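(* For every integer $n \ge 1$ let $\Lambda_{1\times1}(2^n) = 2^{-n/2}\mathbb{Z} \times 2^{-n/2}\mathbb{Z} \subset \mathbb{R}^2$ (the scaled von Neumann lattice of density $2^n$), and let $A_{1\times1}(2^n)$ and $B_{1\times1}(2^n)$ denote the sharp lower and upper spectral bounds of the Gaussian Gabor frame operator $S_{\Lambda_{1\times1}(2^n)}$ on $L^2(\mathbb{R})$. Then for every integer $n\ge 1$ $$B_{1\times1}(2^{n+1}) = \frac{A_{1\times1}(2^n)+B_{1\times1}(2^n)}{2} \quad\text{and}\quad A_{1\times1}(2^{n+1}) = \sqrt{A_{1\times1}(2^n)\, B_{1\times1}(2^n)} .$$ Moreover $B_{1\times1}(2)/A_{1\times1}(2) = \sqrt{2}$, and $$A_{1\times1}(2) = G = \frac{1}{\mathsf{ag}_2(\sqrt{2},1)} = \theta_4(e^{-\pi})^2 = 0.8346\ldots,$$ where $G$ is Gauss' constant, $\mathsf{ag}_2$ is the classical arithmetic-geometric mean and $\theta_4$ is the Jacobi theta constant.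
   Context: Inner product and norm on $L^2(\mathbb{R})$: $\langle f,g\rangle = \int_{\mathbb{R}} f(t)\overline{g(t)}\,dt$, $\|f\|_2^2=\langle f,f\rangle$. Time-frequency shifts: for $(x,\omega)\in\mathbb{R}^2$, $\pi(x,\omega) f(t) = e^{2\pi i \omega t} f(t-x)$. Normalized Gaussian: $\varphi(t) = 2^{1/4}e^{-\pi t^2}$, so $\|\varphi\|_2=1$. Lattices: a lattice is $\Lambda = M\mathbb{Z}^2$ with $M\in \mathrm{GL}(2,\mathbb{R})$; its co-volume is $\mathrm{vol}(\Lambda)=|\det M|$ and its density is $\mathrm{vol}(\Lambda)^{-1}$. Gaussian Gabor frame operator (normalized by the co-volume): $S_\Lambda f = \mathrm{vol}(\Lambda)\sum_{\lambda\in\Lambda}\langle f,\pi(\lambda)\varphi\rangle\,\pi(\lambda)\varphi$ for $f \in L^2(\mathbb{R})$. Its sharp spectral bounds are the largest constant $A_\Lambda$ and the smallest constant $B_\Lambda$ such that $A_\Lambda\|f\|_2^2\le \langle S_\Lambda f,f\rangle = \mathrm{vol}(\Lambda)\sum_{\lambda\in\Lambda}|\langle f,\pi(\lambda)\varphi\rangle|^2\le B_\Lambda\|f\|_2^2$ for all $f\in L^2(\mathbb{R})$. Arithmetic-geometric mean: for reals $a_0>b_0>0$, $\mathsf{ag}_2(a_0,b_0)$ is the common limit of the sequences $a_{n+1}=\frac{a_n+b_n}{2}$, $b_{n+1}=\sqrt{a_nb_n}$. Theta constant: $\theta_4(q)=\sum_{k\in\mathbb{Z}}(-1)^kq^{k^2}$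 for $0<|q|<1$. Gauss' constant: $G=\varpi/\pi$, the ratio of the arc length $2\varpi = 4\int_0^{\pi/2}\frac{dx}{\sqrt{2\left(1-\frac12\sin(x)^2\right)}}$ of the lemniscate of Bernoulli to the arc length $2\pi$ of the unit circle. *)

theory Defs
  imports "HOL-Analysis.Analysis"
begin

section \<open>Square-integrable functions and time-frequency shifts\<close>

text \<open>
  Elements of \<open>L\<^sup>2(\<real>)\<close> are represented by Borel functions, not by classes modulo null sets;
  everything below depends on the representatives only up to null sets.
\<close>

definition L2 :: "(real \<Rightarrow> complex) set" where
  "L2 = {f. f \<in> borel_measurable lborel \<and> integrable lborel (\<lambda>t. (cmod (f t))\<^sup>2)}"

definition l2_inner :: "(real \<Rightarrow> complex) \<Rightarrow> (real \<Rightarrow> complex) \<Rightarrow> complex" where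
  "l2_inner f g = (LINT t|lborel. f t * cnj (g t))"

definition l2_norm :: "(real \<Rightarrow> complex) \<Rightarrow> real" where
  "l2_norm f = sqrt (Re (l2_inner f f))"

text \<open>A point \<open>(x, \<omega>)\<close> of the time-frequency plane is a vector with \<open>z $ 1 = x\<close>, \<open>z $ 2 = \<omega>\<close>.\<close>

definition tf_shift :: "real ^ 2 \<Rightarrow> (real \<Rightarrow> complex) \<Rightarrow> real \<Rightarrow> complex" where
  "tf_shift z f t = exp (2 * of_real pi * \<i> * of_real (z $ 2 * t)) * f (t - z $ 1)"

definition gaussian :: "real \<Rightarrow> complex" where
  "gaussian t = of_real (2 powr (1/4) * exp (- pi * t\<^sup>2))"

section \<open>Lattices\<close>

definition lattice_of :: "real ^ 2 ^ 2 \<Rightarrow> (real ^ 2) set" where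
  "lattice_of M = (*v) M ` {k. \<forall>i. k $ i \<in> \<int>}"

definition covolume :: "(real ^ 2) set \<Rightarrow> real" where
  "covolume \<Lambda> = (THE v. \<exists>M. det M \<noteq> 0 \<and> \<Lambda> = lattice_of M \<and> v = \<bar>det M\<bar>)"

lemma lattice_of_subset_imp_det:
  fixes M N :: "real ^ 2 ^ 2"
  assumes "lattice_of N \<subseteq> lattice_of M"
  shows "\<exists>d\<in>\<int>. det N = det M * d"
proof -
  have "\<exists>k. (\<forall>j. k $ j \<in> \<int>) \<and> column i N = M *v k" for i
  proof -
    have "column i N = N *v axis i 1"
      by (simp add: matrix_vector_mult_basis)
    moreover have "\<forall>j. (axis i 1 :: real ^ 2) $ j \<in> \<int>"
      by (simp add: axis_def)
    ultimately have "column i N \<in> lattice_of N"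
      unfolding lattice_of_def by blast
    then show ?thesis
      using assms unfolding lattice_of_def by blast
  qed
  then obtain u where u: "\<And>i j. u i $ j \<in> \<int>" "\<And>i. column i N = M *v u i"
    by metis
  define U :: "real ^ 2 ^ 2" where "U = (\<chi> i j. u j $ i)"
  have "N = M ** U"
    using u(2)
    by (simp add: vec_eq_iff column_def U_def matrix_matrix_mult_def matrix_vector_mult_def)
  then have "det N = det M * det U"
    by (simp add: det_mul)
  moreover have "det U \<in> \<int>"
    using u(1) by (simp add: det_2 U_def)
  ultimately show ?thesis by blast
qed

lemma covolume_lattice_of:
  assumes "det M \<noteq> 0"
  shows "covolume (lattice_of M) = \<bar>det M\<bar>"
  unfolding covolume_def
proof (rule the_equality)
  show "\<exists>M'. det M' \<noteq> 0 \<and> lattice_of M = lattice_of M' \<and> \<bar>det M\<bar> = \<bar>det M'\<bar>"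
    using assms by blast
next
  fix v assume "\<exists>N. det N \<noteq> 0 \<and> lattice_of M = lattice_of N \<and> v = \<bar>det N\<bar>"
  then obtain N where N: "det N \<noteq> 0" "lattice_of M = lattice_of N" "v = \<bar>det N\<bar>"
    by blast
  obtain d where d: "d \<in> \<int>" "det N = det M * d"
    using lattice_of_subset_imp_det[of N M] N(2) by auto
  obtain e where e: "e \<in> \<int>" "det M = det N * e"
    using lattice_of_subset_imp_det[of M N] N(2) by auto
  have "d * e = 1"
    using d(2) e(2) assms by (auto simp: mult.commute)
  then have de: "\<bar>d\<bar> * \<bar>e\<bar> = 1" and "d \<noteq> 0" "e \<noteq> 0"
    by (auto simp flip: abs_mult)
  then have d1: "\<bar>d\<bar> \<ge> 1" and "\<bar>e\<bar> \<ge> 1"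
    using d(1) e(1) by (auto intro!: Ints_nonzero_abs_ge1)
  then have "\<bar>d\<bar> * 1 \<le> \<bar>d\<bar> * \<bar>e\<bar>"
    by (intro mult_left_mono) auto
  then have "\<bar>d\<bar> = 1"
    using de d1 by linarith
  then show "v = \<bar>det M\<bar>"
    using d(2) N(3) by (simp add: abs_mult)
qed

section \<open>The Gaussian Gabor frame operator and its spectral bounds\<close>

text \<open>
  \<open>S\<^sub>\<Lambda> f\<close> is the (almost everywhere unique) \<open>L\<^sup>2\<close>-limit of the partial sums over the finite
  subsets of \<open>\<Lambda>\<close>, i.e. the series is summed unconditionally in \<open>L\<^sup>2(\<real>)\<close>.
\<close>

definition gabor_partial_sum ::
    "(real ^ 2) set \<Rightarrow> (real ^ 2) set \<Rightarrow> (real \<Rightarrow> complex) \<Rightarrow> real \<Rightarrow> complex" where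
  "gabor_partial_sum \<Lambda> F f t =
     of_real (covolume \<Lambda>) *
       (\<Sum>z\<in>F. l2_inner f (tf_shift z gaussian) * tf_shift z gaussian t)"

definition gabor_frame_operator ::
    "(real ^ 2) set \<Rightarrow> (real \<Rightarrow> complex) \<Rightarrow> real \<Rightarrow> complex" where
  "gabor_frame_operator \<Lambda> f =
     (SOME g. g \<in> L2 \<and>
        ((\<lambda>F. l2_norm (\<lambda>t. gabor_partial_sum \<Lambda> F f t - g t)) \<longlongrightarrow> 0) (finite_subsets_at_top \<Lambda>))"

definition lower_spectral_bound :: "(real ^ 2) set \<Rightarrow> real" where
  "lower_spectral_bound \<Lambda> =
     (GREATEST A. \<forall>f\<in>L2. A * (l2_norm f)\<^sup>2 \<le> Re (l2_inner (gabor_frame_operator \<Lambda> f) f))"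

definition upper_spectral_bound :: "(real ^ 2) set \<Rightarrow> real" where
  "upper_spectral_bound \<Lambda> =
     (LEAST B. \<forall>f\<in>L2. Re (l2_inner (gabor_frame_operator \<Lambda> f) f) \<le> B * (l2_norm f)\<^sup>2)"

section \<open>The scaled von Neumann lattices\<close>

text \<open>The square lattice of density \<open>\<delta>\<close>.\<close>

definition Lambda_1x1 :: "real \<Rightarrow> (real ^ 2) set" where
  "Lambda_1x1 \<delta> = {z. \<forall>i. \<exists>k::int. z $ i = \<delta> powr (- 1/2) * of_int k}"

lemma Lambda_1x1_power2:
  "Lambda_1x1 (2 ^ n) = {z. \<forall>i. \<exists>k::int. z $ i = 2 powr (- real n / 2) * of_int k}"
proof -
  have "(2 ^ n :: real) powr (- 1/2) = 2 powr (- real n / 2)"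
    by (simp add: powr_powr flip: powr_realpow)
  then show ?thesis
    by (simp add: Lambda_1x1_def)
qed

lemma Lambda_1x1_eq_lattice_of: "Lambda_1x1 \<delta> = lattice_of (mat (\<delta> powr (- 1/2)))"
proof -
  have mat: "mat c *v k = (\<chi> i. c * k $ i)" for c :: real and k :: "real ^ 2"
    by (simp add: vec_eq_iff matrix_vector_mult_def mat_def if_distrib[where f = "\<lambda>x. x * _"]
        cong: if_cong)
  show ?thesis
  proof (intro set_eqI iffI)
    fix z assume "z \<in> Lambda_1x1 \<delta>"
    then obtain k :: "2 \<Rightarrow> int" where "\<And>i. z $ i = \<delta> powr (- 1/2) * of_int (k i)"
      unfolding Lambda_1x1_def by (simp, metis)
    then have "z = mat (\<delta> powr (- 1/2)) *v (\<chi> i. of_int (k i))"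
      by (simp add: mat vec_eq_iff)
    moreover have "(\<chi> i. of_int (k i)) \<in> {k :: real ^ 2. \<forall>i. k $ i \<in> \<int>}"
      by simp
    ultimately show "z \<in> lattice_of (mat (\<delta> powr (- 1/2)))"
      unfolding lattice_of_def by blast
  next
    fix z assume "z \<in> lattice_of (mat (\<delta> powr (- 1/2)))"
    then show "z \<in> Lambda_1x1 \<delta>"
      unfolding lattice_of_def Lambda_1x1_def by (auto simp: mat elim!: Ints_cases) 
        (metis Ints_cases)
  qed
qed

lemma covolume_Lambda_1x1:
  assumes "\<delta> > 0"
  shows "covolume (Lambda_1x1 \<delta>) = 1 / \<delta>"
proof -
  have "det (mat (\<delta> powr (- 1/2)) :: real ^ 2 ^ 2) = \<delta> powr (- 1/2) * \<delta> powr (- 1/2)"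
    by (simp add: det_2 mat_def)
  also have "\<dots> = \<delta> powr (- 1)"
    by (simp flip: powr_add)
  also have "\<dots> = 1 / \<delta>"
    using assms by (simp add: powr_minus_divide)
  finally show ?thesis
    using assms by (simp add: Lambda_1x1_eq_lattice_of covolume_lattice_of)
qed

definition A_1x1 :: "real \<Rightarrow> real" where
  "A_1x1 \<delta> = lower_spectral_bound (Lambda_1x1 \<delta>)"

definition B_1x1 :: "real \<Rightarrow> real" where
  "B_1x1 \<delta> = upper_spectral_bound (Lambda_1x1 \<delta>)"

section \<open>Special constants\<close>

fun ag2_iter :: "real \<Rightarrow> real \<Rightarrow> nat \<Rightarrow> real \<times> real" where
  "ag2_iter a b 0 = (a, b)"
| "ag2_iter a b (Suc n) =
     (let (x, y) = ag2_iter a b n in ((x + y) / 2, sqrt (x * y)))"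

definition ag2 :: "real \<Rightarrow> real \<Rightarrow> real" where
  "ag2 a b = (THE l. (\<lambda>n. fst (ag2_iter a b n)) \<longlonglongrightarrow> l \<and> (\<lambda>n. snd (ag2_iter a b n)) \<longlonglongrightarrow> l)"

definition theta4 :: "'a :: real_normed_field \<Rightarrow> 'a" where
  "theta4 q = (\<Sum>\<^sub>\<infinity>k::int. (-1) powi k * q powi (k\<^sup>2))"

definition lemniscate_length :: real where
  "lemniscate_length = 4 * integral {0..pi/2} (\<lambda>x. 1 / sqrt (2 * (1 - 1/2 * (sin x)\<^sup>2)))"

definition gauss_constant :: real where
  "gauss_constant = lemniscate_length / (2 * pi)"

end

theory Submission
  imports Defs "HOL-Probability.Characteristic_Functions"
begin

text \<open>
  For even density \<open>N = 2 K\<close> the quadratic form of the frame operator is computed in Zak coordinates.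
  Write \<open>F(x) = f(N\<^sup>1\<^sup>/\<^sup>2 x)\<close>. Parseval in the modulation index, followed by summation over the translation
  index, gives
  \<open>\<langle>S f, f\<rangle> = N\<^sup>1\<^sup>/\<^sup>2 \<integral>\<^sub>0\<^sup>1 \<theta>(N x) \<Sum>\<^sub>m\<^sub>,\<^sub>n q\<^bsup>(m-n)\<^sup>2\<^esup> F(x + m) cnj (F(x + n)) dx\<close>
  with \<open>q = exp (- \<pi> K)\<close> and \<open>\<theta>(x) = \<Sum>\<^sub>k q\<^bsup>k\<^sup>2\<^esup> cos (2 \<pi> k x)\<close>; evenness of \<open>N\<close> is what decouples the factor
  \<open>\<theta>(N x)\<close> from the Toeplitz form, whose symbol is again \<open>\<theta>\<close>. Hence the spectral bounds are the squares of
  \<open>min \<theta> = \<theta>(1/2) = \<theta>\<^sub>4(q)\<close> and \<open>max \<theta> = \<theta>(0) = \<theta>\<^sub>3(q)\<close>. Doubling \<open>N\<close> squares \<open>q\<close>, and the duplication formulas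
  of \<open>\<theta>\<^sub>3\<close> and \<open>\<theta>\<^sub>4\<close> are the arithmetic-geometric mean recursion. Since \<open>\<theta>\<^sub>3, \<theta>\<^sub>4 \<rightarrow> 1\<close> as \<open>q \<rightarrow> 0\<close>, the iteration started
  from the ratio \<open>sqrt 2\<close> at \<open>q = e\<^sup>-\<^sup>\<pi>\<close> evaluates \<open>ag\<^sub>2(sqrt 2, 1)\<close>, and Landen's transformation identifies the
  result with the lemniscate integral.
\<close>

section \<open>The arithmetic-geometric mean and elliptic integrals\<close>


text \<open>\<open>gabor_frame_operator\<close> is defined by \<open>SOME\<close>, so nothing is
  known about it until the frame series is shown to converge in \<open>L2\<close>. Convergence rests
  on a Bessel bound, which therefore has to be proved for finite sums of coefficients alone. The Zak
  formula is used only for functions of bounded support, where the sums over \<open>m\<close> and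
  \<open>n\<close> are finite; truncation then carries the Bessel bound and the lower bound over to
  all of \<open>L2\<close>. The two theta factors live on independent variables, the position and
  the variable dual to integer translation. This is why their extreme values multiply, and why
  sharpness asks for concentration in both variables at once. The position of the minimum of
  \<theta> is obtained from the smallness of q: every density considered has s = pi K \<ge> 3, and
  then the first harmonic outweighs all the others. Poisson summation for Gaussians enters twice: it
  evaluates the sums over translated windows, and it relates s to pi^2/s, which produces the
  starting ratio \<open>sqrt 2\<close>. It is derived by comparing Fourier coefficients of two
  continuous periodic functions, with Parseval as the uniqueness statement.\<close>

definition agm_integrand :: "real \<Rightarrow> real \<Rightarrow> real \<Rightarrow> real" where
  "agm_integrand a b x = 1 / sqrt (a\<^sup>2 * (cos x)\<^sup>2 + b\<^sup>2 * (sin x)\<^sup>2)"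

lemma agm_radicand_pos:
  fixes a b x :: real
  assumes "a > 0" "b > 0"
  shows "a\<^sup>2 * (cos x)\<^sup>2 + b\<^sup>2 * (sin x)\<^sup>2 > 0"
proof (cases "cos x = 0")
  case True
  then have "sin x \<noteq> 0" by (metis cos_zero_iff_int sin_cos_squared_add power_zero_numeral add_0 zero_neq_one)
  with assms show ?thesis by (simp add: True)
next
  case False
  with assms show ?thesis by (simp add: add_pos_nonneg)
qed

lemma continuous_on_agm_integrand [continuous_intros]:
  assumes "a > 0" "b > 0"
  shows "continuous_on S (agm_integrand a b)"
  unfolding agm_integrand_def
  using agm_radicand_pos[OF assms]
  by (auto intro!: continuous_intros simp: less_le)

text \<open>Sine and cosine enter only through their squares, so the integrand is symmetric about
  pi/2. The doubled interval is needed because Landen's substitution maps [0, pi/2] onto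
  [0, pi].\<close>

lemma agm_integral_upto_pi:
  assumes "a > 0" "b > 0"
  shows "integral {0..pi} (agm_integrand a b) = 2 * integral {0..pi/2} (agm_integrand a b)"
proof -
  let ?f = "agm_integrand a b"
  have int: "?f integrable_on {c..d}" for c d
    by (intro integrable_continuous_interval continuous_on_agm_integrand assms)
  have "((\<lambda>x. - 1 *\<^sub>R ?f (pi - x)) has_integral integral {pi - 0..pi - pi/2} ?f - integral {pi - pi/2 .. pi - 0} ?f) {0..pi/2}"
    by (rule has_integral_substitution_general[where s="{}" and c=0 and d=pi])
      (auto intro!: continuous_intros continuous_on_agm_integrand assms DERIV_cong[OF DERIV_diff[OF DERIV_const DERIV_ident]])
  then have "((\<lambda>x. - ?f x) has_integral - integral {pi/2..pi} ?f) {0..pi/2}"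
    by (simp add: agm_integrand_def)
  then have "integral {pi/2..pi} ?f = integral {0..pi/2} ?f"
    using has_integral_neg_iff[of ?f _ "{0..pi/2}"] by (auto dest: integral_unique)
  moreover have "integral {0..pi/2} ?f + integral {pi/2..pi} ?f = integral {0..pi} ?f"
    by (rule Henstock_Kurzweil_Integration.integral_combine) (auto intro: int)
  ultimately show ?thesis by simp
qed

text \<open>
  Landen's transformation in Gauss' form: for \<open>\<psi>\<close> with \<open>tan (\<psi> - x) = (b / a) tan x\<close> the integrand
  of the arithmetic and geometric means at \<open>\<psi>\<close> pulls back to twice the original integrand.
  The arctangent below is a formula for \<open>\<psi>\<close> without singularities.
\<close>
lemma agm_integral_step:
  assumes a: "a > 0" and b: "b > 0"
  shows "integral {0..pi/2} (agm_integrand ((a + b) / 2) (sqrt (a * b))) = integral {0..pi/2} (agm_integrand a b)"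
proof -
  let ?g = "agm_integrand ((a + b) / 2) (sqrt (a * b))"
  have pos: "(a + b) / 2 > 0" "sqrt (a * b) > 0" using a b by auto
  define d where "d x = a * (cos x)\<^sup>2 + b * (sin x)\<^sup>2" for x
  \<comment> \<open>\<open>u x\<close> is tan (2 x - \<psi> x): apply the subtraction formula to x
    and \<psi> - x, using tan (\<psi> - x) = (b / a) tan x, and multiply numerator and denominator
    by a cos^2 x. The new denominator \<open>d x\<close> never vanishes.\<close>
  define u where "u x = (a - b) * sin x * cos x / d x" for x
  define \<psi> where "\<psi> x = 2 * x - arctan (u x)" for x
  define r where "r x = a\<^sup>2 * (cos x)\<^sup>2 + b\<^sup>2 * (sin x)\<^sup>2" for x
  have d: "d x > 0" for x
    using agm_radicand_pos[of "sqrt a" "sqrt b" x] a b by (simp add: d_def)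
  have r: "r x > 0" for x
    using agm_radicand_pos[OF a b] by (simp add: r_def)
  have cs: "(cos x)\<^sup>2 = 1 - (sin x)\<^sup>2" for x :: real
    by (simp add: cos_squared_eq)
  \<comment> \<open>Both sides are the squared modulus of a cos x + i b sin x, on the left after
    multiplication by cos x - i sin x. Multiplying by cos x + i sin x instead gives the numerators
    of \<open>cos2\<close> and \<open>sin2\<close>, since \<psi> is x plus the argument of a cos x +
    i b sin x.\<close>
  have du: "(d x)\<^sup>2 + ((a - b) * sin x * cos x)\<^sup>2 = r x" for x
    unfolding d_def r_def power_mult_distrib cs by (simp add: power2_eq_square algebra_simps)
  have u1: "1 + (u x)\<^sup>2 = r x / (d x)\<^sup>2" for x
    using d[of x] du[of x] by (simp add: u_def power_divide field_simps)
  have sqrtu: "sqrt (1 + (u x)\<^sup>2) = sqrt (r x) / d x" for x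
    using d[of x] by (simp add: u1 real_sqrt_divide)
  have sin2: "sin (\<psi> x) = (a + b) * sin x * cos x / sqrt (r x)" for x
  proof -
    have "sin (\<psi> x) = (2 * sin x * cos x - (1 - 2 * (sin x)\<^sup>2) * u x) / sqrt (1 + (u x)\<^sup>2)"
      unfolding \<psi>_def sin_diff cos_arctan sin_arctan sin_double cos_double_sin by (simp add: diff_divide_distrib)
    also have "\<dots> = (2 * sin x * cos x * d x - (1 - 2 * (sin x)\<^sup>2) * ((a - b) * sin x * cos x)) / sqrt (r x)"
      unfolding sqrtu using d[of x] r[of x] by (simp add: u_def field_simps)
    also have "2 * sin x * cos x * d x - (1 - 2 * (sin x)\<^sup>2) * ((a - b) * sin x * cos x) = (a + b) * sin x * cos x"
      unfolding d_def cs by (simp add: algebra_simps power2_eq_square)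
    finally show ?thesis .
  qed
  have cos2: "cos (\<psi> x) = (a * (cos x)\<^sup>2 - b * (sin x)\<^sup>2) / sqrt (r x)" for x
  proof -
    have "cos (\<psi> x) = ((1 - 2 * (sin x)\<^sup>2) + (2 * sin x * cos x) * u x) / sqrt (1 + (u x)\<^sup>2)"
      unfolding \<psi>_def cos_diff cos_arctan sin_arctan sin_double cos_double_sin by (simp add: add_divide_distrib)
    also have "\<dots> = ((1 - 2 * (sin x)\<^sup>2) * d x + 2 * (a - b) * (sin x)\<^sup>2 * (cos x)\<^sup>2) / sqrt (r x)"
      unfolding sqrtu using d[of x] r[of x] by (simp add: u_def field_simps power2_eq_square)
    also have "(1 - 2 * (sin x)\<^sup>2) * d x + 2 * (a - b) * (sin x)\<^sup>2 * (cos x)\<^sup>2 = a * (cos x)\<^sup>2 - b * (sin x)\<^sup>2"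
      unfolding d_def cs by (simp add: algebra_simps power2_eq_square)
    finally show ?thesis .
  qed
  have rad: "((a + b) / 2)\<^sup>2 * (cos (\<psi> x))\<^sup>2 + (sqrt (a * b))\<^sup>2 * (sin (\<psi> x))\<^sup>2 = ((a + b) * d x / (2 * sqrt (r x)))\<^sup>2" for x
  proof -
    have "((a + b) / 2)\<^sup>2 * (cos (\<psi> x))\<^sup>2 + (sqrt (a * b))\<^sup>2 * (sin (\<psi> x))\<^sup>2 =
        (a + b)\<^sup>2 * ((a * (cos x)\<^sup>2 - b * (sin x)\<^sup>2)\<^sup>2 + 4 * a * b * (sin x)\<^sup>2 * (cos x)\<^sup>2) / (4 * r x)"
    proof -
      have "(sqrt (r x))\<^sup>2 = r x" "(sqrt (a * b))\<^sup>2 = a * b"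
        using a b r[of x] by auto
      then have "((a + b) / 2)\<^sup>2 * (cos (\<psi> x))\<^sup>2 + (sqrt (a * b))\<^sup>2 * (sin (\<psi> x))\<^sup>2 =
          (a + b)\<^sup>2 / 4 * ((a * (cos x)\<^sup>2 - b * (sin x)\<^sup>2)\<^sup>2 / r x) +
          a * b * ((a + b)\<^sup>2 * (sin x)\<^sup>2 * (cos x)\<^sup>2 / r x)"
        unfolding sin2 cos2 power_divide power_mult_distrib by simp
      also have "\<dots> = (a + b)\<^sup>2 * ((a * (cos x)\<^sup>2 - b * (sin x)\<^sup>2)\<^sup>2 + 4 * a * b * (sin x)\<^sup>2 * (cos x)\<^sup>2) / (4 * r x)"
        using r[of x] by (simp add: divide_simps) (simp add: algebra_simps)
      finally show ?thesis .
    qed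
    also have "(a * (cos x)\<^sup>2 - b * (sin x)\<^sup>2)\<^sup>2 + 4 * a * b * (sin x)\<^sup>2 * (cos x)\<^sup>2 = (d x)\<^sup>2"
      by (simp add: d_def power2_eq_square algebra_simps)
    finally show ?thesis using r[of x] by (simp add: power_divide power_mult_distrib)
  qed
  have g\<psi>: "?g (\<psi> x) = 2 * sqrt (r x) / ((a + b) * d x)" for x
    unfolding agm_integrand_def rad using a b d[of x] r[of x] by (simp add: abs_mult abs_of_pos)
  have deriv: "(\<psi> has_real_derivative (a + b) * d x / r x) (at x)" for x
  proof -
    have dd: "(d has_real_derivative - 2 * (a - b) * sin x * cos x) (at x)"
      unfolding d_def by (auto intro!: derivative_eq_intros simp: algebra_simps)
    have dn: "((\<lambda>x. (a - b) * sin x * cos x) has_real_derivative (a - b) * ((cos x)\<^sup>2 - (sin x)\<^sup>2)) (at x)"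
      by (auto intro!: derivative_eq_intros simp: algebra_simps power2_eq_square)
    have "(u has_real_derivative ((a - b) * ((cos x)\<^sup>2 - (sin x)\<^sup>2) * d x
        - (a - b) * sin x * cos x * (- 2 * (a - b) * sin x * cos x)) / (d x * d x)) (at x)"
      unfolding u_def using d[of x] by (intro DERIV_divide dn dd) simp
    also have "((a - b) * ((cos x)\<^sup>2 - (sin x)\<^sup>2) * d x
        - (a - b) * sin x * cos x * (- 2 * (a - b) * sin x * cos x)) / (d x * d x)
        = ((a - b) * ((cos x)\<^sup>2 - (sin x)\<^sup>2) * d x + 2 * ((a - b) * sin x * cos x)\<^sup>2) / (d x)\<^sup>2"
      by (simp add: power2_eq_square algebra_simps)
    finally have du': "(u has_real_derivative ((a - b) * ((cos x)\<^sup>2 - (sin x)\<^sup>2) * d x + 2 * ((a - b) * sin x * cos x)\<^sup>2) / (d x)\<^sup>2) (at x)" .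
    have "(\<psi> has_real_derivative 2 - inverse (1 + (u x)\<^sup>2) *
        (((a - b) * ((cos x)\<^sup>2 - (sin x)\<^sup>2) * d x + 2 * ((a - b) * sin x * cos x)\<^sup>2) / (d x)\<^sup>2)) (at x)"
      unfolding \<psi>_def by (intro DERIV_diff DERIV_chain2[where f=arctan, OF DERIV_arctan du'] DERIV_cmult_Id)
    also have "2 - inverse (1 + (u x)\<^sup>2) *
        (((a - b) * ((cos x)\<^sup>2 - (sin x)\<^sup>2) * d x + 2 * ((a - b) * sin x * cos x)\<^sup>2) / (d x)\<^sup>2)
        = (2 * r x - ((a - b) * ((cos x)\<^sup>2 - (sin x)\<^sup>2) * d x + 2 * ((a - b) * sin x * cos x)\<^sup>2)) / r x"
      unfolding u1 using d[of x] r[of x] by (simp add: field_simps)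
    also have "2 * r x - ((a - b) * ((cos x)\<^sup>2 - (sin x)\<^sup>2) * d x + 2 * ((a - b) * sin x * cos x)\<^sup>2) = (a + b) * d x"
      unfolding d_def r_def power_mult_distrib cs by (simp add: algebra_simps power2_eq_square)
    finally show ?thesis .
  qed
  have \<psi>0: "\<psi> 0 = 0" and \<psi>1: "\<psi> (pi / 2) = pi"
    by (simp_all add: \<psi>_def u_def)
  have mono: "\<psi> x \<le> \<psi> y" if "x \<le> y" for x y
    using that by (rule DERIV_nonneg_imp_nondecreasing) (use deriv a b d r in \<open>force intro: exI less_imp_le\<close>)
  have "((\<lambda>x. ((a + b) * d x / r x) *\<^sub>R ?g (\<psi> x)) has_integral integral {\<psi> 0..\<psi> (pi / 2)} ?g) {0..pi / 2}"
  proof (rule has_integral_substitution[where c=0 and d=pi])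
    show "\<psi> ` {0..pi / 2} \<subseteq> {0..pi}"
      using mono[of 0] mono[of _ "pi / 2"] \<psi>0 \<psi>1 by auto
    show "continuous_on {0..pi} ?g"
      by (intro continuous_on_agm_integrand pos)
    show "(\<psi> has_real_derivative (a + b) * d x / r x) (at x within {0..pi / 2})" for x
      using deriv has_field_derivative_at_within by blast
  qed (use \<psi>0 \<psi>1 in auto)
  also have "(\<lambda>x. ((a + b) * d x / r x) *\<^sub>R ?g (\<psi> x)) = (\<lambda>x. 2 * agm_integrand a b x)"
  proof
    fix x
    have "(a + b) * d x / r x * (2 * sqrt (r x) / ((a + b) * d x)) = 2 * (sqrt (r x) / r x)"
      using d[of x] a b by simp
    also have "sqrt (r x) / r x = 1 / sqrt (r x)"
      using r[of x] by (simp add: field_simps)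
    finally show "((a + b) * d x / r x) *\<^sub>R ?g (\<psi> x) = 2 * agm_integrand a b x"
      by (simp add: g\<psi>) (simp add: agm_integrand_def r_def)
  qed
  finally have "integral {0..pi / 2} (\<lambda>x. 2 * agm_integrand a b x) = integral {0..pi} ?g"
    unfolding \<psi>0 \<psi>1 by (rule integral_unique)
  then show ?thesis
    by (simp add: agm_integral_upto_pi[OF pos])
qed

lemma agm_integral_bounds:
  assumes "0 < b" "b \<le> a"
  shows "pi / (2 * a) \<le> integral {0..pi/2} (agm_integrand a b)"
    and "integral {0..pi/2} (agm_integrand a b) \<le> pi / (2 * b)"
proof -
  have a: "a > 0" using assms by simp
  have int: "agm_integrand a b integrable_on {0..pi/2}"
    by (intro integrable_continuous_interval continuous_on_agm_integrand a assms)
  have rad: "b\<^sup>2 \<le> a\<^sup>2 * (cos x)\<^sup>2 + b\<^sup>2 * (sin x)\<^sup>2" "a\<^sup>2 * (cos x)\<^sup>2 + b\<^sup>2 * (sin x)\<^sup>2 \<le> a\<^sup>2" for x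
  proof -
    have "b\<^sup>2 \<le> a\<^sup>2" using assms by (simp add: power_mono)
    then have "b\<^sup>2 * (cos x)\<^sup>2 \<le> a\<^sup>2 * (cos x)\<^sup>2" "b\<^sup>2 * (sin x)\<^sup>2 \<le> a\<^sup>2 * (sin x)\<^sup>2"
      by (auto intro: mult_right_mono)
    moreover have "c * (cos x)\<^sup>2 + c * (sin x)\<^sup>2 = c" for c
      by (metis distrib_left mult.right_neutral sin_cos_squared_add2)
    ultimately show "b\<^sup>2 \<le> a\<^sup>2 * (cos x)\<^sup>2 + b\<^sup>2 * (sin x)\<^sup>2" "a\<^sup>2 * (cos x)\<^sup>2 + b\<^sup>2 * (sin x)\<^sup>2 \<le> a\<^sup>2"
      by (metis add_le_cancel_right, metis add_le_cancel_left)
  qed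
  have bd: "1 / a \<le> agm_integrand a b x" "agm_integrand a b x \<le> 1 / b" for x
  proof -
    have "b \<le> sqrt (a\<^sup>2 * (cos x)\<^sup>2 + b\<^sup>2 * (sin x)\<^sup>2)" "sqrt (a\<^sup>2 * (cos x)\<^sup>2 + b\<^sup>2 * (sin x)\<^sup>2) \<le> a"
      using rad[of x] a by (auto intro: real_le_rsqrt real_le_lsqrt)
    moreover have "0 < sqrt (a\<^sup>2 * (cos x)\<^sup>2 + b\<^sup>2 * (sin x)\<^sup>2)"
      using agm_radicand_pos[OF a assms(1)] by simp
    ultimately show "1 / a \<le> agm_integrand a b x" "agm_integrand a b x \<le> 1 / b"
      using assms by (auto simp: agm_integrand_def intro!: divide_left_mono mult_pos_pos)
  qed
  have c: "integral {0..pi/2} (\<lambda>_. c) = pi / 2 * c" "(\<lambda>_. c) integrable_on {0..pi/2}" for c :: real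
    by (auto intro: integrable_continuous_interval)
  show "pi / (2 * a) \<le> integral {0..pi/2} (agm_integrand a b)"
    using integral_le[OF c(2) int, of "1 / a"] bd c(1)[of "1/a"] by simp
  show "integral {0..pi/2} (agm_integrand a b) \<le> pi / (2 * b)"
    using integral_le[OF int c(2), of "1 / b"] bd c(1)[of "1/b"] by simp
qed

section \<open>Limits of the arithmetic-geometric iteration\<close>

lemma ag2_eqI:
  assumes "(\<lambda>n. fst (ag2_iter a b n)) \<longlonglongrightarrow> l" "(\<lambda>n. snd (ag2_iter a b n)) \<longlonglongrightarrow> l"
  shows "ag2 a b = l"
  unfolding ag2_def using assms by (auto intro: LIMSEQ_unique)

lemma ag2_iter_pos:
  assumes "0 < b" "b \<le> a"
  shows "0 < snd (ag2_iter a b n) \<and> snd (ag2_iter a b n) \<le> fst (ag2_iter a b n)"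
proof (induction n)
  case (Suc n)
  then show ?case
    using arith_geo_mean_sqrt[of "fst (ag2_iter a b n)" "snd (ag2_iter a b n)"]
    by (auto simp: case_prod_unfold Let_def)
qed (use assms in auto)

lemma agm_integral_ag2_iter:
  assumes "0 < b" "b \<le> a"
  shows "integral {0..pi/2} (agm_integrand (fst (ag2_iter a b n)) (snd (ag2_iter a b n)))
    = integral {0..pi/2} (agm_integrand a b)"
proof (induction n)
  case (Suc n)
  have "0 < fst (ag2_iter a b n)" "0 < snd (ag2_iter a b n)"
    using ag2_iter_pos[OF assms, of n] by auto
  from agm_integral_step[OF this] Suc show ?case
    by (simp add: case_prod_unfold Let_def)
qed auto

text \<open>The integral is constant along the iteration and squeezed between pi / (2 a_n) and pi /
  (2 b_n), which share the limit pi / (2 l).\<close>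

lemma agm_integral_limit:
  assumes ab: "0 < b" "b \<le> a" and "l > 0"
    and "(\<lambda>n. fst (ag2_iter a b n)) \<longlonglongrightarrow> l" "(\<lambda>n. snd (ag2_iter a b n)) \<longlonglongrightarrow> l"
  shows "integral {0..pi/2} (agm_integrand a b) = pi / (2 * l)"
proof (rule antisym)
  let ?I = "integral {0..pi/2} (agm_integrand a b)"
  have bd: "pi / (2 * fst (ag2_iter a b n)) \<le> ?I" "?I \<le> pi / (2 * snd (ag2_iter a b n))" for n
    using agm_integral_bounds ag2_iter_pos[OF ab, of n] agm_integral_ag2_iter[OF ab, of n] by metis+
  have "(\<lambda>n. pi / (2 * fst (ag2_iter a b n))) \<longlonglongrightarrow> pi / (2 * l)" "(\<lambda>n. pi / (2 * snd (ag2_iter a b n))) \<longlonglongrightarrow> pi / (2 * l)"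
    using assms by (auto intro!: tendsto_intros)
  with bd show "pi / (2 * l) \<le> ?I" "?I \<le> pi / (2 * l)"
    by (auto intro: LIMSEQ_le_const LIMSEQ_le_const2)
qed

text \<open>The lemniscate radicand 2 - sin^2 x equals 2 cos^2 x + sin^2 x, so the arc length is
  four times Gauss' integral with means sqrt 2 and 1.\<close>

lemma gauss_constant_eq:
  assumes "l > 0"
    and "(\<lambda>n. fst (ag2_iter (sqrt 2) 1 n)) \<longlonglongrightarrow> l" "(\<lambda>n. snd (ag2_iter (sqrt 2) 1 n)) \<longlonglongrightarrow> l"
  shows "gauss_constant = 1 / l"
proof -
  have "(\<lambda>x. 1 / sqrt (2 * (1 - 1/2 * (sin x)\<^sup>2))) = agm_integrand (sqrt 2) 1"
    by (auto simp: agm_integrand_def cos_squared_eq algebra_simps fun_eq_iff)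
  then have "lemniscate_length = 4 * (pi / (2 * l))"
    using agm_integral_limit[of 1 "sqrt 2" l] assms by (simp add: lemniscate_length_def)
  then show ?thesis by (simp add: gauss_constant_def field_simps)
qed

lemma ag2_iter_antimono:
  assumes "0 < b" "b \<le> a"
  shows "fst (ag2_iter a b (Suc n)) \<le> fst (ag2_iter a b n)"
    and "snd (ag2_iter a b n) \<le> snd (ag2_iter a b (Suc n))"
proof -
  have *: "0 < snd (ag2_iter a b n)" "snd (ag2_iter a b n) \<le> fst (ag2_iter a b n)"
    using ag2_iter_pos[OF assms] by auto
  show "fst (ag2_iter a b (Suc n)) \<le> fst (ag2_iter a b n)"
    using * by (simp add: case_prod_unfold Let_def)
  show "snd (ag2_iter a b n) \<le> snd (ag2_iter a b (Suc n))"
    using * by (auto simp: case_prod_unfold Let_def power2_eq_square intro!: real_le_rsqrt mult_right_mono)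
qed

lemma ag2_limit_bounds:
  assumes "0 < b" "b \<le> a"
    and "(\<lambda>n. fst (ag2_iter a b n)) \<longlonglongrightarrow> l" "(\<lambda>n. snd (ag2_iter a b n)) \<longlonglongrightarrow> l"
  shows "snd (ag2_iter a b n) \<le> l" "l \<le> fst (ag2_iter a b n)"
  using incseq_le[OF incseq_SucI assms(4)] decseq_ge[OF decseq_SucI assms(3)] ag2_iter_antimono[OF assms(1,2)]
  by blast+

text \<open>The second step of the iteration already suffices: its geometric mean \<open>v\<close>
  is at least 1.1981 and its arithmetic mean at most 1.19816, and the limit lies between the two.
  The square roots are enclosed by squaring rational bounds.\<close>

lemma ag2_sqrt2_bounds:
  assumes "(\<lambda>n. fst (ag2_iter (sqrt 2) 1 n)) \<longlonglongrightarrow> l" "(\<lambda>n. snd (ag2_iter (sqrt 2) 1 n)) \<longlonglongrightarrow> l"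
  shows "0.8346 \<le> 1 / l" "1 / l < 0.8347"
proof -
  define s where "s = sqrt 2"
  define t where "t = sqrt s"
  define v where "v = sqrt ((s + 1) / 2 * t)"
  have s: "1.414213 \<le> s" "s \<le> 1.414214"
    unfolding s_def by (rule real_le_rsqrt real_le_lsqrt; simp add: power2_eq_square)+
  have t: "1.189206 \<le> t" "t \<le> 1.189208"
    using s unfolding t_def by - (rule real_le_rsqrt real_le_lsqrt; simp add: power2_eq_square)+
  have "1.2071065 * 1.189206 \<le> (s + 1) / 2 * t"
    using s t by (intro mult_mono) auto
  then have v: "1.1981 \<le> v"
    unfolding v_def by (intro real_le_rsqrt) (simp add: power2_eq_square)
  have "ag2_iter s 1 2 = (((s + 1) / 2 + t) / 2, v)"
    by (simp add: numeral_2_eq_2 t_def v_def)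
  then have "v \<le> l" "l \<le> ((s + 1) / 2 + t) / 2"
    using ag2_limit_bounds[of 1 s l 2] assms by (auto simp: s_def)
  then have "11981 / 10000 \<le> l" "l \<le> 119816 / 100000"
    using v s t by (simp_all add: field_simps)
  then show "0.8346 \<le> 1 / l" "1 / l < 0.8347"
    by (auto simp: field_simps)
qed

section \<open>Theta series\<close>


text \<open>With nome q = exp (-s), the value at 0 is \<theta>_3 and the value at 1/2 is \<theta>_4.
  In the parameter s duplication reads s to 2 s and Poisson summation s to pi^2/s; the cosine form
  keeps the values real, so they can be compared.\<close>

definition gtheta :: "real \<Rightarrow> real \<Rightarrow> real" where
  "gtheta s x = (\<Sum>\<^sub>\<infinity>k::int. exp (- s * (of_int k)\<^sup>2) * cos (2 * pi * of_int k * x))"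

text \<open>Unconditional sums over the integers suit reindexing, series over the naturals suit
  estimates; evenness of the summand connects the two.\<close>

lemma has_sum_int_symmetric:
  fixes f :: "int \<Rightarrow> 'a :: banach"
  assumes "summable (\<lambda>n. norm (f (int (Suc n))))" and even: "\<And>k. f (- k) = f k"
  shows "(f has_sum (f 0 + 2 *\<^sub>R (\<Sum>n. f (int (Suc n))))) UNIV"
proof -
  let ?S = "\<Sum>n. f (int (Suc n))"
  have s: "((\<lambda>n. f (int (Suc n))) has_sum ?S) UNIV"
    by (intro norm_summable_imp_has_sum assms(1) summable_sums summable_norm_cancel[OF assms(1)])
  have "bij_betw (\<lambda>n. int (Suc n)) UNIV {0<..}" "bij_betw (\<lambda>n. - int (Suc n)) UNIV {..<0}"
    by (rule bij_betwI[where g="\<lambda>k. nat (k - 1)"]; force)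
       (rule bij_betwI[where g="\<lambda>k. nat (- k - 1)"]; force)
  from has_sum_reindex_bij_betw[OF this(1), of f ?S] has_sum_reindex_bij_betw[OF this(2), of f ?S]
  have "(f has_sum ?S) {0<..}" "(f has_sum ?S) {..<0}"
    using s even[of "1 + int _"] by (auto simp: even)
  moreover have "(f has_sum f 0) {0}"
    by (rule has_sum_finiteI) auto
  ultimately have "(f has_sum (f 0 + (?S + ?S))) ({0} \<union> ({0<..} \<union> {..<0}))"
    by (intro has_sum_Un_disjoint) auto
  also have "{0} \<union> ({0<..} \<union> {..<0}) = (UNIV :: int set)" by auto
  finally show ?thesis by (simp add: scaleR_2)
qed

lemma summable_gauss_weight:
  assumes "s > 0"
  shows "summable (\<lambda>n. exp (- s * (real (Suc n))\<^sup>2))"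
    and "(\<Sum>n. exp (- s * (real (Suc n))\<^sup>2)) \<le> exp (- s) / (1 - exp (- s))"
proof -
  define q where "q = exp (- s)"
  have q: "0 < q" "q < 1" using assms by (auto simp: q_def)
  have le: "exp (- s * (real (Suc n))\<^sup>2) \<le> q * q ^ n" for n
  proof -
    have "real (Suc n) * 1 \<le> real (Suc n) * real (Suc n)"
      by (intro mult_left_mono) auto
    then have "- s * (real (Suc n))\<^sup>2 \<le> real (Suc n) * (- s)"
      using assms by (simp add: power2_eq_square)
    then have "exp (- s * (real (Suc n))\<^sup>2) \<le> q ^ Suc n"
      unfolding q_def exp_of_nat_mult[symmetric] by simp
    then show ?thesis by simp
  qed
  have g: "summable (\<lambda>n. q * q ^ n)"
    using q by (intro summable_mult summable_geometric) simp
  show 1: "summable (\<lambda>n. exp (- s * (real (Suc n))\<^sup>2))"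
    by (rule summable_comparison_test'[OF g]) (use le in auto)
  have "(\<Sum>n. exp (- s * (real (Suc n))\<^sup>2)) \<le> (\<Sum>n. q * q ^ n)"
    by (intro suminf_le 1 g le)
  also have "\<dots> = q * (1 / (1 - q))"
    using q by (simp add: suminf_mult suminf_geometric)
  finally show "(\<Sum>n. exp (- s * (real (Suc n))\<^sup>2)) \<le> exp (- s) / (1 - exp (- s))"
    by (simp add: q_def)
qed

lemma summable_on_gauss_weight:
  fixes s :: real
  assumes "s > 0"
  shows "(\<lambda>k::int. exp (- s * (of_int k)\<^sup>2)) summable_on UNIV"
  using has_sum_int_symmetric[of "\<lambda>k. exp (- s * (of_int k)\<^sup>2)"] summable_gauss_weight(1)[OF assms]
  by (auto intro: has_sum_imp_summable simp: add.commute)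

lemma summable_on_gtheta:
  assumes "s > 0"
  shows "(\<lambda>k::int. exp (- s * (of_int k)\<^sup>2) * cos (2 * pi * of_int k * x)) summable_on UNIV"
proof (rule Infinite_Sum.abs_summable_summable, rule Infinite_Sum.abs_summable_on_comparison_test)
  show "(\<lambda>k::int. norm (exp (- s * (of_int k)\<^sup>2))) summable_on UNIV"
    using summable_on_gauss_weight[OF assms] by simp
qed (simp add: abs_mult)

lemma has_sum_gtheta:
  assumes "s > 0"
  shows "((\<lambda>k::int. exp (- s * (of_int k)\<^sup>2) * cos (2 * pi * of_int k * x)) has_sum gtheta s x) UNIV"
  using summable_on_gtheta[OF assms] by (simp add: gtheta_def)

lemma gtheta_eq_suminf:
  assumes "s > 0"
  shows "gtheta s x = 1 + 2 * (\<Sum>n. exp (- s * (real (Suc n))\<^sup>2) * cos (2 * pi * real (Suc n) * x))"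
    and "summable (\<lambda>n. norm (exp (- s * (real (Suc n))\<^sup>2) * cos (2 * pi * real (Suc n) * x)))"
proof -
  show 1: "summable (\<lambda>n. norm (exp (- s * (real (Suc n))\<^sup>2) * cos (2 * pi * real (Suc n) * x)))"
    by (rule summable_comparison_test'[OF summable_gauss_weight(1)[OF assms]]) (auto simp: abs_mult)
  have "((\<lambda>k::int. exp (- s * (of_int k)\<^sup>2) * cos (2 * pi * of_int k * x)) has_sum
     (1 + 2 * (\<Sum>n. exp (- s * (real (Suc n))\<^sup>2) * cos (2 * pi * real (Suc n) * x)))) UNIV"
    using has_sum_int_symmetric[of "\<lambda>k::int. exp (- s * (of_int k)\<^sup>2) * cos (2 * pi * of_int k * x)"] 1
    by (simp add: add.commute)
  then show "gtheta s x = 1 + 2 * (\<Sum>n. exp (- s * (real (Suc n))\<^sup>2) * cos (2 * pi * real (Suc n) * x))"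
    using has_sum_unique has_sum_gtheta[OF assms] by blast
qed

lemma gtheta_near_1:
  assumes "s > 0"
  shows "\<bar>gtheta s x - 1\<bar> \<le> 2 * exp (- s) / (1 - exp (- s))"
proof -
  note sm = gtheta_eq_suminf(2)[OF assms, of x]
  have "\<bar>gtheta s x - 1\<bar> = 2 * norm (\<Sum>n. exp (- s * (real (Suc n))\<^sup>2) * cos (2 * pi * real (Suc n) * x))"
    by (simp add: gtheta_eq_suminf(1)[OF assms])
  also have "norm (\<Sum>n. exp (- s * (real (Suc n))\<^sup>2) * cos (2 * pi * real (Suc n) * x))
      \<le> (\<Sum>n. norm (exp (- s * (real (Suc n))\<^sup>2) * cos (2 * pi * real (Suc n) * x)))"
    by (rule summable_norm[OF sm])
  also have "\<dots> \<le> (\<Sum>n. exp (- s * (real (Suc n))\<^sup>2))"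
    by (intro suminf_le sm summable_gauss_weight assms) (auto simp: abs_mult)
  finally show ?thesis using summable_gauss_weight(2)[OF assms] by simp
qed

lemma gtheta_le:
  assumes "s > 0"
  shows "gtheta s x \<le> gtheta s 0"
  by (rule has_sum_mono[OF has_sum_gtheta[OF assms] has_sum_gtheta[OF assms]]) simp

lemma cos_pi_of_int_half: "cos (2 * pi * of_int k * (1 / 2)) = (if even k then 1 else -1)"
  using cos_npi_int[of k] by (simp add: mult.commute mult.left_commute)

section \<open>The minimum of the theta function\<close>

lemma abs_sin_mult_le: "\<bar>sin (real n * x)\<bar> \<le> real n * \<bar>sin x\<bar>"
proof (induction n)
  case (Suc n)
  have "sin (real (Suc n) * x) = sin (real n * x) * cos x + cos (real n * x) * sin x"
    by (simp add: distrib_right sin_add add.commute)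
  then have "\<bar>sin (real (Suc n) * x)\<bar> \<le> \<bar>sin (real n * x)\<bar> * \<bar>cos x\<bar> + \<bar>cos (real n * x)\<bar> * \<bar>sin x\<bar>"
    by (metis abs_mult abs_triangle_ineq)
  also have "\<dots> \<le> \<bar>sin (real n * x)\<bar> * 1 + 1 * \<bar>sin x\<bar>"
    by (intro add_mono mult_mono) auto
  finally show ?case using Suc by (simp add: distrib_right)
qed auto

text \<open>Centred at pi, with x = 2 y + pi, the left side is 2 sin^2 (n y) and the right side is 2
  n^2 sin^2 y. The common factor 1 + cos x is what makes all harmonics comparable with the first
  one.\<close>

lemma cos_mult_diff_bound: "\<bar>cos (real n * x) - (-1) ^ n\<bar> \<le> (real n)\<^sup>2 * (1 + cos x)"
proof -
  define y where "y = (x - pi) / 2"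
  have x: "x = 2 * y + pi" by (simp add: y_def field_simps)
  have "cos (real n * x) = (-1) ^ n * cos (2 * (real n * y))"
    using cos_npi[of n] by (simp add: x distrib_left cos_add mult.left_commute)
  also have "\<dots> = (-1) ^ n - (-1) ^ n * (2 * (sin (real n * y))\<^sup>2)"
    by (simp add: cos_double_sin right_diff_distrib)
  finally have "\<bar>cos (real n * x) - (-1) ^ n\<bar> = 2 * \<bar>sin (real n * y)\<bar>\<^sup>2"
    by (simp add: abs_mult power_abs)
  also have "\<dots> \<le> 2 * (real n * \<bar>sin y\<bar>)\<^sup>2"
    using abs_sin_mult_le[of n y] by (intro mult_left_mono power_mono) auto
  also have "\<dots> = (real n)\<^sup>2 * (1 + cos x)"
    by (simp add: x cos_double_sin power_mult_distrib)
  finally show ?thesis .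
qed

lemma Suc_Suc_sq_le_power: "(real (Suc (Suc n)))\<^sup>2 \<le> 4 * 4 ^ n"
proof (induction n)
  case (Suc n)
  have "(real (Suc (Suc (Suc n))))\<^sup>2 \<le> 4 * (real (Suc (Suc n)))\<^sup>2"
    by (simp add: power2_eq_square algebra_simps)
  with Suc show ?case by simp
qed simp

text \<open>
  The first harmonic dominates: \<open>cos (k t)\<close> differs from its value at \<open>t = \<pi>\<close> by at most
  \<open>k\<^sup>2 (1 + cos t)\<close>.
\<close>
lemma gtheta_ge:
  assumes "s \<ge> 3"
  shows "gtheta s (1 / 2) \<le> gtheta s x"
proof -
  have s: "s > 0" using assms by simp
  define q where "q = exp (- s)"
  \<comment> \<open>The hypothesis s \<ge> 3 is used here, through exp s \<ge> 1 + s \<ge>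
    4.\<close>
  have q: "0 < q" "q \<le> 1 / 4"
  proof -
    have "4 \<le> exp s" using exp_ge_add_one_self[of s] assms by linarith
    then show "0 < q" "q \<le> 1 / 4" by (auto simp: q_def exp_minus field_simps)
  qed
  let ?w = "\<lambda>n. exp (- s * (real (Suc n))\<^sup>2)"
  let ?d = "\<lambda>n. ?w n * (cos (real (Suc n) * (2 * pi * x)) - (-1) ^ Suc n)"
  define c where "c = 1 + cos (2 * pi * x)"
  have c: "c \<ge> 0" unfolding c_def using cos_ge_minus_one[of "2 * pi * x"] by linarith
  have h: "cos (2 * pi * real (Suc n) * (1 / 2)) = (-1) ^ Suc n" for n
    using cos_npi[of "Suc n"] by (simp add: mult.commute)
  have sx: "summable (\<lambda>n. ?w n * cos (real (Suc n) * (2 * pi * x)))"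
    using summable_norm_cancel[OF gtheta_eq_suminf(2)[OF s, of x]] by (simp add: mult_ac)
  have sh: "summable (\<lambda>n. ?w n * (-1) ^ Suc n)"
    using gtheta_eq_suminf(2)[OF s, of "1/2"] unfolding h by (rule summable_norm_cancel)
  have sd: "summable ?d"
    using summable_diff[OF sx sh] by (simp only: right_diff_distrib)
  have "gtheta s x - gtheta s (1 / 2) = 2 * (\<Sum>n. ?d n)"
    unfolding gtheta_eq_suminf(1)[OF s] h right_diff_distrib
    by (subst suminf_diff[OF sx sh, symmetric]) (simp add: mult_ac)
  moreover have "0 \<le> (\<Sum>n. ?d n)"
  proof -
    have d0: "?d 0 = q * c"
      by (simp add: q_def c_def)
    \<comment> \<open>\<open>?d (Suc n)\<close> belongs to the harmonic n + 2. Its weight is bounded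
      through (n + 2)^2 \<ge> 4 + 2 n, and its cosine difference through (n + 2)^2 \<le> 4 *
      4^n.\<close>
    have dn: "- (4 * c * q ^ 4 * (1/4) ^ n) \<le> ?d (Suc n)" for n
    proof -
      have e: "?w (Suc n) \<le> q ^ 4 * (q ^ 2) ^ n"
      proof -
        have "real (4 + 2 * n) \<le> (real (Suc (Suc n)))\<^sup>2"
          by (simp add: power2_eq_square algebra_simps)
        then have "- s * (real (Suc (Suc n)))\<^sup>2 \<le> real (4 + 2 * n) * (- s)"
          using s by simp
        then have "?w (Suc n) \<le> q ^ (4 + 2 * n)"
          unfolding q_def exp_of_nat_mult[symmetric] by simp
        then show ?thesis by (simp add: power_add power_mult)
      qed
      have "\<bar>?d (Suc n)\<bar> = ?w (Suc n) * \<bar>cos (real (Suc (Suc n)) * (2 * pi * x)) - (-1) ^ Suc (Suc n)\<bar>"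
        by (simp add: abs_mult)
      also have "\<dots> \<le> (q ^ 4 * (q ^ 2) ^ n) * ((real (Suc (Suc n)))\<^sup>2 * c)"
        unfolding c_def using q by (intro mult_mono e cos_mult_diff_bound) auto
      also have "\<dots> \<le> (q ^ 4 * (q ^ 2) ^ n) * ((4 * 4 ^ n) * c)"
        using q c by (intro mult_mono Suc_Suc_sq_le_power) auto
      also have "\<dots> = 4 * c * q ^ 4 * (4 * q ^ 2) ^ n"
        by (simp add: power_mult_distrib mult_ac)
      also have "\<dots> \<le> 4 * c * q ^ 4 * (1/4) ^ n"
      proof -
        have "q * q \<le> 1/4 * (1/4)" using q by (intro mult_mono) auto
        then show ?thesis using q c by (intro mult_left_mono power_mono) (auto simp: power2_eq_square)
      qed
      finally show ?thesis by linarith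
    qed
    have "(\<Sum>n. - (4 * c * q ^ 4 * (1/4) ^ n)) \<le> (\<Sum>n. ?d (Suc n))"
      using sd summable_Suc_iff[of ?d]
      by (intro suminf_le dn summable_minus summable_mult summable_geometric) simp_all
    also have "(\<Sum>n. - (4 * c * q ^ 4 * (1/4) ^ n)) = - (4 * c * q ^ 4 * (4 / 3))"
      by (simp add: suminf_minus suminf_mult suminf_geometric)
    finally have "- (16 / 3 * c * q ^ 4) \<le> (\<Sum>n. ?d n) - ?d 0"
      using suminf_split_head[OF sd] by simp
    \<comment> \<open>The tail sums to 4 * (4/3) = 16/3 times c q^4, and q^3 \<le> 1/64 makes this
      less than the first harmonic q c.\<close>
    moreover have "16 / 3 * c * q ^ 4 \<le> q * c"
    proof -
      have "q ^ 3 \<le> (1/4) ^ 3" using q by (intro power_mono) auto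
      then have "q * c * (16 / 3 * q ^ 3) \<le> q * c * 1"
        using q c by (intro mult_left_mono) (auto simp: power3_eq_cube)
      then show ?thesis by (simp add: power3_eq_cube power4_eq_xxxx mult_ac)
    qed
    ultimately show ?thesis using d0 by linarith
  qed
  ultimately show ?thesis by linarith
qed

lemma gtheta_half_pos:
  assumes "s \<ge> 3"
  shows "gtheta s (1 / 2) > 0"
proof -
  have "4 \<le> exp s" using exp_ge_add_one_self[of s] assms by linarith
  then have "exp (- s) \<le> 1 / 4" by (auto simp: exp_minus field_simps)
  then have "2 * exp (- s) / (1 - exp (- s)) \<le> 2 * (1/4) / (1 - 1/4)"
    by (intro frac_le) auto
  then show ?thesis using gtheta_near_1[of s "1/2"] assms by simp
qed

lemma gtheta_0_pos:
  assumes "s > 0"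
  shows "gtheta s 0 > 0"
proof -
  have "(\<Sum>n. exp (- s * (real (Suc n))\<^sup>2)) \<ge> 0"
    by (intro suminf_nonneg summable_gauss_weight assms) auto
  then show ?thesis by (simp add: gtheta_eq_suminf(1)[OF assms])
qed

section \<open>Products of theta series and the duplication formulas\<close>

lemma has_sum_product_real:
  fixes f :: "'a \<Rightarrow> real" and g :: "'b \<Rightarrow> real"
  assumes f: "(f has_sum a) A" and g: "(g has_sum b) B"
  shows "((\<lambda>(x, y). f x * g y) has_sum a * b) (A \<times> B)"
proof -
  have sm: "(\<lambda>(x, y). f x * g y) summable_on A \<times> B"
  proof (rule Infinite_Sum.abs_summable_summable, subst Infinite_Sum.abs_summable_on_Sigma_iff, intro conjI ballI)
    have f': "(\<lambda>x. norm (f x)) summable_on A" and g': "(\<lambda>x. norm (g x)) summable_on B"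
      using summable_on_iff_abs_summable_on_real has_sum_imp_summable f g by blast+
    show "(\<lambda>y. norm (case (x, y) of (x, y) \<Rightarrow> f x * g y)) summable_on B" for x
      using summable_on_cmult_right[OF g', of "\<bar>f x\<bar>"] by (simp add: abs_mult)
    show "(\<lambda>x. norm (\<Sum>\<^sub>\<infinity>y\<in>B. norm (case (x, y) of (x, y) \<Rightarrow> f x * g y))) summable_on A"
      using summable_on_cmult_left[OF f', of "infsum (\<lambda>y. \<bar>g y\<bar>) B"]
      by (simp add: abs_mult infsum_cmult_right' infsum_nonneg)
  qed
  have "infsum (\<lambda>(x, y). f x * g y) (A \<times> B) = a * b"
    using f g by (subst infsum_Sigma'_banach[OF sm, symmetric])
      (simp add: infsum_cmult_right' infsum_cmult_left' has_sum_iff)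
  with sm show ?thesis by (simp add: has_sum_iff)
qed

lemma has_sum_gtheta_product:
  assumes "s > 0"
  shows "((\<lambda>(k::int, l::int). exp (- s * ((of_int k)\<^sup>2 + (of_int l)\<^sup>2)) *
    (cos (2 * pi * of_int k * x) * cos (2 * pi * of_int l * y))) has_sum gtheta s x * gtheta s y) UNIV"
proof -
  have e: "exp (- s * (a + b)) * (c * d) = (exp (- s * a) * c) * (exp (- s * b) * d)" for a b c d :: real
    by (simp only: distrib_left exp_add mult_ac)
  show ?thesis
    unfolding e using has_sum_product_real[OF has_sum_gtheta[OF assms] has_sum_gtheta[OF assms]] by simp
qed

text \<open>
  The sublattice of pairs with even coordinate sum is the image of \<open>(u, v) \<mapsto> (u + v, u - v)\<close>,
  which doubles the quadratic form \<open>k\<^sup>2 + l\<^sup>2\<close>.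
\<close>
lemma has_sum_even_sublattice:
  fixes f :: "int \<times> int \<Rightarrow> real"
  assumes "((\<lambda>(u, v). f (u + v, u - v)) has_sum S) UNIV"
  shows "((\<lambda>p. if even (fst p + snd p) then f p else 0) has_sum S) UNIV"
proof -
  have "((\<lambda>(u, v). f (u + v, u - v)) has_sum S) UNIV = (f has_sum S) {p. even (fst p + snd p)}"
  proof (rule has_sum_reindex_bij_witness[of _ "\<lambda>(k, l). ((k + l) div 2, (k - l) div 2)" "\<lambda>(u, v). (u + v, u - v)"])
    fix p :: "int \<times> int" assume "p \<in> {p. even (fst p + snd p)}"
    then have "even (fst p + snd p)" "even (fst p - snd p)" by auto
    then show "(case case p of (k, l) \<Rightarrow> ((k + l) div 2, (k - l) div 2) of (u, v) \<Rightarrow> (u + v, u - v)) = p"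
      by (cases p) (simp, presburger)
  qed auto
  moreover have "(f has_sum S) {p. even (fst p + snd p)} =
      ((\<lambda>p. if even (fst p + snd p) then f p else 0) has_sum S) UNIV"
    by (rule has_sum_cong_neutral) auto
  ultimately show ?thesis using assms by simp
qed

text \<open>In the double series for \<theta>_3^2 + \<theta>_4^2 the sign (-1)^(k + l) cancels the
  pairs with odd sum and doubles those with even sum; the latter form a rotated lattice with doubled
  quadratic form.\<close>

lemma gtheta_double_0:
  assumes "s > 0"
  shows "(gtheta (2 * s) 0)\<^sup>2 = ((gtheta s 0)\<^sup>2 + (gtheta s (1/2))\<^sup>2) / 2"
proof -
  let ?P = "\<lambda>p::int \<times> int. exp (- s * ((of_int (fst p))\<^sup>2 + (of_int (snd p))\<^sup>2))"
  have "((\<lambda>(u, v). ?P (u + v, u - v)) has_sum gtheta (2 * s) 0 * gtheta (2 * s) 0) UNIV"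
    using has_sum_gtheta_product[of "2 * s" 0 0] assms
    by (simp add: case_prod_unfold power2_eq_square algebra_simps)
  from has_sum_even_sublattice[OF this] have
    1: "((\<lambda>p. if even (fst p + snd p) then ?P p else 0) has_sum (gtheta (2 * s) 0)\<^sup>2) UNIV"
    by (simp add: power2_eq_square)
  have "((\<lambda>p. 2 * (if even (fst p + snd p) then ?P p else 0)) has_sum gtheta s 0 * gtheta s 0 + gtheta s (1/2) * gtheta s (1/2)) UNIV"
  proof (rule has_sum_cong[THEN iffD1, OF _ has_sum_add[OF has_sum_gtheta_product[OF assms, of 0 0] has_sum_gtheta_product[OF assms, of "1/2" "1/2"]]])
  qed (auto simp: case_prod_unfold cos_pi_of_int_half[simplified])
  from has_sum_unique[OF this has_sum_cmult_right[OF 1, of 2]] show ?thesis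
    by (simp add: power2_eq_square)
qed

text \<open>The product is written in both orders, so that the pair (k, l) carries (-1)^k + (-1)^l.
  This vanishes for odd k + l; for k = u + v, l = u - v it equals 2 (-1)^(u + v), which gives the
  square of the alternating series.\<close>

lemma gtheta_double_half:
  assumes "s > 0"
  shows "(gtheta (2 * s) (1/2))\<^sup>2 = gtheta s 0 * gtheta s (1/2)"
proof -
  let ?P = "\<lambda>p::int \<times> int. exp (- s * ((of_int (fst p))\<^sup>2 + (of_int (snd p))\<^sup>2)) * (if even (fst p) then 1 else - 1)"

  have "((\<lambda>(u, v). ?P (u + v, u - v)) has_sum gtheta (2 * s) (1/2) * gtheta (2 * s) (1/2)) UNIV"
    by (rule has_sum_cong[THEN iffD1, OF _ has_sum_gtheta_product[of "2 * s" "1/2" "1/2"]])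
      (use assms in \<open>auto simp: cos_pi_of_int_half power2_eq_square algebra_simps\<close>)
  from has_sum_even_sublattice[OF this] have
    1: "((\<lambda>p. if even (fst p + snd p) then ?P p else 0) has_sum (gtheta (2 * s) (1/2))\<^sup>2) UNIV"
    by (simp add: power2_eq_square)
  have "((\<lambda>p. 2 * (if even (fst p + snd p) then ?P p else 0)) has_sum gtheta s 0 * gtheta s (1/2) + gtheta s (1/2) * gtheta s 0) UNIV"
  proof (rule has_sum_cong[THEN iffD1, OF _ has_sum_add[OF has_sum_gtheta_product[OF assms, of 0 "1/2"] has_sum_gtheta_product[OF assms, of "1/2" 0]]])
  qed (auto simp: case_prod_unfold cos_pi_of_int_half[simplified])
  from has_sum_unique[OF this has_sum_cmult_right[OF 1, of 2]] show ?thesis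
    by (simp add: power2_eq_square)
qed

lemma theta4_eq_gtheta: "theta4 (exp (- s)) = gtheta s (1 / 2)" for s :: real
proof -
  have "(-1) powi k = (if even k then 1 else - 1 :: real)" for k :: int
    by (simp add: power_int_minus_left)
  moreover have "exp (- s) powi k\<^sup>2 = exp (- s * (of_int k)\<^sup>2)" for k :: int
    by (simp add: exp_power_int mult.commute)
  ultimately show ?thesis
    unfolding theta4_def gtheta_def cos_pi_of_int_half by (simp add: mult.commute)
qed

lemma gtheta_limit: 
  assumes "s > 0"
  shows "(\<lambda>n. gtheta (2 ^ n * s) x) \<longlonglongrightarrow> 1"
proof (rule LIM_zero_cancel, rule Lim_null_comparison)
  show "\<forall>\<^sub>F n in sequentially. norm (gtheta (2 ^ n * s) x - 1) \<le> 2 * exp (- (2 ^ n * s)) / (1 - exp (- (2 ^ n * s)))"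
    using gtheta_near_1 assms by (intro always_eventually) auto
  have "filterlim (\<lambda>n. 2 ^ n * s) at_top sequentially"
  proof (rule filterlim_at_top_mono)
    show "filterlim (\<lambda>n. real n * s) at_top sequentially"
      using filterlim_at_top_mult_tendsto_pos[OF tendsto_const assms filterlim_real_sequentially] .
    show "\<forall>\<^sub>F n in sequentially. real n * s \<le> 2 ^ n * s"
      using assms by (intro always_eventually allI mult_right_mono) (auto intro: less_imp_le of_nat_less_two_power)
  qed
  then have e: "(\<lambda>n. exp (- (2 ^ n * s))) \<longlonglongrightarrow> 0"
    by (intro filterlim_compose[OF exp_at_bot] filterlim_uminus_at_bot_at_top[THEN filterlim_compose])
  have "(\<lambda>n. 2 * exp (- (2 ^ n * s)) / (1 - exp (- (2 ^ n * s)))) \<longlonglongrightarrow> 2 * 0 / (1 - 0)"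
    by (intro tendsto_intros e) auto
  then show "(\<lambda>n. 2 * exp (- (2 ^ n * s)) / (1 - exp (- (2 ^ n * s)))) \<longlonglongrightarrow> 0" by simp
qed

section \<open>Square-integrable functions and summation under the integral\<close>


definition square_integrable :: "'a measure \<Rightarrow> ('a \<Rightarrow> complex) \<Rightarrow> bool" where
  "square_integrable M f \<longleftrightarrow> f \<in> borel_measurable M \<and> integrable M (\<lambda>x. (cmod (f x))\<^sup>2)"

lemma square_integrableD:
  assumes "square_integrable M f"
  shows "f \<in> borel_measurable M" "integrable M (\<lambda>x. (cmod (f x))\<^sup>2)"
  using assms by (auto simp: square_integrable_def)

lemma square_integrable_mult_norm:
  assumes "square_integrable M f" "square_integrable M g"
  shows "integrable M (\<lambda>x. cmod (f x) * cmod (g x))"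
proof (rule Bochner_Integration.integrable_bound)
  show "integrable M (\<lambda>x. (cmod (f x))\<^sup>2 + (cmod (g x))\<^sup>2)"
    using assms by (auto dest: square_integrableD)
  have "cmod (f x) * cmod (g x) \<le> (cmod (f x))\<^sup>2 + (cmod (g x))\<^sup>2" for x
    using sum_squares_bound[of "cmod (f x)" "cmod (g x)"] mult_nonneg_nonneg[OF norm_ge_zero norm_ge_zero, of "f x" "g x"]
    by linarith
  then show "AE x in M. norm (cmod (f x) * cmod (g x)) \<le> norm ((cmod (f x))\<^sup>2 + (cmod (g x))\<^sup>2)"
    by simp
qed (use assms[THEN square_integrableD(1)] in measurable)

lemma square_integrable_mult:
  assumes "square_integrable M f" "square_integrable M g"
  shows "integrable M (\<lambda>x. f x * g x)" "integrable M (\<lambda>x. f x * cnj (g x))"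
proof -
  note [measurable] = assms[THEN square_integrableD(1)]
  have [measurable]: "cnj \<in> borel_measurable borel"
    by (intro borel_measurable_continuous_onI continuous_intros)
  show "integrable M (\<lambda>x. f x * g x)" "integrable M (\<lambda>x. f x * cnj (g x))"
    by (rule Bochner_Integration.integrable_bound[OF square_integrable_mult_norm[OF assms]];
        measurable; simp add: norm_mult)+
qed

lemma square_integrable_add:
  assumes "square_integrable M f" "square_integrable M g"
  shows "square_integrable M (\<lambda>x. f x + g x)"
  unfolding square_integrable_def
proof
  note [measurable] = assms[THEN square_integrableD(1)]
  show "(\<lambda>x. f x + g x) \<in> borel_measurable M" by measurable
  show "integrable M (\<lambda>x. (cmod (f x + g x))\<^sup>2)"
  proof (rule Bochner_Integration.integrable_bound)
    show "integrable M (\<lambda>x. (cmod (f x))\<^sup>2 + (cmod (g x))\<^sup>2 + 2 * (cmod (f x) * cmod (g x)))"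
      using assms[THEN square_integrableD(2)] square_integrable_mult_norm[OF assms] by simp
    have "(cmod (f x + g x))\<^sup>2 \<le> (cmod (f x) + cmod (g x))\<^sup>2" for x
      by (intro power_mono norm_triangle_ineq) auto
    then show "AE x in M. norm ((cmod (f x + g x))\<^sup>2) \<le> norm ((cmod (f x))\<^sup>2 + (cmod (g x))\<^sup>2 + 2 * (cmod (f x) * cmod (g x)))"
      by (simp add: power2_sum mult.assoc)
  qed measurable
qed

lemma square_integrable_cmult:
  assumes "square_integrable M f"
  shows "square_integrable M (\<lambda>x. c * f x)"
  using assms by (auto simp: square_integrable_def norm_mult power_mult_distrib)

lemma square_integrable_diff:
  assumes "square_integrable M f" "square_integrable M g"
  shows "square_integrable M (\<lambda>x. f x - g x)"
  using square_integrable_add[OF assms(1) square_integrable_cmult[OF assms(2), of "-1"]] by simp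

lemma square_integrable_0: "square_integrable M (\<lambda>x. 0)"
  by (simp add: square_integrable_def)

lemma square_integrable_sum:
  assumes "\<And>i. i \<in> I \<Longrightarrow> square_integrable M (f i)"
  shows "square_integrable M (\<lambda>x. \<Sum>i\<in>I. f i x)"
  using assms by (induction I rule: infinite_finite_induct) (auto intro: square_integrable_add square_integrable_0)

lemma square_integrable_bounded_mult:
  assumes "square_integrable M f" "g \<in> borel_measurable M" "\<And>x. x \<in> space M \<Longrightarrow> cmod (g x) \<le> C"
  shows "square_integrable M (\<lambda>x. g x * f x)"
  unfolding square_integrable_def
proof
  note [measurable] = assms(1)[THEN square_integrableD(1)] assms(2)
  show "(\<lambda>x. g x * f x) \<in> borel_measurable M" by measurable
  show "integrable M (\<lambda>x. (cmod (g x * f x))\<^sup>2)"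
  proof (rule Bochner_Integration.integrable_bound)
    show "integrable M (\<lambda>x. C\<^sup>2 * (cmod (f x))\<^sup>2)"
      using assms(1) by (auto dest: square_integrableD)
    show "AE x in M. norm ((cmod (g x * f x))\<^sup>2) \<le> norm (C\<^sup>2 * (cmod (f x))\<^sup>2)"
      using assms(3) by (auto intro!: AE_I2 mult_right_mono power_mono simp: norm_mult power_mult_distrib)
  qed measurable
qed

lemma (in finite_measure) square_integrable_bounded:
  assumes "f \<in> borel_measurable M" "\<And>x. x \<in> space M \<Longrightarrow> cmod (f x) \<le> C"
  shows "square_integrable M f"
  using square_integrable_bounded_mult[OF _ assms, of "\<lambda>_. 1"] by (simp add: square_integrable_def)

lemma integral_norm_sq_add_le:
  assumes "square_integrable M f" "square_integrable M g"
  shows "(LINT x|M. (cmod (f x + g x))\<^sup>2) \<le> 2 * (LINT x|M. (cmod (f x))\<^sup>2) + 2 * (LINT x|M. (cmod (g x))\<^sup>2)"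
proof -
  note i = square_integrableD(2)[OF assms(1)] square_integrableD(2)[OF assms(2)]
  have "(cmod (f x + g x))\<^sup>2 \<le> 2 * (cmod (f x))\<^sup>2 + 2 * (cmod (g x))\<^sup>2" for x
  proof -
    have "(cmod (f x + g x))\<^sup>2 \<le> (cmod (f x) + cmod (g x))\<^sup>2"
      by (intro power_mono norm_triangle_ineq) auto
    then show ?thesis
      using sum_squares_bound[of "cmod (f x)" "cmod (g x)"] by (simp add: power2_sum)
  qed
  then have "(LINT x|M. (cmod (f x + g x))\<^sup>2) \<le> (LINT x|M. 2 * (cmod (f x))\<^sup>2 + 2 * (cmod (g x))\<^sup>2)"
    using i square_integrableD(2)[OF square_integrable_add[OF assms]] by (intro integral_mono) auto
  then show ?thesis using i by simp
qed

lemma discriminant_le: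
  fixes A B c :: real
  assumes "A \<ge> 0" and pos: "\<And>x. 0 \<le> A * x\<^sup>2 + 2 * c * x + B"
  shows "c\<^sup>2 \<le> A * B"
proof (cases "A = 0")
  case True
  have "c = 0"
  proof (rule ccontr)
    assume "c \<noteq> 0"
    \<comment> \<open>At this point the polynomial, which is linear here, takes the value
      -1.\<close>
    then show False using pos[of "- (B + 1) / (2 * c)"] True by simp
  qed
  then show ?thesis using True by simp
next
  case False
  then have "A > 0" using assms by simp
  then have "A * (- c / A)\<^sup>2 + 2 * c * (- c / A) + B = B - c\<^sup>2 / A"
    by (simp add: power2_eq_square)
  with pos[of "- c / A"] have "c\<^sup>2 / A \<le> B" by simp
  with \<open>A > 0\<close> show ?thesis by (simp add: field_simps)
qed

lemma integral_Cauchy_Schwarz: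
  assumes "square_integrable M f" "square_integrable M g"
  shows "(LINT x|M. cmod (f x) * cmod (g x))\<^sup>2 \<le> (LINT x|M. (cmod (f x))\<^sup>2) * (LINT x|M. (cmod (g x))\<^sup>2)"
proof (rule discriminant_le)
  fix t :: real
  note i = square_integrableD(2)[OF assms(1)] square_integrableD(2)[OF assms(2)] square_integrable_mult_norm[OF assms]
  have "0 \<le> (LINT x|M. (t * cmod (f x) + cmod (g x))\<^sup>2)"
    by (intro integral_nonneg_AE) auto
  also have "(LINT x|M. (t * cmod (f x) + cmod (g x))\<^sup>2)
     = (LINT x|M. t\<^sup>2 * (cmod (f x))\<^sup>2 + 2 * t * (cmod (f x) * cmod (g x)) + (cmod (g x))\<^sup>2)"
    by (intro Bochner_Integration.integral_cong) (auto simp: power2_eq_square algebra_simps)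
  also have "\<dots> = t\<^sup>2 * (LINT x|M. (cmod (f x))\<^sup>2) + 2 * t * (LINT x|M. cmod (f x) * cmod (g x)) + (LINT x|M. (cmod (g x))\<^sup>2)"
    using i by simp
  finally show "0 \<le> (LINT x|M. (cmod (f x))\<^sup>2) * t\<^sup>2 + 2 * (LINT x|M. cmod (f x) * cmod (g x)) * t + (LINT x|M. (cmod (g x))\<^sup>2)"
    by (simp add: mult_ac)
qed auto

text \<open>Fubini for counting measure on the integers, transported from series over the naturals
  along \<open>int_decode\<close>.\<close>

lemma has_sum_integral:
  fixes f :: "int \<Rightarrow> 'a \<Rightarrow> 'b :: {banach, second_countable_topology}"
  assumes int: "\<And>k. integrable M (f k)"
    and pt: "\<And>x. x \<in> space M \<Longrightarrow> (\<lambda>k. norm (f k x)) summable_on UNIV"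
    and sm: "(\<lambda>k. LINT x|M. norm (f k x)) summable_on UNIV"
  shows "integrable M (\<lambda>x. \<Sum>\<^sub>\<infinity>k. f k x)"
    and "((\<lambda>k. LINT x|M. f k x) has_sum (LINT x|M. (\<Sum>\<^sub>\<infinity>k. f k x))) UNIV"
proof -
  note bij = bij_int_decode
  have pt': "summable (\<lambda>n. norm (f (int_decode n) x))" if "x \<in> space M" for x
    using pt[OF that] summable_on_reindex_bij_betw[OF bij, of "\<lambda>k. norm (f k x)"]
    by (intro summable_on_imp_summable) simp
  have sm': "summable (\<lambda>n. LINT x|M. norm (f (int_decode n) x))"
    using sm summable_on_reindex_bij_betw[OF bij, of "\<lambda>k. LINT x|M. norm (f k x)"]
    by (intro summable_on_imp_summable) simp
  have eq: "(\<Sum>n. f (int_decode n) x) = (\<Sum>\<^sub>\<infinity>k. f k x)" if "x \<in> space M" for x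
  proof -
    have "((\<lambda>n. f (int_decode n) x) has_sum (\<Sum>\<^sub>\<infinity>k. f k x)) UNIV"
      using Infinite_Sum.abs_summable_summable[OF pt[OF that]]
        has_sum_reindex_bij_betw[OF bij, of "\<lambda>k. f k x"] by simp
    then show ?thesis using has_sum_imp_sums sums_unique by metis
  qed
  note * = integrable_suminf[of M "\<lambda>n. f (int_decode n)", OF int AE_I2[OF pt'] sm']
    sums_integral[of M "\<lambda>n. f (int_decode n)", OF int AE_I2[OF pt'] sm']
  show "integrable M (\<lambda>x. \<Sum>\<^sub>\<infinity>k. f k x)"
    by (rule Bochner_Integration.integrable_cong[THEN iffD1, OF refl _ *(1)]) (use eq in auto)
  have "(LINT x|M. (\<Sum>n. f (int_decode n) x)) = (LINT x|M. (\<Sum>\<^sub>\<infinity>k. f k x))"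
    by (rule Bochner_Integration.integral_cong) (use eq in auto)
  with *(2) have "(\<lambda>n. LINT x|M. f (int_decode n) x) sums (LINT x|M. (\<Sum>\<^sub>\<infinity>k. f k x))" by simp
  moreover have "summable (\<lambda>n. norm (LINT x|M. f (int_decode n) x))"
    by (rule summable_comparison_test'[OF sm']) simp
  ultimately have "((\<lambda>n. LINT x|M. f (int_decode n) x) has_sum (LINT x|M. (\<Sum>\<^sub>\<infinity>k. f k x))) UNIV"
    by (intro norm_summable_imp_has_sum)
  then show "((\<lambda>k. LINT x|M. f k x) has_sum (LINT x|M. (\<Sum>\<^sub>\<infinity>k. f k x))) UNIV"
    using has_sum_reindex_bij_betw[OF bij, of "\<lambda>k. LINT x|M. f k x"] by simp
qed

text \<open>For nonnegative terms the integral of the sum bounds every finite sum of integrals, so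
  summability of the integrals comes for free.\<close>

lemma has_sum_integral_nonneg:
  fixes f :: "int \<Rightarrow> 'a \<Rightarrow> real"
  assumes int: "\<And>k. integrable M (f k)" and nonneg: "\<And>k x. x \<in> space M \<Longrightarrow> f k x \<ge> 0"
    and pt: "\<And>x. x \<in> space M \<Longrightarrow> ((\<lambda>k. f k x) has_sum F x) UNIV"
    and F: "integrable M F"
  shows "((\<lambda>k. LINT x|M. f k x) has_sum (LINT x|M. F x)) UNIV"
proof -
  have "((\<lambda>k. LINT x|M. f k x) has_sum (LINT x|M. (\<Sum>\<^sub>\<infinity>k. f k x))) UNIV"
  proof (rule has_sum_integral(2)[OF int])
    show "(\<lambda>k. norm (f k x)) summable_on UNIV" if "x \<in> space M" for x
      using pt[OF that] nonneg[OF that] by (auto intro: has_sum_imp_summable)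
    have eq: "(LINT x|M. norm (f k x)) = (LINT x|M. f k x)" for k
      by (rule Bochner_Integration.integral_cong) (use nonneg in auto)
    show "(\<lambda>k. LINT x|M. norm (f k x)) summable_on UNIV"
      unfolding eq
    proof (rule nonneg_bdd_above_summable_on)
      show "bdd_above (sum (\<lambda>k. LINT x|M. f k x) ` {A. A \<subseteq> UNIV \<and> finite A})"
      proof (rule bdd_aboveI2)
        fix A :: "int set" assume "A \<in> {A. A \<subseteq> UNIV \<and> finite A}"
        then have "finite A" by simp
        have "(\<Sum>k\<in>A. LINT x|M. f k x) = (LINT x|M. (\<Sum>k\<in>A. f k x))"
          using int by simp
        also have "\<dots> \<le> (LINT x|M. F x)"
        proof (rule integral_mono)
          show "integrable M (\<lambda>x. \<Sum>k\<in>A. f k x)" using int by simp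
          show "(\<Sum>k\<in>A. f k x) \<le> F x" if "x \<in> space M" for x
            using finite_sum_le_has_sum[OF pt[OF that] \<open>finite A\<close>] nonneg[OF that] by auto
        qed (rule F)
        finally show "(\<Sum>k\<in>A. LINT x|M. f k x) \<le> (LINT x|M. F x)" .
      qed
    qed (use nonneg in \<open>auto intro!: integral_nonneg_AE\<close>)
  qed
  also have "(LINT x|M. (\<Sum>\<^sub>\<infinity>k. f k x)) = (LINT x|M. F x)"
    by (rule Bochner_Integration.integral_cong) (use pt in \<open>auto simp: has_sum_iff\<close>)
  finally show ?thesis .
qed

text \<open>The period is half-open so that its integer translates tile the line without
  overlap.\<close>

abbreviation unit_interval :: "real measure" where
  "unit_interval \<equiv> restrict_space lborel {0..<1}"

lemma finite_measure_unit_interval: "finite_measure unit_interval"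
  by (rule finite_measureI) (simp add: emeasure_restrict_space space_restrict_space)

interpretation unit_interval: finite_measure unit_interval
  by (rule finite_measure_unit_interval)

lemma measurable_unit_interval:
  "f \<in> borel_measurable lborel \<Longrightarrow> f \<in> borel_measurable unit_interval"
  by (rule measurable_restrict_space1)

lemma space_unit_interval [simp]: "space unit_interval = {0..<1}"
  by (simp add: space_restrict_space)

lemma square_integrable_unit_interval_continuous:
  fixes f :: "real \<Rightarrow> complex"
  assumes "continuous_on UNIV f"
  shows "square_integrable unit_interval f"
proof -
  have "compact (f ` {0..1})"
    by (intro compact_continuous_image continuous_on_subset[OF assms]) auto
  then obtain C where "\<And>y. y \<in> {0..1} \<Longrightarrow> cmod (f y) \<le> C"
    using compact_imp_bounded bounded_iff by (metis imageI)
  then show ?thesis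
    using borel_measurable_continuous_onI[OF assms]
    by (intro unit_interval.square_integrable_bounded[of _ C]) (auto intro: measurable_unit_interval)
qed

lemma integrable_unit_interval_shift:
  fixes h :: "real \<Rightarrow> 'b :: {banach, second_countable_topology}"
  assumes "integrable lborel h"
  shows "integrable unit_interval (\<lambda>x. h (x + a))"
  using lborel_integrable_real_affine[OF assms, of 1 a]
  by (subst integrable_restrict_space) (auto intro: integrable_mult_indicator simp: add.commute)

text \<open>Cut into pieces on [m, m + 1), the function is at each point a sum with at most one
  nonzero term, the one for the floor of x, so sum and integral can be interchanged.\<close>

lemma has_sum_integral_periodize:
  fixes h :: "real \<Rightarrow> 'b :: {banach, second_countable_topology}"
  assumes h: "integrable lborel h"
  shows "((\<lambda>m::int. LINT x|unit_interval. h (x + of_int m)) has_sum (LINT x|lborel. h x)) UNIV"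
proof -
  define f where "f m x = indicator {of_int m..<of_int m + 1} x *\<^sub>R h x" for m :: int and x
  have int: "integrable lborel (f m)" for m
    unfolding f_def using h by (intro integrable_mult_indicator) auto
  have eq: "indicat_real {of_int m..<of_int m + 1} x = (if m = \<lfloor>x\<rfloor> then 1 else 0)" for m x
    unfolding indicator_def using floor_eq_iff[of x m] by auto
  have hs: "((\<lambda>m. f m x) has_sum h x) UNIV" "((\<lambda>m. norm (f m x)) has_sum norm (h x)) UNIV" for x
  proof -
    have "((\<lambda>m. f m x) has_sum h x) {\<lfloor>x\<rfloor>}" "((\<lambda>m. norm (f m x)) has_sum norm (h x)) {\<lfloor>x\<rfloor>}"
      by (auto intro!: has_sum_finiteI simp: f_def eq)
    then show "((\<lambda>m. f m x) has_sum h x) UNIV" "((\<lambda>m. norm (f m x)) has_sum norm (h x)) UNIV"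
      by (auto simp: f_def eq elim!: has_sum_cong_neutral[THEN iffD1, rotated -1] split: if_splits)
  qed
  have "((\<lambda>m. LINT x|lborel. f m x) has_sum (LINT x|lborel. (\<Sum>\<^sub>\<infinity>m. f m x))) UNIV"
  proof (rule has_sum_integral(2)[OF int])
    show "(\<lambda>m. norm (f m x)) summable_on UNIV" for x
      using hs(2) by (auto intro: has_sum_imp_summable)
    have "((\<lambda>m. LINT x|lborel. norm (f m x)) has_sum (LINT x|lborel. norm (h x))) UNIV"
      by (rule has_sum_integral_nonneg) (use int h hs(2) in auto)
    then show "(\<lambda>m. LINT x|lborel. norm (f m x)) summable_on UNIV"
      by (rule has_sum_imp_summable)
  qed
  moreover have "(\<Sum>\<^sub>\<infinity>m. f m x) = h x" for x
    using hs(1) by (simp add: has_sum_iff)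
  moreover have "(LINT x|lborel. f m x) = (LINT x|unit_interval. h (x + of_int m))" for m
  proof -
    have "(LINT x|lborel. f m x) = (LINT x|lborel. f m (of_int m + 1 * x))"
      using lborel_integral_real_affine[of 1 "f m" "of_int m"] by simp
    also have "\<dots> = (LINT x|lborel. indicator {0..<1} x *\<^sub>R h (x + of_int m))"
      by (intro Bochner_Integration.integral_cong) (auto simp: f_def indicator_def add.commute)
    also have "\<dots> = (LINT x|unit_interval. h (x + of_int m))"
      by (subst integral_restrict_space) auto
    finally show ?thesis .
  qed
  ultimately show ?thesis by simp
qed

section \<open>Parseval's identity\<close>


definition fexp :: "int \<Rightarrow> real \<Rightarrow> complex" where
  "fexp l x = cis (2 * pi * of_int l * x)"

lemma norm_fexp [simp]: "cmod (fexp l x) = 1"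
  by (simp add: fexp_def)

lemma fexp_0 [simp]: "fexp 0 x = 1"
  by (simp add: fexp_def)

lemma fexp_mult: "fexp k x * fexp l x = fexp (k + l) x"
  by (simp add: fexp_def cis_mult algebra_simps)

lemma cnj_fexp: "cnj (fexp l x) = fexp (- l) x"
  by (simp add: fexp_def cis_cnj)

lemma continuous_on_fexp [continuous_intros]: "continuous_on S (fexp l)"
  unfolding fexp_def by (intro continuous_intros)

lemma measurable_fexp [measurable]: "fexp l \<in> borel_measurable borel"
  by (intro borel_measurable_continuous_onI continuous_on_fexp)

lemma fexp_of_int_add [simp]: "fexp l (x + of_int m) = fexp l x"
proof -
  have "fexp l (x + of_int m) = cis (2 * pi * of_int l * x) * cis (2 * pi * of_int (l * m))"
    by (simp add: fexp_def cis_mult algebra_simps)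
  also have "cis (2 * pi * of_int (l * m)) = 1"
    by (simp only: cis.ctr cos_int_2pin sin_int_2pin) (simp add: complex_eq_iff)
  finally show ?thesis by (simp add: fexp_def)
qed

lemma square_integrable_fexp: "square_integrable unit_interval (fexp l)"
  by (rule square_integrable_unit_interval_continuous[OF continuous_on_fexp])

lemma integral_fexp: "(LINT x|unit_interval. fexp l x) = (if l = 0 then 1 else 0)"
proof (cases "l = 0")
  case True
  then show ?thesis by (simp add: measure_restrict_space)
next
  case False
  define a where "a = 2 * pi * of_int l * \<i>"
  define F where "F x = fexp l x * inverse a" for x
  have fexp: "fexp l = (\<lambda>x. exp (x *\<^sub>R a))"
    by (simp add: fun_eq_iff fexp_def cis_conv_exp a_def scaleR_conv_of_real mult_ac)
  have D: "(F has_vector_derivative fexp l x) (at x within S)" for x S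
  proof -
    have "(F has_vector_derivative (exp (x *\<^sub>R a) * a) * inverse a) (at x within S)"
      unfolding F_def fexp by (intro has_vector_derivative_mult_left exp_scaleR_has_vector_derivative_right)
    moreover have "a \<noteq> 0" using False by (simp add: a_def)
    ultimately show ?thesis by (simp add: fexp mult.assoc)
  qed
  have "(LINT x|unit_interval. fexp l x) = (LINT x:{0..<1}|lborel. fexp l x)"
    unfolding set_lebesgue_integral_def by (subst integral_restrict_space) auto
  also have "\<dots> = (LINT x:{0..1}|lborel. fexp l x)"
    unfolding set_lebesgue_integral_def
    by (rule integral_cong_AE) (auto simp: indicator_def intro: eventually_mono[OF AE_lborel_singleton[of 1]])
  also have "\<dots> = F 1 - F 0"
    unfolding set_lebesgue_integral_def
    by (rule integral_FTC_atLeastAtMost[where F=F and f="fexp l"]) (auto intro: D continuous_on_fexp)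
  also have "\<dots> = 0"
    using fexp_of_int_add[of l 0 1] by (simp add: F_def)
  finally show ?thesis using False by simp
qed

definition fcoeff :: "(real \<Rightarrow> complex) \<Rightarrow> int \<Rightarrow> complex" where
  "fcoeff h l = (LINT x|unit_interval. h x * cnj (fexp l x))"

section \<open>Trigonometric polynomials and uniform approximation\<close>

definition trig_poly :: "(real \<Rightarrow> complex) \<Rightarrow> bool" where
  "trig_poly p \<longleftrightarrow> (\<exists>F c. finite F \<and> (\<forall>l. l \<notin> F \<longrightarrow> c l = 0) \<and> p = (\<lambda>x. \<Sum>l\<in>F. c l * fexp l x))"

text \<open>Parseval's sums run over all finite sets beyond some index set; coefficients vanishing
  outside \<open>F\<close> allow \<open>p\<close> to be written over each of them.\<close>

lemma trig_poly_extend: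
  assumes "trig_poly p"
  shows "\<exists>F c. finite F \<and> (\<forall>l. l \<notin> F \<longrightarrow> c l = 0) \<and>
    (\<forall>G. finite G \<longrightarrow> F \<subseteq> G \<longrightarrow> p = (\<lambda>x. \<Sum>l\<in>G. c l * fexp l x))"
proof -
  from assms obtain F c where F: "finite F" "\<And>l. l \<notin> F \<Longrightarrow> c l = 0" "p = (\<lambda>x. \<Sum>l\<in>F. c l * fexp l x)"
    unfolding trig_poly_def by blast
  have "p = (\<lambda>x. \<Sum>l\<in>G. c l * fexp l x)" if "finite G" "F \<subseteq> G" for G
    unfolding F(3) using that F(2) by (intro ext sum.mono_neutral_left) auto
  with F(1,2) show ?thesis by blast
qed

lemma trig_poly_add:
  assumes "trig_poly p" "trig_poly q"
  shows "trig_poly (\<lambda>x. p x + q x)"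
proof -
  obtain F c where F: "finite F" "\<And>l. l \<notin> F \<Longrightarrow> c l = 0" "\<And>G. finite G \<Longrightarrow> F \<subseteq> G \<Longrightarrow> p = (\<lambda>x. \<Sum>l\<in>G. c l * fexp l x)"
    using trig_poly_extend[OF assms(1)] by blast
  obtain F' c' where F': "finite F'" "\<And>l. l \<notin> F' \<Longrightarrow> c' l = 0" "\<And>G. finite G \<Longrightarrow> F' \<subseteq> G \<Longrightarrow> q = (\<lambda>x. \<Sum>l\<in>G. c' l * fexp l x)"
    using trig_poly_extend[OF assms(2)] by blast
  have "p = (\<lambda>x. \<Sum>l\<in>F \<union> F'. c l * fexp l x)" "q = (\<lambda>x. \<Sum>l\<in>F \<union> F'. c' l * fexp l x)"
    using F F' by (metis Un_upper1 Un_upper2 finite_UnI)+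
  then have "(\<lambda>x. p x + q x) = (\<lambda>x. \<Sum>l\<in>F \<union> F'. (c l + c' l) * fexp l x)"
    by (simp add: distrib_right sum.distrib)
  then show ?thesis
    unfolding trig_poly_def using F(1,2) F'(1,2)
    by (intro exI[of _ "F \<union> F'"] exI[of _ "\<lambda>l. c l + c' l"]) auto
qed

lemma trig_poly_cmult_fexp:
  assumes "trig_poly p"
  shows "trig_poly (\<lambda>x. a * fexp k x * p x)"
proof -
  obtain F c where F: "finite F" "\<And>l. l \<notin> F \<Longrightarrow> c l = 0" "p = (\<lambda>x. \<Sum>l\<in>F. c l * fexp l x)"
    using assms unfolding trig_poly_def by blast
  have "a * fexp k x * p x = (\<Sum>l\<in>(+) k ` F. (a * c (l - k)) * fexp l x)" for x
    unfolding F(3) sum_distrib_left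
    by (subst sum.reindex) (auto simp: mult_ac simp flip: fexp_mult intro!: sum.cong)
  moreover have "a * c (l - k) = 0" if "l \<notin> (+) k ` F" for l
  proof -
    have "l - k \<notin> F" using that by (metis add_diff_cancel_left' diff_add_cancel add.commute image_eqI)
    then show ?thesis using F(2) by simp
  qed
  ultimately show ?thesis
    unfolding trig_poly_def using F(1)
    by (intro exI[of _ "(+) k ` F"] exI[of _ "\<lambda>l. a * c (l - k)"]) auto
qed

lemma trig_poly_1: "trig_poly (\<lambda>x. 1)"
  unfolding trig_poly_def by (intro exI[of _ "{0}"] exI[of _ "\<lambda>l. if l = 0 then 1 else 0"]) auto

lemma trig_poly_cmult: "trig_poly p \<Longrightarrow> trig_poly (\<lambda>x. a * p x)"
  using trig_poly_cmult_fexp[of p a 0] by simp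

lemma trig_poly_const: "trig_poly (\<lambda>x. a)"
  using trig_poly_cmult[OF trig_poly_1, of a] by simp

lemma trig_poly_sum:
  "(\<And>i. i \<in> I \<Longrightarrow> trig_poly (p i)) \<Longrightarrow> trig_poly (\<lambda>x. \<Sum>i\<in>I. p i x)"
  by (induction I rule: infinite_finite_induct) (auto intro: trig_poly_add trig_poly_const)

lemma trig_poly_cos_mult:
  assumes "trig_poly p"
  shows "trig_poly (\<lambda>x. of_real (cos (2 * pi * x)) * p x)"
proof -
  have "of_real (cos (2 * pi * x)) * p x = 1/2 * fexp 1 x * p x + 1/2 * fexp (-1) x * p x" for x
    by (simp add: fexp_def complex_eq_iff field_simps)
  with trig_poly_add[OF trig_poly_cmult_fexp[OF assms, of "1/2" 1] trig_poly_cmult_fexp[OF assms, of "1/2" "-1"]]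
  show ?thesis by simp
qed

lemma trig_poly_sin_mult:
  assumes "trig_poly p"
  shows "trig_poly (\<lambda>x. of_real (sin (2 * pi * x)) * p x)"
proof -
  have "of_real (sin (2 * pi * x)) * p x = - \<i>/2 * fexp 1 x * p x + \<i>/2 * fexp (-1) x * p x" for x
    by (simp add: fexp_def complex_eq_iff field_simps)
  with trig_poly_add[OF trig_poly_cmult_fexp[OF assms, of "- \<i>/2" 1] trig_poly_cmult_fexp[OF assms, of "\<i>/2" "-1"]]
  show ?thesis by simp
qed

lemma trig_poly_polynomial_cos:
  fixes g :: "real \<Rightarrow> complex"
  assumes "polynomial_function g"
  shows "trig_poly (\<lambda>x. g (cos (2 * pi * x)))"
proof -
  have pw: "trig_poly (\<lambda>x. of_real (cos (2 * pi * x) ^ n))" for n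
    by (induction n) (auto intro: trig_poly_1 dest: trig_poly_cos_mult)
  have re: "trig_poly (\<lambda>x. of_real (f (cos (2 * pi * x))))" if f: "real_polynomial_function f" for f
  proof -
    obtain a n where "f = (\<lambda>x. \<Sum>i\<le>n. a i * x ^ i)"
      using f[unfolded real_polynomial_function_iff_sum] by blast
    then have eq: "(\<lambda>x. complex_of_real (f (cos (2 * pi * x)))) =
        (\<lambda>x. \<Sum>i\<le>n. of_real (a i) * of_real (cos (2 * pi * x) ^ i))"
      by (simp only: of_real_sum of_real_mult)
    show ?thesis
      unfolding eq by (rule trig_poly_sum, rule trig_poly_cmult, rule pw)
  qed
  have "real_polynomial_function (Re \<circ> g)" "real_polynomial_function (Im \<circ> g)"
    using assms bounded_linear_Re bounded_linear_Im unfolding polynomial_function_def by auto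
  from trig_poly_add[OF re[OF this(1)] trig_poly_cmult[OF re[OF this(2)], of "\<i>"]]
  show ?thesis by (simp add: complex_eq[symmetric])
qed

lemma trig_poly_approx_cos:
  fixes u :: "real \<Rightarrow> complex"
  assumes "continuous_on {-1..1} u" "\<epsilon> > 0"
  obtains p where "trig_poly p" "\<And>x. cmod (u (cos (2 * pi * x)) - p x) < \<epsilon>"
proof -
  obtain g where g: "polynomial_function g" "\<And>y. y \<in> {-1..1} \<Longrightarrow> norm (u y - g y) < \<epsilon>"
    using Stone_Weierstrass_polynomial_function[OF _ assms] by auto
  show ?thesis
    by (rule that[OF trig_poly_polynomial_cos[OF g(1)]]) (auto intro!: g(2))
qed

text \<open>
  On the period \<open>[0, 1]\<close> the reflection \<open>x \<mapsto> 1 - x\<close> splits \<open>sin\<^sup>2 \<cdot> f\<close> into an even part, a continuous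
  function of the cosine, and an odd part, the sine times such a function.
\<close>
lemma trig_poly_approx_sin_sq:
  fixes f :: "real \<Rightarrow> complex"
  assumes f: "continuous_on {0..1} f" and \<epsilon>: "\<epsilon> > 0"
  obtains p where "trig_poly p" "\<And>x. x \<in> {0..1} \<Longrightarrow> cmod (of_real ((sin (2 * pi * x))\<^sup>2) * f x - p x) < \<epsilon>"
proof -
  \<comment> \<open>\<open>t\<close> inverts x to cos (2 pi x) on [0, 1/2], and 1 - t inverts it on
    [1/2, 1].\<close>
  define t where "t y = arccos y / (2 * pi)" for y
  have t: "continuous_on {-1..1} t" "t ` {-1..1} \<subseteq> {0..1}" "(\<lambda>y. 1 - t y) ` {-1..1} \<subseteq> {0..1}"
  proof -
    show "continuous_on {-1..1} t" unfolding t_def by (intro continuous_intros) auto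
    have "0 \<le> t y \<and> t y \<le> 1" if "y \<in> {-1..1}" for y
      using that arccos_lbound[of y] arccos_ubound[of y] by (auto simp: t_def divide_simps)
    then show "t ` {-1..1} \<subseteq> {0..1}" "(\<lambda>y. 1 - t y) ` {-1..1} \<subseteq> {0..1}" by auto
  qed
  have c1: "continuous_on {-1..1} (\<lambda>y. f (t y))"
    by (rule continuous_on_compose2[OF f t(1,2)])
  have c2: "continuous_on {-1..1} (\<lambda>y. f (1 - t y))"
    by (rule continuous_on_compose2[OF f _ t(3)]) (intro continuous_intros t(1))
  define u where "u y = of_real (1 - y\<^sup>2) * ((f (t y) + f (1 - t y)) / 2)" for y
  \<comment> \<open>One sine of sin^2 is kept outside; the other turns the odd part of f into a
    reflection-invariant function, with sqrt (1 - y^2) = |sin|. This avoids dividing by the sine, so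
    \<open>v\<close> is continuous even if f takes different values at 0 and 1.\<close>
  define v where "v y = of_real (sqrt (1 - y\<^sup>2)) * ((f (t y) - f (1 - t y)) / 2)" for y
  have u: "continuous_on {-1..1} u" and v: "continuous_on {-1..1} v"
    unfolding u_def v_def by (intro continuous_intros c1 c2; simp)+
  obtain p where p: "trig_poly p" "\<And>x. cmod (u (cos (2 * pi * x)) - p x) < \<epsilon> / 2"
    using trig_poly_approx_cos[OF u, of "\<epsilon> / 2"] \<epsilon> by auto
  obtain q where q: "trig_poly q" "\<And>x. cmod (v (cos (2 * pi * x)) - q x) < \<epsilon> / 2"
    using trig_poly_approx_cos[OF v, of "\<epsilon> / 2"] \<epsilon> by auto
  have eq: "of_real ((sin (2 * pi * x))\<^sup>2) * f x = u (cos (2 * pi * x)) + of_real (sin (2 * pi * x)) * v (cos (2 * pi * x))"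
    if "x \<in> {0..1}" for x
  proof -
    have s: "1 - (cos (2 * pi * x))\<^sup>2 = (sin (2 * pi * x))\<^sup>2"
      by (simp add: sin_squared_eq)
    show ?thesis
    proof (cases "x \<le> 1 / 2")
      case True
      then have "t (cos (2 * pi * x)) = x" "sin (2 * pi * x) \<ge> 0"
        using that by (auto simp: t_def arccos_cos intro!: sin_ge_zero)
      then show ?thesis
        unfolding u_def v_def s by (simp add: power2_eq_square field_simps)
    next
      case False
      have "cos (2 * pi * x) = cos (2 * pi * (1 - x))" "sin (2 * pi * x) = - sin (2 * pi * (1 - x))"
        by (simp_all add: right_diff_distrib cos_diff sin_diff)
      moreover have "t (cos (2 * pi * (1 - x))) = 1 - x" "sin (2 * pi * (1 - x)) \<ge> 0"
        using that False by (auto simp: t_def arccos_cos intro!: sin_ge_zero)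
      ultimately have t': "t (cos (2 * pi * x)) = 1 - x" and "sin (2 * pi * x) \<le> 0"
        by auto
      then have s': "sqrt ((sin (2 * pi * x))\<^sup>2) = - sin (2 * pi * x)"
        by simp
      show ?thesis
        unfolding u_def v_def s t' s' by (simp add: power2_eq_square field_simps)
    qed
  qed
  show ?thesis
  proof (rule that)
    show "trig_poly (\<lambda>x. p x + of_real (sin (2 * pi * x)) * q x)"
      by (intro trig_poly_add p trig_poly_sin_mult q)
    show "cmod (of_real ((sin (2 * pi * x))\<^sup>2) * f x - (p x + of_real (sin (2 * pi * x)) * q x)) < \<epsilon>"
      if "x \<in> {0..1}" for x
    proof -
      have "cmod (of_real ((sin (2 * pi * x))\<^sup>2) * f x - (p x + of_real (sin (2 * pi * x)) * q x))
         = cmod ((u (cos (2 * pi * x)) - p x) + of_real (sin (2 * pi * x)) * (v (cos (2 * pi * x)) - q x))"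
        unfolding eq[OF that] by (simp add: algebra_simps)
      also have "\<dots> \<le> cmod (u (cos (2 * pi * x)) - p x) + \<bar>sin (2 * pi * x)\<bar> * cmod (v (cos (2 * pi * x)) - q x)"
        by (metis norm_triangle_ineq norm_mult norm_of_real)
      also have "\<dots> \<le> cmod (u (cos (2 * pi * x)) - p x) + 1 * cmod (v (cos (2 * pi * x)) - q x)"
        by (intro add_left_mono mult_right_mono) auto
      also have "\<dots> < \<epsilon>" using p(2)[of x] q(2)[of x] by simp
      finally show ?thesis .
    qed
  qed
qed

lemma square_integrable_trig_poly:
  assumes "trig_poly p"
  shows "square_integrable unit_interval p"
proof -
  obtain F c where "p = (\<lambda>x. \<Sum>l\<in>F. c l * fexp l x)"
    using assms unfolding trig_poly_def by blast
  then show ?thesis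
    by (auto intro!: square_integrable_sum square_integrable_cmult square_integrable_fexp)
qed

section \<open>Density of trigonometric polynomials in the square norm\<close>

definition trig_approx :: "(real \<Rightarrow> complex) \<Rightarrow> bool" where
  "trig_approx h \<longleftrightarrow> (\<forall>\<epsilon>>0. \<exists>p. trig_poly p \<and> (LINT x|unit_interval. (cmod (h x - p x))\<^sup>2) < \<epsilon>)"

lemma trig_approx_limit:
  assumes h: "square_integrable unit_interval h"
    and g: "\<And>n. square_integrable unit_interval (g n)" "\<And>n. trig_approx (g n)"
    and lim: "(\<lambda>n. LINT x|unit_interval. (cmod (h x - g n x))\<^sup>2) \<longlonglongrightarrow> 0"
  shows "trig_approx h"
  unfolding trig_approx_def
proof (intro allI impI)
  fix \<epsilon> :: real assume "\<epsilon> > 0"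
  then have "\<forall>\<^sub>F n in sequentially. (LINT x|unit_interval. (cmod (h x - g n x))\<^sup>2) < \<epsilon> / 4"
    by (intro order_tendstoD(2)[OF lim]) auto
  then obtain n where n: "(LINT x|unit_interval. (cmod (h x - g n x))\<^sup>2) < \<epsilon> / 4"
    by (auto simp: eventually_sequentially)
  obtain p where p: "trig_poly p" "(LINT x|unit_interval. (cmod (g n x - p x))\<^sup>2) < \<epsilon> / 4"
    using g(2)[of n] \<open>\<epsilon> > 0\<close> unfolding trig_approx_def by (meson divide_pos_pos zero_less_numeral)
  have "(LINT x|unit_interval. (cmod (h x - p x))\<^sup>2) \<le>
      2 * (LINT x|unit_interval. (cmod (h x - g n x))\<^sup>2) + 2 * (LINT x|unit_interval. (cmod (g n x - p x))\<^sup>2)"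
    using integral_norm_sq_add_le[OF square_integrable_diff[OF h g(1)] square_integrable_diff[OF g(1) square_integrable_trig_poly[OF p(1)]], of n n]
    by simp
  with n p show "\<exists>p. trig_poly p \<and> (LINT x|unit_interval. (cmod (h x - p x))\<^sup>2) < \<epsilon>"
    by (intro exI[of _ p]) auto
qed

lemma trig_approx_sin_sq:
  assumes f: "continuous_on UNIV f"
  shows "trig_approx (\<lambda>x. of_real ((sin (2 * pi * x))\<^sup>2) * f x)"
  unfolding trig_approx_def
proof (intro allI impI)
  fix \<epsilon> :: real assume \<epsilon>: "\<epsilon> > 0"
  obtain p where p: "trig_poly p" "\<And>x. x \<in> {0..1} \<Longrightarrow> cmod (of_real ((sin (2 * pi * x))\<^sup>2) * f x - p x) < sqrt (\<epsilon> / 2)"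
    using trig_poly_approx_sin_sq[OF continuous_on_subset[OF f subset_UNIV], of "sqrt (\<epsilon> / 2)"] \<epsilon> by auto
  have "(LINT x|unit_interval. (cmod (of_real ((sin (2 * pi * x))\<^sup>2) * f x - p x))\<^sup>2) \<le> (LINT x|unit_interval. \<epsilon> / 2)"
  proof (rule integral_mono')
    show "(cmod (of_real ((sin (2 * pi * x))\<^sup>2) * f x - p x))\<^sup>2 \<le> \<epsilon> / 2" if "x \<in> space unit_interval" for x
      using power_mono[OF less_imp_le[OF p(2)[of x]], of 2] that \<epsilon> by auto
  qed (use \<epsilon> in auto)
  also have "\<dots> = \<epsilon> / 2" by (simp add: measure_restrict_space)
  finally show "\<exists>p. trig_poly p \<and> (LINT x|unit_interval. (cmod (of_real ((sin (2 * pi * x))\<^sup>2) * f x - p x))\<^sup>2) < \<epsilon>"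
    using p(1) \<epsilon> by (intro exI[of _ p]) auto
qed

lemma integral_norm_sq_tendsto_0:
  assumes h: "h \<in> borel_measurable M" and g: "\<And>n. g n \<in> borel_measurable M"
    and w: "integrable M w" "\<And>n. AE x in M. (cmod (h x - g n x))\<^sup>2 \<le> w x"
    and lim: "AE x in M. (\<lambda>n. g n x) \<longlonglongrightarrow> h x"
  shows "(\<lambda>n. LINT x|M. (cmod (h x - g n x))\<^sup>2) \<longlonglongrightarrow> 0"
proof -
  note [measurable] = h g
  have "(\<lambda>n. LINT x|M. (cmod (h x - g n x))\<^sup>2) \<longlonglongrightarrow> (LINT x|M. 0)"
  proof (rule integral_dominated_convergence[OF _ _ w(1)])
    show "AE x in M. (\<lambda>n. (cmod (h x - g n x))\<^sup>2) \<longlonglongrightarrow> 0"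
      using lim
    proof eventually_elim
      case (elim x)
      have "(\<lambda>n. (cmod (h x - g n x))\<^sup>2) \<longlonglongrightarrow> (cmod (h x - h x))\<^sup>2"
        by (intro tendsto_intros elim)
      then show ?case by simp
    qed
    show "AE x in M. norm ((cmod (h x - g n x))\<^sup>2) \<le> w x" for n using w(2) by simp
  qed measurable
  then show ?thesis by simp
qed

text \<open>A measurable function is an almost everywhere limit of continuous ones. Clipping their
  values supplies a dominating constant; the factor \<open>w n\<close> turns each of them into sin^2
  times a continuous function and tends to 1 wherever the sine does not vanish, that is, off the
  multiples of 1/2.\<close>

lemma trig_approx_bounded:
  assumes h: "h \<in> borel_measurable lborel" and C: "\<And>x. cmod (h x) \<le> C"
  shows "trig_approx h"
proof -
  define C' where "C' = max C 1"
  have C': "C' > 0" "\<And>x. cmod (h x) \<le> C'" using C by (auto simp: C'_def le_max_iff_disj)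
  have "h measurable_on UNIV"
    using measurable_completion[OF h] by (intro lebesgue_measurable_imp_measurable_on) auto
  then obtain N g where N: "negligible N" and g: "\<And>n. continuous_on UNIV (g n)" "\<And>x. x \<notin> N \<Longrightarrow> (\<lambda>n. g n x) \<longlonglongrightarrow> h x"
    unfolding measurable_on_def by auto
  \<comment> \<open>The continuous radial retraction of the plane onto the disc of radius
    \<open>C'\<close>.\<close>
  define cl where "cl z = of_real (C' / max C' (cmod z)) * z" for z :: complex
  have cl: "continuous_on UNIV cl" unfolding cl_def using C' by (intro continuous_intros) auto
  have cl_le: "cmod (cl z) \<le> C'" for z
    using C'(1) mult_right_mono[of "cmod z" "max C' (cmod z)" C'] by (simp add: cl_def norm_mult norm_divide divide_simps mult_ac)
  have cl_id: "cl z = z" if "cmod z \<le> C'" for z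
    using that C' by (simp add: cl_def max_absorb1)
  define sn where "sn x = (sin (2 * pi * x))\<^sup>2" for x :: real
  have sn: "0 \<le> sn x" "sn x \<le> 1" for x by (auto simp: sn_def abs_square_le_1)
  define w where "w n x = sn x / max (sn x) (inverse (Suc n))" for n x
  have w: "0 \<le> w n x" "w n x \<le> 1" for n x
    using sn[of x] by (auto simp: w_def divide_le_eq_1 max_def)
  define G where "G n x = of_real (w n x) * cl (g n x)" for n x
  have cont: "continuous_on UNIV (\<lambda>x. of_real (1 / max (sn x) (inverse (Suc n))) * cl (g n x))" for n
  proof (intro continuous_on_mult continuous_on_of_real continuous_on_divide continuous_on_const)
    show "continuous_on UNIV (\<lambda>x. max (sn x) (inverse (Suc n)))"
      unfolding sn_def by (intro continuous_intros)
    show "\<forall>x\<in>UNIV. max (sn x) (inverse (Suc n)) \<noteq> 0"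
      by (auto simp: max_def)
    show "continuous_on UNIV (\<lambda>x. cl (g n x))"
      by (rule continuous_on_compose2[OF cl g(1)]) simp
  qed
  have Geq: "G n = (\<lambda>x. of_real (sn x) * (of_real (1 / max (sn x) (inverse (Suc n))) * cl (g n x)))" for n
    by (simp add: G_def w_def fun_eq_iff)
  have Gc: "continuous_on UNIV (G n)" for n
    unfolding Geq by (intro continuous_on_mult[OF _ cont] continuous_intros) (auto simp: sn_def intro!: continuous_intros)
  have Gm: "G n \<in> borel_measurable lborel" for n
    using borel_measurable_continuous_onI[OF Gc] by simp
  have Gb: "cmod (G n x) \<le> C'" for n x
    using mult_mono[OF w(2) cl_le[of "g n x"], of n x] C' w(1)[of n x] by (simp add: G_def norm_mult)
  have hU: "square_integrable unit_interval h" "\<And>n. square_integrable unit_interval (G n)"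
    using C'(2) Gb Gm h by (auto intro!: unit_interval.square_integrable_bounded measurable_unit_interval)
  have ae: "AE x in unit_interval. (\<lambda>n. G n x) \<longlonglongrightarrow> h x"
  proof -
    have "countable (range (\<lambda>k::int. real_of_int k / 2))" by auto
    then have "AE x in lborel. x \<notin> range (\<lambda>k::int. real_of_int k / 2)"
      by (intro AE_not_in countable_imp_null_set_lborel)
    moreover have "AE x in lebesgue. x \<notin> N"
      using N by (intro AE_not_in) (simp add: negligible_iff_null_sets)
    then have "AE x in lborel. x \<notin> N"
      by (simp add: AE_completion_iff)
    ultimately have "AE x in lborel. (\<lambda>n. G n x) \<longlonglongrightarrow> h x"
    proof eventually_elim
      case (elim x)
      have "sin (2 * pi * x) \<noteq> 0"
      proof
        assume "sin (2 * pi * x) = 0"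
        then obtain i :: int where "2 * pi * x = of_int i * pi" using sin_zero_iff_int2 by auto
        then have "x = of_int i / 2" by simp
        with elim(1) show False by blast
      qed
      then have pos: "sn x > 0" by (simp add: sn_def)
      have "(\<lambda>n. w n x) \<longlonglongrightarrow> sn x / max (sn x) 0"
        unfolding w_def using pos by (intro tendsto_intros LIMSEQ_inverse_real_of_nat) auto
      moreover have "(\<lambda>n. cl (g n x)) \<longlonglongrightarrow> cl (h x)"
        by (intro continuous_on_tendsto_compose[OF cl] g(2) elim) auto
      ultimately have "(\<lambda>n. G n x) \<longlonglongrightarrow> of_real (sn x / max (sn x) 0) * cl (h x)"
        unfolding G_def by (intro tendsto_intros)
      then show ?case using pos cl_id[OF C'(2)] by simp
    qed
    then show ?thesis by (subst AE_restrict_space_iff) auto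
  qed
  show ?thesis
  proof (rule trig_approx_limit[OF hU])
    show "trig_approx (G n)" for n
      unfolding Geq sn_def by (rule trig_approx_sin_sq) (use cont[unfolded sn_def] in auto)
    show "(\<lambda>n. LINT x|unit_interval. (cmod (h x - G n x))\<^sup>2) \<longlonglongrightarrow> 0"
    proof (rule integral_norm_sq_tendsto_0[OF _ _ _ _ ae])
      have "(cmod (h x - G n x))\<^sup>2 \<le> (2 * C')\<^sup>2" for n x
        using norm_triangle_ineq4[of "h x" "G n x"] C'(2)[of x] Gb[of n x] by (intro power_mono) auto
      then show "AE x in unit_interval. (cmod (h x - G n x))\<^sup>2 \<le> (2 * C')\<^sup>2" for n by simp
    qed (use h Gm in \<open>auto intro: measurable_unit_interval\<close>)
  qed
qed

text \<open>Cutting off large values reduces to the bounded case, with |h|^2 as dominating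
  function.\<close>

lemma trig_approx_square_integrable:
  assumes hm: "h \<in> borel_measurable lborel" and h: "square_integrable unit_interval h"
  shows "trig_approx h"
proof -
  note [measurable] = hm
  define g where "g n x = (if cmod (h x) \<le> real n then h x else 0)" for n x
  have gm: "g n \<in> borel_measurable lborel" for n unfolding g_def by measurable
  have gb: "cmod (g n x) \<le> real n" for n x by (simp add: g_def)
  show ?thesis
  proof (rule trig_approx_limit[OF h])
    show "square_integrable unit_interval (g n)" for n
      by (rule unit_interval.square_integrable_bounded[of _ "real n"]) (use gm gb in \<open>auto intro: measurable_unit_interval\<close>)
    show "trig_approx (g n)" for n
      using trig_approx_bounded[OF gm gb] .
    show "(\<lambda>n. LINT x|unit_interval. (cmod (h x - g n x))\<^sup>2) \<longlonglongrightarrow> 0"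
    proof (rule integral_norm_sq_tendsto_0[OF _ _ square_integrableD(2)[OF h]])
      show "AE x in unit_interval. (cmod (h x - g n x))\<^sup>2 \<le> (cmod (h x))\<^sup>2" for n
        by (simp add: g_def)
      have "(\<lambda>n. g n x) \<longlonglongrightarrow> h x" for x
      proof (rule tendsto_eventually)
        obtain m where "cmod (h x) \<le> real m" using real_arch_simple by blast
        then show "\<forall>\<^sub>F n in sequentially. g n x = h x"
          by (auto simp: g_def eventually_sequentially intro!: exI[of _ m])
      qed
      then show "AE x in unit_interval. (\<lambda>n. g n x) \<longlonglongrightarrow> h x" by simp
    qed (use hm gm in \<open>auto intro: measurable_unit_interval\<close>)
  qed
qed

text \<open>Completing the square in the coefficients. Taking \<open>c = fcoeff h\<close> gives
  Bessel's inequality, taking \<open>h = 0\<close> gives the norm of a trigonometric polynomial, and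
  general \<open>c\<close> shows that Fourier coefficients are the best choice.\<close>

lemma integral_norm_sq_diff_trig:
  assumes h: "square_integrable unit_interval h" and F: "finite F"
  shows "(LINT x|unit_interval. (cmod (h x - (\<Sum>l\<in>F. c l * fexp l x)))\<^sup>2)
    = (LINT x|unit_interval. (cmod (h x))\<^sup>2) - (\<Sum>l\<in>F. (cmod (fcoeff h l))\<^sup>2) + (\<Sum>l\<in>F. (cmod (fcoeff h l - c l))\<^sup>2)"
proof -
  define p where "p x = (\<Sum>l\<in>F. c l * fexp l x)" for x
  have p: "square_integrable unit_interval p"
    unfolding p_def by (intro square_integrable_sum square_integrable_cmult square_integrable_fexp)
  have hp: "(LINT x|unit_interval. h x * cnj (p x)) = (\<Sum>l\<in>F. fcoeff h l * cnj (c l))"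
  proof -
    have "(LINT x|unit_interval. h x * cnj (p x)) = (LINT x|unit_interval. (\<Sum>l\<in>F. (h x * cnj (fexp l x)) * cnj (c l)))"
      by (simp add: p_def sum_distrib_left mult_ac)
    also have "\<dots> = (\<Sum>l\<in>F. LINT x|unit_interval. (h x * cnj (fexp l x)) * cnj (c l))"
      by (intro Bochner_Integration.integral_sum integrable_mult_left square_integrable_mult h square_integrable_fexp)
    finally show ?thesis by (simp add: fcoeff_def)
  qed
  have pp: "(LINT x|unit_interval. p x * cnj (p x)) = (\<Sum>l\<in>F. c l * cnj (c l))"
  proof -
    have e: "(LINT x|unit_interval. fexp k x * cnj (fexp l x)) = (if k = l then 1 else 0)" for k l
      by (simp add: cnj_fexp fexp_mult integral_fexp)
    have i: "integrable unit_interval (\<lambda>x. fexp k x * cnj (fexp l x))" for k l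
      by (intro square_integrable_mult square_integrable_fexp)
    have "(LINT x|unit_interval. p x * cnj (p x)) = (LINT x|unit_interval. (\<Sum>l\<in>F. \<Sum>k\<in>F. (c k * cnj (c l)) * (fexp k x * cnj (fexp l x))))"
      by (simp add: p_def sum_distrib_left sum_distrib_right mult_ac)
    also have "\<dots> = (\<Sum>l\<in>F. \<Sum>k\<in>F. (c k * cnj (c l)) * (LINT x|unit_interval. fexp k x * cnj (fexp l x)))"
      by (simp only: Bochner_Integration.integral_sum Bochner_Integration.integrable_sum integrable_mult_right i integral_mult_right_zero)
    also have "\<dots> = (\<Sum>l\<in>F. c l * cnj (c l))"
      using F by (simp add: e if_distrib[of "(*) _"] cong: if_cong)
    finally show ?thesis .
  qed
  have expand: "(cmod (a - b))\<^sup>2 = (cmod a)\<^sup>2 - 2 * Re (a * cnj b) + Re (b * cnj b)" for a b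
    by (simp add: cmod_power2) (simp add: power2_eq_square algebra_simps)
  have i1: "integrable unit_interval (\<lambda>x. (cmod (h x))\<^sup>2)" using square_integrableD(2)[OF h] .
  have i2: "integrable unit_interval (\<lambda>x. h x * cnj (p x))" "integrable unit_interval (\<lambda>x. p x * cnj (p x))"
    by (intro square_integrable_mult h p)+
  have split3: "(LINT x|unit_interval. X x - 2 * Y x + Z x) = (LINT x|unit_interval. X x) - 2 * (LINT x|unit_interval. Y x) + (LINT x|unit_interval. Z x)"
    if "integrable unit_interval X" "integrable unit_interval Y" "integrable unit_interval Z" for X Y Z :: "real \<Rightarrow> real"
    using that by simp
  have "(LINT x|unit_interval. (cmod (h x - p x))\<^sup>2) =
      (LINT x|unit_interval. (cmod (h x))\<^sup>2) - 2 * Re (LINT x|unit_interval. h x * cnj (p x)) + Re (LINT x|unit_interval. p x * cnj (p x))"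
    unfolding expand integral_Re[OF i2(1), symmetric] integral_Re[OF i2(2), symmetric]
    by (intro split3 i1 integrable_Re i2)
  also have "\<dots> = (LINT x|unit_interval. (cmod (h x))\<^sup>2) - (\<Sum>l\<in>F. (cmod (fcoeff h l))\<^sup>2) + (\<Sum>l\<in>F. (cmod (fcoeff h l - c l))\<^sup>2)"
    unfolding hp pp expand by (simp add: sum.distrib sum_subtractf sum_distrib_left)
  finally show ?thesis by (simp add: p_def)
qed

text \<open>On every finite set containing the frequencies of a close approximant \<open>p\<close>,
  the Fourier partial sum approximates at least as well as \<open>p\<close>; Bessel's inequality
  supplies the other side.\<close>

theorem parseval:
  assumes hm: "h \<in> borel_measurable lborel" and h: "square_integrable unit_interval h"
  shows "((\<lambda>l. (cmod (fcoeff h l))\<^sup>2) has_sum (LINT x|unit_interval. (cmod (h x))\<^sup>2)) UNIV"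
  unfolding has_sum_def tendsto_iff eventually_finite_subsets_at_top
proof (intro allI impI)
  fix \<epsilon> :: real assume "\<epsilon> > 0"
  let ?I = "LINT x|unit_interval. (cmod (h x))\<^sup>2"
  obtain p where p: "trig_poly p" "(LINT x|unit_interval. (cmod (h x - p x))\<^sup>2) < \<epsilon>"
    using trig_approx_square_integrable[OF hm h] \<open>\<epsilon> > 0\<close> unfolding trig_approx_def by blast
  obtain F c where F: "finite F" "\<And>l. l \<notin> F \<Longrightarrow> c l = 0" "\<And>G. finite G \<Longrightarrow> F \<subseteq> G \<Longrightarrow> p = (\<lambda>x. \<Sum>l\<in>G. c l * fexp l x)"
    using trig_poly_extend[OF p(1)] by blast
  have "dist (\<Sum>l\<in>G. (cmod (fcoeff h l))\<^sup>2) ?I < \<epsilon>" if "finite G" "F \<subseteq> G" for G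
  proof -
    have "?I - (\<Sum>l\<in>G. (cmod (fcoeff h l))\<^sup>2) + (\<Sum>l\<in>G. (cmod (fcoeff h l - c l))\<^sup>2) < \<epsilon>"
      using p(2) integral_norm_sq_diff_trig[OF h that(1), of c] F(3)[OF that] by simp
    moreover have "0 \<le> (\<Sum>l\<in>G. (cmod (fcoeff h l - c l))\<^sup>2)" by (intro sum_nonneg) auto
    moreover have "0 \<le> ?I - (\<Sum>l\<in>G. (cmod (fcoeff h l))\<^sup>2)"
    proof -
      have "0 \<le> (LINT x|unit_interval. (cmod (h x - (\<Sum>l\<in>G. fcoeff h l * fexp l x)))\<^sup>2)"
        by (intro integral_nonneg_AE) auto
      then show ?thesis
        unfolding integral_norm_sq_diff_trig[OF h that(1)] by simp
    qed
    ultimately show ?thesis by (simp add: dist_real_def)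
  qed
  with F(1) show "\<exists>X. finite X \<and> X \<subseteq> UNIV \<and> (\<forall>Y. finite Y \<and> X \<subseteq> Y \<and> Y \<subseteq> UNIV \<longrightarrow> dist (\<Sum>l\<in>Y. (cmod (fcoeff h l))\<^sup>2) ?I < \<epsilon>)"
    by blast
qed

section \<open>The theta inversion formula\<close>


text \<open>This is the characteristic function of the standard normal distribution at
  \<open>\<tau>\<close>, after the substitution x to c x with c^2 = 2 s.\<close>

lemma gaussian_fourier_integral:
  assumes s: "s > 0"
  shows "integrable lborel (\<lambda>x. exp (- s * x\<^sup>2))"
    and "(LINT x|lborel. complex_of_real (exp (- s * x\<^sup>2)) * cnj (fexp l x))
       = of_real (sqrt (pi / s) * exp (- (pi\<^sup>2 / s) * (of_int l)\<^sup>2))"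
proof -
  define c where "c = sqrt (2 * s)"
  have c: "c > 0" "c\<^sup>2 = 2 * s" using s by (auto simp: c_def)
  define \<tau> where "\<tau> = - (2 * pi * of_int l) / c"
  have dens: "std_normal_density (c * x) = (1 / sqrt (2 * pi)) * exp (- s * x\<^sup>2)" for x
    using c by (simp add: std_normal_density_def power_mult_distrib)
  have "integrable lborel (\<lambda>x. std_normal_density (0 + c * x))"
    using c by (intro lborel_integrable_real_affine) auto
  from integrable_mult_right[OF this, of "sqrt (2 * pi)"]
  show "integrable lborel (\<lambda>x. exp (- s * x\<^sup>2))"
    unfolding add_0 dens by (rule Bochner_Integration.integrable_cong[THEN iffD1, OF refl, rotated]) simp
  have "complex_of_real (exp (- (\<tau>\<^sup>2) / 2)) = char std_normal_distribution \<tau>"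
    by (simp add: char_std_normal_distribution)
  also have "\<dots> = (LINT x|lborel. std_normal_density x *\<^sub>R iexp (\<tau> * x))"
    unfolding char_def by (subst integral_density) auto
  also have "\<dots> = \<bar>c\<bar> *\<^sub>R (LINT x|lborel. std_normal_density (0 + c * x) *\<^sub>R iexp (\<tau> * (0 + c * x)))"
    using c by (intro lborel_integral_real_affine) auto
  also have "(\<lambda>x. std_normal_density (0 + c * x) *\<^sub>R iexp (\<tau> * (0 + c * x)))
      = (\<lambda>x. (1 / sqrt (2 * pi)) *\<^sub>R (complex_of_real (exp (- s * x\<^sup>2)) * cnj (fexp l x)))"
  proof
    fix x
    have "\<tau> * (c * x) = - (2 * pi * of_int l * x)"
      using c by (simp add: \<tau>_def)
    then have "iexp (\<tau> * (0 + c * x)) = cnj (fexp l x)"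
      unfolding fexp_def cis_cnj by (simp only: add_0 cis_conv_exp)
    then show "std_normal_density (0 + c * x) *\<^sub>R iexp (\<tau> * (0 + c * x)) =
        (1 / sqrt (2 * pi)) *\<^sub>R (complex_of_real (exp (- s * x\<^sup>2)) * cnj (fexp l x))"
      by (simp only: add_0 dens) (simp add: scaleR_conv_of_real)
  qed
  finally have e: "complex_of_real (exp (- (\<tau>\<^sup>2) / 2)) =
      (c / sqrt (2 * pi)) *\<^sub>R (LINT x|lborel. complex_of_real (exp (- s * x\<^sup>2)) * cnj (fexp l x))"
    using c by simp
  have "sqrt (2 * pi) / c = sqrt (pi / s)"
    by (simp add: c_def real_sqrt_divide[symmetric])
  moreover have "- (\<tau>\<^sup>2) / 2 = - (pi\<^sup>2 / s) * (of_int l)\<^sup>2"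
    using s by (simp add: \<tau>_def power_divide power_mult_distrib c(2))
  moreover have "(LINT x|lborel. complex_of_real (exp (- s * x\<^sup>2)) * cnj (fexp l x)) = (sqrt (2 * pi) / c) *\<^sub>R complex_of_real (exp (- (\<tau>\<^sup>2) / 2))"
    using c unfolding e by simp
  ultimately show "(LINT x|lborel. complex_of_real (exp (- s * x\<^sup>2)) * cnj (fexp l x))
       = of_real (sqrt (pi / s) * exp (- (pi\<^sup>2 / s) * (of_int l)\<^sup>2))"
    by (simp only: scaleR_conv_of_real of_real_mult)
qed

lemma continuous_on_infsum:
  fixes f :: "'i \<Rightarrow> 'a :: topological_space \<Rightarrow> 'b :: banach"
  assumes "\<And>k. continuous_on S (f k)" "\<And>k x. x \<in> S \<Longrightarrow> norm (f k x) \<le> M k" "M summable_on UNIV"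
  shows "continuous_on S (\<lambda>x. \<Sum>\<^sub>\<infinity>k. f k x)"
  by (rule uniform_limit_theorem[OF _ Weierstrass_m_test_general[where M=M and X=UNIV]])
     (use assms in \<open>auto intro!: always_eventually continuous_on_sum\<close>)

section \<open>The periodized Gaussian\<close>

definition gauss_periodic :: "real \<Rightarrow> real \<Rightarrow> real" where
  "gauss_periodic s x = (\<Sum>\<^sub>\<infinity>m::int. exp (- s * (x + of_int m)\<^sup>2))"

text \<open>Since m^2 / 2 \<le> (x + m)^2 + x^2, giving up half of the decay rate yields a majorant
  that is uniform for bounded x.\<close>

lemma gauss_translate_bound:
  fixes s x R :: real
  assumes "s > 0" "\<bar>x\<bar> \<le> R"
  shows "exp (- s * (x + of_int m)\<^sup>2) \<le> exp (s * R\<^sup>2) * exp (- (s / 2) * (of_int m)\<^sup>2)"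
proof -
  have "(of_int m)\<^sup>2 / 2 \<le> (x + of_int m)\<^sup>2 + x\<^sup>2"
    using zero_le_power2[of "2 * x + of_int m"] by (simp add: power2_eq_square algebra_simps)
  moreover have "x\<^sup>2 \<le> R\<^sup>2" using assms(2) by (metis abs_ge_zero power2_abs power_mono)
  ultimately have "s * ((of_int m)\<^sup>2 / 2) \<le> s * ((x + of_int m)\<^sup>2 + R\<^sup>2)"
    using assms(1) by (intro mult_left_mono) auto
  then show ?thesis unfolding exp_add[symmetric] by (simp add: algebra_simps)
qed

lemma has_sum_gauss_periodic:
  assumes "s > 0"
  shows "((\<lambda>m::int. exp (- s * (x + of_int m)\<^sup>2)) has_sum gauss_periodic s x) UNIV"
proof -
  have "(\<lambda>m::int. exp (s * \<bar>x\<bar>\<^sup>2) * exp (- (s / 2) * (of_int m)\<^sup>2)) summable_on UNIV"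
    using assms by (intro summable_on_cmult_right summable_on_gauss_weight) auto
  then have "(\<lambda>m::int. exp (- s * (x + of_int m)\<^sup>2)) summable_on UNIV"
    by (rule summable_on_comparison_test) (use gauss_translate_bound[OF assms order_refl] in auto)
  then show ?thesis by (simp add: gauss_periodic_def)
qed

lemma isCont_gauss_periodic:
  assumes "s > 0"
  shows "isCont (gauss_periodic s) x"
proof -
  let ?S = "{- (\<bar>x\<bar> + 1) .. \<bar>x\<bar> + 1}"
  have "continuous_on ?S (\<lambda>y. \<Sum>\<^sub>\<infinity>m::int. exp (- s * (y + of_int m)\<^sup>2))"
  proof (rule continuous_on_infsum)
    show "norm (exp (- s * (y + of_int m)\<^sup>2)) \<le> exp (s * (\<bar>x\<bar> + 1)\<^sup>2) * exp (- (s / 2) * (of_int m)\<^sup>2)"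
      if "y \<in> ?S" for y and m :: int
      using gauss_translate_bound[OF assms, of y "\<bar>x\<bar> + 1" m] that by auto
    show "(\<lambda>m::int. exp (s * (\<bar>x\<bar> + 1)\<^sup>2) * exp (- (s / 2) * (of_int m)\<^sup>2)) summable_on UNIV"
      using assms by (intro summable_on_cmult_right summable_on_gauss_weight) auto
  qed (intro continuous_intros)
  moreover have "x \<in> interior ?S" unfolding interior_atLeastAtMost_real by auto
  ultimately show ?thesis
    unfolding gauss_periodic_def[abs_def] by (rule continuous_on_interior)
qed

lemma gauss_periodic_of_int_add: "gauss_periodic s (x + of_int n) = gauss_periodic s x"
  unfolding gauss_periodic_def
  by (rule infsum_reindex_bij_witness[of _ "\<lambda>m. m - n" "\<lambda>m. m + n"]) (auto simp: add_ac)

lemma gtheta_of_int_add: "gtheta s (x + of_int n) = gtheta s x"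
proof -
  have "cos (2 * pi * of_int k * (x + of_int n)) = cos (2 * pi * of_int k * x)" for k
  proof -
    have "2 * pi * of_int k * (x + of_int n) = 2 * pi * of_int k * x + 2 * pi * of_int (k * n)"
      by (simp add: algebra_simps)
    then show ?thesis by (simp only: cos_add cos_int_2pin sin_int_2pin mult_1_right mult_zero_right diff_zero)
  qed
  then show ?thesis by (simp add: gtheta_def)
qed

text \<open>The reflection of k to -k conjugates every term, so the sum is real and equals the sum
  of the real parts.\<close>

lemma has_sum_gtheta_fexp:
  assumes "s > 0"
  shows "((\<lambda>k::int. complex_of_real (exp (- s * (of_int k)\<^sup>2)) * fexp k x) has_sum of_real (gtheta s x)) UNIV"
proof -
  let ?f = "\<lambda>k::int. complex_of_real (exp (- s * (of_int k)\<^sup>2)) * fexp k x"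
  define f where "f = ?f"
  have sm: "f summable_on UNIV"
    unfolding f_def by (rule Infinite_Sum.abs_summable_summable) (use summable_on_gauss_weight[OF assms] in \<open>simp add: norm_mult\<close>)
  have "(f has_sum infsum f UNIV) UNIV" using sm by simp
  then have "((\<lambda>k. f (- k)) has_sum infsum f UNIV) UNIV"
    using has_sum_reindex_bij_betw[OF bij_uminus, of f] by blast
  moreover have "f (- k) = cnj (f k)" for k
    by (simp add: f_def cnj_fexp)
  ultimately have "((\<lambda>k. cnj (f k)) has_sum infsum f UNIV) UNIV" by simp
  then have "infsum f UNIV = cnj (infsum f UNIV)"
    by (metis infsumI infsum_cnj)
  then have "Im (infsum f UNIV) = 0" by (metis cnj.simps(2) neg_equal_zero)
  moreover have "((\<lambda>k. Re (f k)) has_sum Re (infsum f UNIV)) UNIV"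
    using sm by (intro has_sum_Re) simp
  then have "((\<lambda>k. exp (- s * (of_int k)\<^sup>2) * cos (2 * pi * of_int k * x)) has_sum Re (infsum f UNIV)) UNIV"
    by (simp add: f_def fexp_def)
  then have "Re (infsum f UNIV) = gtheta s x"
    using has_sum_gtheta[OF assms] has_sum_unique by blast
  ultimately have "infsum f UNIV = of_real (gtheta s x)" by (simp add: complex_eq_iff)
  with sm have "(f has_sum of_real (gtheta s x)) UNIV" by (simp add: has_sum_iff)
  then show ?thesis by (simp add: f_def)
qed

lemma continuous_on_gtheta:
  assumes "s > 0"
  shows "continuous_on UNIV (gtheta s)"
  unfolding gtheta_def[abs_def]
  by (rule continuous_on_infsum[OF _ _ summable_on_gauss_weight[OF assms]])
     (auto intro!: continuous_intros simp: abs_mult)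

lemma isCont_gtheta: "s > 0 \<Longrightarrow> isCont (gtheta s) x"
  using continuous_on_gtheta continuous_on_eq_continuous_at[OF open_UNIV] by blast

lemma fcoeff_gtheta:
  assumes "s > 0"
  shows "fcoeff (\<lambda>x. of_real (gtheta s x)) l = of_real (exp (- s * (of_int l)\<^sup>2))"
proof -
  let ?f = "\<lambda>k x. complex_of_real (exp (- s * (of_int k)\<^sup>2)) * (fexp k x * cnj (fexp l x))"
  have "((\<lambda>k. LINT x|unit_interval. ?f k x) has_sum (LINT x|unit_interval. (\<Sum>\<^sub>\<infinity>k. ?f k x))) UNIV"
  proof (rule has_sum_integral(2))
    show "integrable unit_interval (?f k)" for k
      by (intro integrable_mult_right square_integrable_mult square_integrable_fexp)
    show "(\<lambda>k. norm (?f k x)) summable_on UNIV" for x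
      using summable_on_gauss_weight[OF assms] by (simp add: norm_mult)
    show "(\<lambda>k. LINT x|unit_interval. norm (?f k x)) summable_on UNIV"
      using summable_on_gauss_weight[OF assms] by (simp add: norm_mult measure_restrict_space)
  qed
  moreover have "(\<Sum>\<^sub>\<infinity>k. ?f k x) = of_real (gtheta s x) * cnj (fexp l x)" for x
    using has_sum_cmult_left[OF has_sum_gtheta_fexp[OF assms, of x], of "cnj (fexp l x)"]
    by (simp add: has_sum_iff mult.assoc)
  moreover have "(LINT x|unit_interval. ?f k x) = (if k = l then of_real (exp (- s * (of_int l)\<^sup>2)) else 0)" for k
    by (simp add: cnj_fexp fexp_mult integral_fexp)
  ultimately have 1: "((\<lambda>k. if k = l then complex_of_real (exp (- s * (of_int l)\<^sup>2)) else 0) has_sum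
      fcoeff (\<lambda>x. of_real (gtheta s x)) l) UNIV"
    by (simp add: fcoeff_def)
  have "((\<lambda>k. if k = l then complex_of_real (exp (- s * (of_int l)\<^sup>2)) else 0) has_sum
      of_real (exp (- s * (of_int l)\<^sup>2))) {l}"
    by (rule has_sum_finiteI) auto
  then have "((\<lambda>k. if k = l then complex_of_real (exp (- s * (of_int l)\<^sup>2)) else 0) has_sum
      of_real (exp (- s * (of_int l)\<^sup>2))) UNIV"
    by (rule has_sum_cong_neutral[THEN iffD1, rotated -1]) auto
  then show ?thesis using 1 has_sum_unique by blast
qed

text \<open>Unfolding: the characters have period 1, so the coefficient of the periodization is the
  Fourier integral of the Gaussian over the whole line.\<close>

lemma fcoeff_gauss_periodic:
  assumes "s > 0"
  shows "fcoeff (\<lambda>x. of_real (gauss_periodic s x)) l = of_real (sqrt (pi / s) * exp (- (pi\<^sup>2 / s) * (of_int l)\<^sup>2))"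
proof -
  let ?g = "\<lambda>x. complex_of_real (exp (- s * x\<^sup>2)) * cnj (fexp l x)"
  have [measurable]: "cnj \<in> borel_measurable borel"
    by (intro borel_measurable_continuous_onI continuous_intros)
  have g: "integrable lborel ?g"
    by (rule Bochner_Integration.integrable_bound[OF gaussian_fourier_integral(1)[OF assms]])
       (measurable, simp add: norm_mult)
  have n: "norm (?g (x + of_int m)) = exp (- s * (x + of_int m)\<^sup>2)" for x m
    by (simp add: norm_mult)
  have "((\<lambda>m. LINT x|unit_interval. ?g (x + of_int m)) has_sum (LINT x|unit_interval. (\<Sum>\<^sub>\<infinity>m. ?g (x + of_int m)))) UNIV"
  proof (rule has_sum_integral(2))
    show "integrable unit_interval (\<lambda>x. ?g (x + of_int m))" for m
      by (rule integrable_unit_interval_shift[OF g])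
    show "(\<lambda>m. norm (?g (x + of_int m))) summable_on UNIV" for x
      unfolding n using has_sum_gauss_periodic[OF assms] by (rule has_sum_imp_summable)
    show "(\<lambda>m. LINT x|unit_interval. norm (?g (x + of_int m))) summable_on UNIV"
      using has_sum_integral_periodize[OF integrable_norm[OF g]] by (rule has_sum_imp_summable)
  qed
  moreover have "(\<Sum>\<^sub>\<infinity>m. ?g (x + of_int m)) = of_real (gauss_periodic s x) * cnj (fexp l x)" for x
    using has_sum_cmult_left[OF has_sum_of_real[OF has_sum_gauss_periodic[OF assms, of x]], of "cnj (fexp l x)"]
    by (simp add: has_sum_iff)
  ultimately have "((\<lambda>m. LINT x|unit_interval. ?g (x + of_int m)) has_sum fcoeff (\<lambda>x. of_real (gauss_periodic s x)) l) UNIV"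
    by (simp add: fcoeff_def)
  from has_sum_unique[OF this has_sum_integral_periodize[OF g]] gaussian_fourier_integral(2)[OF assms, of l]
  show ?thesis by simp
qed

text \<open>By Parseval the integral of |D|^2 vanishes, and continuity turns this into vanishing at
  every point, the right end included.\<close>

lemma continuous_zero_of_fcoeff_zero:
  assumes D: "continuous_on UNIV D" and z: "\<And>l. fcoeff D l = 0" and x: "x \<in> {0..1}"
  shows "D x = 0"
proof -
  have m: "D \<in> borel_measurable lborel"
    using borel_measurable_continuous_onI[OF D] by simp
  have "((\<lambda>l::int. 0) has_sum (LINT x|unit_interval. (cmod (D x))\<^sup>2)) UNIV"
    using parseval[OF m square_integrable_unit_interval_continuous[OF D]] by (simp add: z)
  then have I: "(LINT x|unit_interval. (cmod (D x))\<^sup>2) = 0"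
    using has_sum_0_simp has_sum_unique by blast
  have "(LINT x:{0..1}|lborel. (cmod (D x))\<^sup>2) = (LINT x:{0..<1}|lborel. (cmod (D x))\<^sup>2)"
    unfolding set_lebesgue_integral_def using m
    by (intro integral_cong_AE) (auto simp: indicator_def intro: eventually_mono[OF AE_lborel_singleton[of 1]])
  also have "\<dots> = (LINT x|unit_interval. (cmod (D x))\<^sup>2)"
    unfolding set_lebesgue_integral_def by (subst integral_restrict_space) auto
  finally have I': "(LINT x:{0..1}|lborel. (cmod (D x))\<^sup>2) = 0" using I by simp
  have cont: "continuous_on {0..1} (\<lambda>x. (cmod (D x))\<^sup>2)"
    by (intro continuous_intros continuous_on_subset[OF D]) auto
  then have "((\<lambda>x. (cmod (D x))\<^sup>2) has_integral 0) {0..1}"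
    using set_borel_integral_eq_integral[OF borel_integrable_compact[OF compact_Icc cont, folded set_integrable_def[of lborel "{0..1}", simplified]]] I'
    by (metis has_integral_integral)
  then have "(cmod (D x))\<^sup>2 = 0"
    using has_integral_0_cbox_imp_0[of 0 1 "\<lambda>x. (cmod (D x))\<^sup>2" x] cont x by simp
  then show ?thesis by simp
qed

text \<open>Poisson summation: both sides are continuous with equal Fourier coefficients, so they
  agree on the period, and both have period 1.\<close>

theorem gauss_periodic_eq_gtheta:
  assumes s: "s > 0"
  shows "gauss_periodic s x = sqrt (pi / s) * gtheta (pi\<^sup>2 / s) x"
proof -
  define t where "t = pi\<^sup>2 / s"
  have t: "t > 0" using s by (simp add: t_def)
  let ?H = "\<lambda>x. complex_of_real (gauss_periodic s x)" and ?K = "\<lambda>x. of_real (sqrt (pi / s)) * complex_of_real (gtheta t x)"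
  have cH: "continuous_on UNIV ?H"
    by (intro continuous_on_of_real continuous_at_imp_continuous_on ballI isCont_gauss_periodic s)
  have cK: "continuous_on UNIV ?K"
    by (intro continuous_on_of_real continuous_on_mult continuous_on_const continuous_on_gtheta t)
  have int: "integrable unit_interval (\<lambda>x. F x * cnj (fexp l x))" if "continuous_on UNIV F" for F l
    by (intro square_integrable_mult(2) square_integrable_fexp square_integrable_unit_interval_continuous that)
  have "fcoeff (\<lambda>x. ?H x - ?K x) l = 0" for l
  proof -
    have "fcoeff ?K l = of_real (sqrt (pi / s)) * fcoeff (\<lambda>x. of_real (gtheta t x)) l"
      by (simp add: fcoeff_def mult.assoc)
    moreover have "fcoeff (\<lambda>x. ?H x - ?K x) l = fcoeff ?H l - fcoeff ?K l"
      unfolding fcoeff_def left_diff_distrib by (intro Bochner_Integration.integral_diff int cH cK)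
    ultimately show ?thesis
      using fcoeff_gauss_periodic[OF s, of l] fcoeff_gtheta[OF t, of l] by (simp add: t_def)
  qed
  from continuous_zero_of_fcoeff_zero[OF continuous_on_diff[OF cH cK] this, of "frac x"]
  have "gauss_periodic s (frac x) = sqrt (pi / s) * gtheta t (frac x)"
    using frac_lt_1[of x] by (simp add: frac_ge_0 less_imp_le flip: of_real_mult)
  moreover have "x = frac x + of_int \<lfloor>x\<rfloor>" by (simp add: frac_def)
  ultimately show ?thesis
    by (metis gauss_periodic_of_int_add gtheta_of_int_add t_def)
qed

text \<open>At x = 0 the periodized Gaussian and the theta series are literally the same
  series.\<close>

lemma gtheta_inversion_0:
  assumes "s > 0"
  shows "gtheta s 0 = sqrt (pi / s) * gtheta (pi\<^sup>2 / s) 0"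
  using gauss_periodic_eq_gtheta[OF assms, of 0] by (simp add: gauss_periodic_def gtheta_def)

text \<open>
  The inversion formula at \<open>s = \<pi> / 2\<close>, where \<open>\<pi>\<^sup>2 / s = 4 s\<close>, closes the two duplication steps from
  \<open>s\<close> to \<open>4 s\<close> into the equation \<open>x\<^sup>2 = 2 y\<^sup>2\<close> for \<open>x = \<theta>\<^sub>3\<^sup>2\<close> and \<open>y = \<theta>\<^sub>4\<^sup>2\<close> at \<open>e\<^sup>-\<^sup>\<pi>\<close>.
\<close>
lemma gtheta_pi_ratio: "(gtheta pi 0)\<^sup>2 = sqrt 2 * (gtheta pi (1/2))\<^sup>2"
proof -
  define u where "u = (gtheta (pi / 2) 0)\<^sup>2"
  define v where "v = (gtheta (pi / 2) (1/2))\<^sup>2"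
  define X where "X = (gtheta pi 0)\<^sup>2"
  define Y where "Y = (gtheta pi (1/2))\<^sup>2"
  have X: "X = (u + v) / 2" using gtheta_double_0[of "pi / 2"] by (simp add: X_def u_def v_def)
  have Y: "Y\<^sup>2 = u * v"
    using gtheta_double_half[of "pi / 2"] by (simp add: Y_def u_def v_def power_mult_distrib)
  have "gtheta (pi / 2) 0 = sqrt 2 * gtheta (2 * pi) 0"
    using gtheta_inversion_0[of "pi / 2"] by (simp add: power2_eq_square mult.commute)
  then have "u = 2 * (gtheta (2 * pi) 0)\<^sup>2"
    by (simp add: u_def power_mult_distrib)
  then have "u = X + Y" using gtheta_double_0[of pi] by (simp add: X_def Y_def)
  with X have "v = X - Y" by simp
  with Y \<open>u = X + Y\<close> have "X\<^sup>2 = 2 * Y\<^sup>2" by (simp add: power2_eq_square algebra_simps)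
  then have "X\<^sup>2 = (sqrt 2 * Y)\<^sup>2" by (simp add: power_mult_distrib)
  moreover have "X \<ge> 0" "Y \<ge> 0" by (simp_all add: X_def Y_def)
  ultimately have "X = sqrt 2 * Y" by (simp add: power2_eq_iff_nonneg)
  then show ?thesis by (simp add: X_def Y_def)
qed

section \<open>The space \<open>L\<^sup>2(\<real>)\<close>\<close>


lemma L2_iff: "f \<in> L2 \<longleftrightarrow> square_integrable lborel f"
  by (simp add: L2_def square_integrable_def)

lemma l2_norm_eq: "l2_norm f = sqrt (LINT t|lborel. (cmod (f t))\<^sup>2)"
proof -
  have "f t * cnj (f t) = of_real ((cmod (f t))\<^sup>2)" for t
    by (simp only: complex_norm_square)
  then show ?thesis by (simp add: l2_norm_def l2_inner_def del: of_real_power)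
qed

lemma l2_norm_nonneg [simp]: "l2_norm f \<ge> 0"
  unfolding l2_norm_eq by (intro real_sqrt_ge_zero integral_nonneg_AE) auto

lemma l2_norm_sq: "(l2_norm f)\<^sup>2 = (LINT t|lborel. (cmod (f t))\<^sup>2)"
  unfolding l2_norm_eq by (rule real_sqrt_pow2) (intro integral_nonneg_AE, auto)

lemma l2_inner_self: "l2_inner f f = of_real ((l2_norm f)\<^sup>2)"
proof -
  have "f t * cnj (f t) = of_real ((cmod (f t))\<^sup>2)" for t
    by (simp only: complex_norm_square)
  then show ?thesis by (simp add: l2_norm_sq l2_inner_def del: of_real_power)
qed

lemma cmod_l2_inner_le:
  assumes "f \<in> L2" "g \<in> L2"
  shows "cmod (l2_inner f g) \<le> l2_norm f * l2_norm g"
proof -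
  have "cmod (l2_inner f g) \<le> (LINT t|lborel. cmod (f t) * cmod (g t))"
    unfolding l2_inner_def using integral_norm_bound[of lborel "\<lambda>t. f t * cnj (g t)"] by (simp add: norm_mult)
  moreover have "(LINT t|lborel. cmod (f t) * cmod (g t))\<^sup>2 \<le> (l2_norm f * l2_norm g)\<^sup>2"
    using integral_Cauchy_Schwarz[of lborel f g] assms by (simp add: L2_iff power_mult_distrib l2_norm_sq)
  then have "(LINT t|lborel. cmod (f t) * cmod (g t)) \<le> l2_norm f * l2_norm g"
    by (rule power2_le_imp_le) simp
  ultimately show ?thesis by linarith
qed

lemma L2_add: "f \<in> L2 \<Longrightarrow> g \<in> L2 \<Longrightarrow> (\<lambda>t. f t + g t) \<in> L2"
  and L2_diff: "f \<in> L2 \<Longrightarrow> g \<in> L2 \<Longrightarrow> (\<lambda>t. f t - g t) \<in> L2"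
  and L2_cmult: "f \<in> L2 \<Longrightarrow> (\<lambda>t. c * f t) \<in> L2"
  and L2_sum: "(\<And>i. i \<in> I \<Longrightarrow> h i \<in> L2) \<Longrightarrow> (\<lambda>t. \<Sum>i\<in>I. h i t) \<in> L2"
  by (simp_all add: L2_iff square_integrable_add square_integrable_diff square_integrable_cmult square_integrable_sum)

lemma l2_inner_add_left:
  assumes "f \<in> L2" "g \<in> L2" "h \<in> L2"
  shows "l2_inner (\<lambda>t. f t + g t) h = l2_inner f h + l2_inner g h"
  using assms by (simp add: l2_inner_def L2_iff distrib_right square_integrable_mult)

lemma l2_inner_diff_left:
  assumes "f \<in> L2" "g \<in> L2" "h \<in> L2"
  shows "l2_inner (\<lambda>t. f t - g t) h = l2_inner f h - l2_inner g h"
  using assms by (simp add: l2_inner_def L2_iff left_diff_distrib square_integrable_mult)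

lemma l2_inner_cmult_left: "l2_inner (\<lambda>t. c * f t) h = c * l2_inner f h"
  by (simp add: l2_inner_def mult.assoc)

lemma l2_inner_sum_left:
  assumes "\<And>i. i \<in> I \<Longrightarrow> f i \<in> L2" "h \<in> L2"
  shows "l2_inner (\<lambda>t. \<Sum>i\<in>I. f i t) h = (\<Sum>i\<in>I. l2_inner (f i) h)"
  using assms by (simp add: l2_inner_def L2_iff sum_distrib_right square_integrable_mult)

lemma l2_inner_commute: "l2_inner g f = cnj (l2_inner f g)"
proof -
  have "(LINT t|lborel. cnj (f t * cnj (g t))) = cnj (LINT t|lborel. f t * cnj (g t))"
    by (rule Bochner_Integration.integral_cnj)
  then show ?thesis by (simp add: l2_inner_def mult.commute)
qed

lemma l2_norm_cmult: "l2_norm (\<lambda>t. c * f t) = cmod c * l2_norm f"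
  by (simp add: l2_norm_eq norm_mult power_mult_distrib real_sqrt_mult)

lemma l2_norm_triangle:
  assumes "f \<in> L2" "g \<in> L2"
  shows "l2_norm (\<lambda>t. f t + g t) \<le> l2_norm f + l2_norm g"
proof (rule power2_le_imp_le)
  let ?h = "\<lambda>t. f t + g t"
  have h: "?h \<in> L2" using assms by (rule L2_add)
  have inner: "Re (l2_inner u v) \<le> l2_norm u * l2_norm v" if "u \<in> L2" "v \<in> L2" for u v
    using cmod_l2_inner_le[OF that] complex_Re_le_cmod[of "l2_inner u v"] by linarith
  have "(l2_norm ?h)\<^sup>2 = Re (l2_inner ?h ?h)" by (simp add: l2_inner_self)
  also have "\<dots> = Re (l2_inner f ?h) + Re (l2_inner g ?h)"
    by (simp add: l2_inner_add_left assms h)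
  also have "\<dots> \<le> l2_norm f * l2_norm ?h + l2_norm g * l2_norm ?h"
    by (intro add_mono inner assms h)
  finally have "l2_norm ?h * l2_norm ?h \<le> (l2_norm f + l2_norm g) * l2_norm ?h"
    by (simp add: power2_eq_square distrib_right)
  then have "l2_norm ?h \<le> l2_norm f + l2_norm g"
    by (cases "l2_norm ?h = 0") (auto simp: mult_le_cancel_right order.strict_iff_order add_nonneg_nonneg)
  then show "(l2_norm ?h)\<^sup>2 \<le> (l2_norm f + l2_norm g)\<^sup>2"
    by (intro power_mono) auto
qed simp

lemma l2_norm_minus_commute: "l2_norm (\<lambda>t. f t - g t) = l2_norm (\<lambda>t. g t - f t)"
  by (simp add: l2_norm_eq norm_minus_commute)

lemma l2_norm_triangle_diff:
  assumes "f \<in> L2" "g \<in> L2"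
  shows "\<bar>l2_norm f - l2_norm g\<bar> \<le> l2_norm (\<lambda>t. f t - g t)"
  using l2_norm_triangle[OF L2_diff[OF assms] assms(2)] l2_norm_triangle[OF L2_diff[OF assms(2,1)] assms(1)]
  by (simp add: l2_norm_minus_commute[of g f])

lemma l2_norm_tendsto:
  assumes "\<And>n. d n \<in> L2" "f \<in> L2" "(\<lambda>n. l2_norm (\<lambda>t. d n t - f t)) \<longlonglongrightarrow> 0"
  shows "(\<lambda>n. l2_norm (d n)) \<longlonglongrightarrow> l2_norm f"
proof (rule LIM_zero_cancel, rule Lim_null_comparison[OF _ assms(3)])
  show "\<forall>\<^sub>F n in sequentially. norm (l2_norm (d n) - l2_norm f) \<le> l2_norm (\<lambda>t. d n t - f t)"
    using l2_norm_triangle_diff[OF assms(1,2)] by simp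
qed

text \<open>
  Riesz--Fischer: with \<open>W = \<Sum> 4\<^sup>j |u\<^sub>j|\<^sup>2\<close>, which is integrable, one has
  \<open>|u\<^sub>j| \<le> 2\<^sup>-\<^sup>j sqrt W\<close>, so the series converges absolutely almost everywhere with a tail bound in \<open>L\<^sup>2\<close>.
\<close>
lemma L2_series_convergent:
  assumes u: "\<And>j. u j \<in> L2" and le: "\<And>j::nat. (l2_norm (u j))\<^sup>2 \<le> C * (1 / 16) ^ j"
  shows "\<exists>g\<in>L2. (\<lambda>n. l2_norm (\<lambda>t. (\<Sum>j<n. u j t) - g t)) \<longlonglongrightarrow> 0"
proof -
  have sq: "square_integrable lborel (u j)" for j using u by (simp add: L2_iff)
  note [measurable] = square_integrableD(1)[OF sq]

  \<comment> \<open>The decay 16^(-j) leaves room for the weight 4^j: the integrals still decay like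
    4^(-j).\<close>
  define v where "v j t = 4 ^ j * (cmod (u j t))\<^sup>2" for j t
  have v: "integrable lborel (v j)" "v j t \<ge> 0" for j t
    unfolding v_def using square_integrableD(2)[OF sq] by auto
  have Iv: "(LINT t|lborel. v j t) \<le> C * (1/4) ^ j" for j
  proof -
    have "(LINT t|lborel. v j t) = 4 ^ j * (l2_norm (u j))\<^sup>2"
      unfolding v_def l2_norm_sq by simp
    also have "\<dots> \<le> 4 ^ j * (C * (1/16) ^ j)" by (intro mult_left_mono le) auto
    also have "\<dots> = C * (4 * (1 / 16)) ^ j" unfolding power_mult_distrib by simp
    finally show ?thesis by simp
  qed
  have sI: "summable (\<lambda>j. LINT t|lborel. v j t)"
  proof (rule summable_comparison_test')
    show "summable (\<lambda>j. C * (1/4) ^ j)" by (intro summable_mult summable_geometric) auto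
    show "norm (LINT t|lborel. v j t) \<le> C * (1/4) ^ j" if "j \<ge> 0" for j
      using Iv[of j] integral_nonneg_AE[of "v j" lborel] v(2) by simp
  qed
  have ae: "AE t in lborel. summable (\<lambda>j. v j t)"
  proof -
    have "(\<integral>\<^sup>+ t. (\<Sum>j. ennreal (v j t)) \<partial>lborel) = (\<Sum>j. \<integral>\<^sup>+ t. ennreal (v j t) \<partial>lborel)"
      using v(1) by (intro nn_integral_suminf) auto
    also have "\<dots> = (\<Sum>j. ennreal (LINT t|lborel. v j t))"
      by (intro suminf_cong nn_integral_eq_integral v) (use v(2) in auto)
    also have "\<dots> \<noteq> top"
      using sI integral_nonneg_AE[of "v _" lborel] v(2) by (simp add: ennreal_suminf_neq_top)
    finally have "(\<integral>\<^sup>+ t. (\<Sum>j. ennreal (v j t)) \<partial>lborel) \<noteq> \<infinity>" by simp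
    moreover have "(\<lambda>t. \<Sum>j. ennreal (v j t)) \<in> borel_measurable lborel"
      using v(1) by measurable
    ultimately have "AE t in lborel. (\<Sum>j. ennreal (v j t)) \<noteq> \<infinity>"
      by (intro nn_integral_PInf_AE)
    then show ?thesis
      by eventually_elim (intro summable_suminf_not_top v, simp)
  qed
  define W where "W t = (\<Sum>j. v j t)" for t
  have W: "integrable lborel W"
    unfolding W_def by (rule integrable_suminf) (use v ae sI in auto)
  define g where "g t = (\<Sum>j. u j t)" for t
  have [measurable]: "g \<in> borel_measurable lborel" unfolding g_def by measurable
  have tail: "AE t in lborel. \<forall>n. (cmod ((\<Sum>j<n. u j t) - g t))\<^sup>2 \<le> 4 * (1/4) ^ n * W t"
    using ae
  proof eventually_elim
    case (elim t)
    have W0: "W t \<ge> 0" unfolding W_def using elim v(2) by (intro suminf_nonneg)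
    have ub: "cmod (u j t) \<le> sqrt (W t) * (1/2) ^ j" for j
    proof -
      have "v j t \<le> W t" unfolding W_def using sum_le_suminf[OF elim, of "{j}"] v(2) by auto
      then have "(cmod (u j t))\<^sup>2 \<le> W t * (1/4) ^ j"
        by (simp add: v_def field_simps)
      also have "\<dots> = (sqrt (W t) * (1/2) ^ j)\<^sup>2"
      proof -
        have "((1/2) ^ j)\<^sup>2 = (1/4 :: real) ^ j"
          by (simp add: power2_eq_square flip: power_mult_distrib)
        then show ?thesis using W0 by (simp only: power_mult_distrib real_sqrt_pow2)
      qed
      finally show ?thesis by (rule power2_le_imp_le) (use W0 in simp)
    qed
    have geo': "(\<lambda>j. sqrt (W t) * (1/2) ^ (j + n)) sums (2 * (1/2) ^ n * sqrt (W t))" for n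
      using sums_mult[OF geometric_sums[of "1/2::real"], of "sqrt (W t) * (1/2) ^ n"]
      by (simp add: power_add mult_ac)
    note geo = geo'[THEN sums_summable]
    have su: "summable (\<lambda>j. cmod (u (j + n) t))" for n
      by (rule summable_comparison_test'[OF geo]) (use ub in auto)
    have "(cmod ((\<Sum>j<n. u j t) - g t))\<^sup>2 \<le> 4 * (1/4) ^ n * W t" for n
    proof -
      have "g t = (\<Sum>j. u (j + n) t) + (\<Sum>j<n. u j t)"
        unfolding g_def using summable_norm_cancel su[of 0] by (intro suminf_split_initial_segment) simp
      then have "cmod ((\<Sum>j<n. u j t) - g t) = cmod (\<Sum>j. u (j + n) t)"
        by (simp add: norm_minus_commute)
      also have "\<dots> \<le> (\<Sum>j. cmod (u (j + n) t))" by (rule summable_norm[OF su])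
      also have "\<dots> \<le> (\<Sum>j. sqrt (W t) * (1/2) ^ (j + n))"
        by (intro suminf_le su geo ub)
      also have "\<dots> = 2 * (1/2) ^ n * sqrt (W t)"
        by (rule sums_unique[OF geo', symmetric])
      finally have "(cmod ((\<Sum>j<n. u j t) - g t))\<^sup>2 \<le> (2 * (1/2) ^ n * sqrt (W t))\<^sup>2"
        by (intro power_mono) auto
      also have "\<dots> = 4 * ((1/2)\<^sup>2) ^ n * W t"
        using W0 by (simp only: power_mult_distrib power_mult[symmetric] mult.commute[of n 2] real_sqrt_pow2) simp
      finally show ?thesis by (simp add: power2_eq_square)
    qed
    then show ?case by blast
  qed
  have gL: "g \<in> L2"
    unfolding L2_iff square_integrable_def
  proof
    show "integrable lborel (\<lambda>t. (cmod (g t))\<^sup>2)"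
    proof (rule Bochner_Integration.integrable_bound)
      show "integrable lborel (\<lambda>t. 4 * W t)" using W by simp
      show "AE t in lborel. norm ((cmod (g t))\<^sup>2) \<le> norm (4 * W t)"
        using tail
      proof eventually_elim
        case (elim t)
        show ?case using elim[rule_format, of 0] by simp
      qed
    qed measurable
  qed measurable
  moreover have "(\<lambda>n. l2_norm (\<lambda>t. (\<Sum>j<n. u j t) - g t)) \<longlonglongrightarrow> 0"
  proof -
    have "(l2_norm (\<lambda>t. (\<Sum>j<n. u j t) - g t))\<^sup>2 \<le> 4 * (1/4) ^ n * (LINT t|lborel. W t)" for n
    proof -
      have "(\<lambda>t. (\<Sum>j<n. u j t) - g t) \<in> L2" by (intro L2_diff L2_sum u gL)
      then have i: "integrable lborel (\<lambda>t. (cmod ((\<Sum>j<n. u j t) - g t))\<^sup>2)"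
        by (simp add: L2_iff square_integrable_def)
      have "(l2_norm (\<lambda>t. (\<Sum>j<n. u j t) - g t))\<^sup>2 \<le> (LINT t|lborel. 4 * (1/4) ^ n * W t)"
        unfolding l2_norm_sq by (rule integral_mono_AE[OF i]) (use W tail in auto)
      then show ?thesis by simp
    qed
    note bd = this
    have "(\<lambda>n. 4 * (1/4) ^ n * (LINT t|lborel. W t)) \<longlonglongrightarrow> 4 * 0 * (LINT t|lborel. W t)"
      by (intro tendsto_intros LIMSEQ_power_zero) auto
    then have lim: "(\<lambda>n. 4 * (1/4) ^ n * (LINT t|lborel. W t)) \<longlonglongrightarrow> 0" by simp
    have "(\<lambda>n. (l2_norm (\<lambda>t. (\<Sum>j<n. u j t) - g t))\<^sup>2) \<longlonglongrightarrow> 0"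
    proof (rule tendsto_sandwich[OF _ _ tendsto_const lim])
      show "\<forall>\<^sub>F n in sequentially. 0 \<le> (l2_norm (\<lambda>t. (\<Sum>j<n. u j t) - g t))\<^sup>2" by simp
      show "\<forall>\<^sub>F n in sequentially. (l2_norm (\<lambda>t. (\<Sum>j<n. u j t) - g t))\<^sup>2 \<le> 4 * (1/4) ^ n * (LINT t|lborel. W t)"
        using bd by (rule always_eventually[OF allI])
    qed
    then have "(\<lambda>n. sqrt ((l2_norm (\<lambda>t. (\<Sum>j<n. u j t) - g t))\<^sup>2)) \<longlonglongrightarrow> sqrt 0"
      by (rule tendsto_real_sqrt)
    then show ?thesis by simp
  qed
  ultimately show ?thesis by blast
qed

section \<open>Bessel families and frame operators\<close>


text \<open>Synthesis is adjoint to taking coefficients and inherits its bound: the squared norm of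
  the sum \<open>u\<close> is paired with its own coefficients, then Cauchy-Schwarz and the Bessel
  bound for \<open>u\<close> itself leave a factor that cancels.\<close>

lemma bessel_synthesis_bound:
  assumes e: "\<And>z. z \<in> F \<Longrightarrow> e z \<in> L2" and F: "finite F" and C: "C \<ge> 0"
    and bessel: "\<And>f. f \<in> L2 \<Longrightarrow> (\<Sum>z\<in>F. (cmod (l2_inner f (e z)))\<^sup>2) \<le> C * (l2_norm f)\<^sup>2"
  shows "(l2_norm (\<lambda>t. \<Sum>z\<in>F. c z * e z t))\<^sup>2 \<le> C * (\<Sum>z\<in>F. (cmod (c z))\<^sup>2)"
proof -
  define u where "u t = (\<Sum>z\<in>F. c z * e z t)" for t
  have u: "u \<in> L2" unfolding u_def by (intro L2_sum L2_cmult e)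
  have "of_real ((l2_norm u)\<^sup>2) = l2_inner u u" by (simp add: l2_inner_self)
  also have "\<dots> = (\<Sum>z\<in>F. l2_inner (\<lambda>t. c z * e z t) u)"
    using l2_inner_sum_left[of F "\<lambda>z t. c z * e z t" u] L2_cmult[OF e] u by (simp add: u_def[abs_def])
  also have "\<dots> = (\<Sum>z\<in>F. c z * l2_inner (e z) u)" by (simp add: l2_inner_cmult_left)
  finally have "(l2_norm u)\<^sup>2 = cmod (\<Sum>z\<in>F. c z * l2_inner (e z) u)"
    by (metis abs_of_nonneg norm_of_real zero_le_power2)
  also have "\<dots> \<le> (\<Sum>z\<in>F. cmod (c z) * cmod (l2_inner u (e z)))"
    by (intro sum_norm_le) (simp add: norm_mult l2_inner_commute[of "e _" u])
  finally have "((l2_norm u)\<^sup>2)\<^sup>2 \<le> (\<Sum>z\<in>F. cmod (c z) * cmod (l2_inner u (e z)))\<^sup>2"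
    by (intro power_mono) auto
  also have "\<dots> \<le> (\<Sum>z\<in>F. (cmod (c z))\<^sup>2) * (\<Sum>z\<in>F. (cmod (l2_inner u (e z)))\<^sup>2)"
    by (rule Cauchy_Schwarz_ineq_sum)
  also have "\<dots> \<le> (\<Sum>z\<in>F. (cmod (c z))\<^sup>2) * (C * (l2_norm u)\<^sup>2)"
    by (intro mult_left_mono bessel u sum_nonneg) auto
  finally have "(l2_norm u)\<^sup>2 * (l2_norm u)\<^sup>2 \<le> (C * (\<Sum>z\<in>F. (cmod (c z))\<^sup>2)) * (l2_norm u)\<^sup>2"
    by (simp add: power2_eq_square mult_ac)
  then have "(l2_norm u)\<^sup>2 \<le> C * (\<Sum>z\<in>F. (cmod (c z))\<^sup>2)"
  proof (cases "l2_norm u = 0")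
    case True
    then show ?thesis using C by (simp add: sum_nonneg)
  next
    case False
    then have "0 < (l2_norm u)\<^sup>2" by simp
    then show ?thesis
      using mult_right_le_imp_le \<open>(l2_norm u)\<^sup>2 * (l2_norm u)\<^sup>2 \<le> _\<close> by blast
  qed
  then show ?thesis by (simp add: u_def[abs_def])
qed

lemma summable_on_tail:
  fixes c :: "'a \<Rightarrow> real"
  assumes "c summable_on A" "\<And>z. c z \<ge> 0" "\<epsilon> > 0"
  shows "\<exists>F. finite F \<and> F \<subseteq> A \<and> (\<forall>G. finite G \<longrightarrow> G \<subseteq> A - F \<longrightarrow> sum c G \<le> \<epsilon>)"
proof -
  obtain F where F: "finite F" "F \<subseteq> A" "dist (sum c F) (infsum c A) \<le> \<epsilon>"
    using infsum_finite_approximation[OF assms(1,3)] by blast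
  have "sum c G \<le> \<epsilon>" if "finite G" "G \<subseteq> A - F" for G
  proof -
    have "sum c F + sum c G = sum c (F \<union> G)"
      using that F by (subst sum.union_disjoint) auto
    also have "\<dots> \<le> infsum c A"
      using that F assms(1,2) by (intro finite_sum_le_infsum) auto
    finally show ?thesis using F(3) by (simp add: dist_real_def)
  qed
  with F show ?thesis by blast
qed

text \<open>Completeness is available for sequences only, so an increasing chain of finite sets is
  chosen whose increments contribute squared norms at most C 16^(-j). Its limit is the limit of the
  whole net, because a larger finite set differs from \<open>F n\<close> only by points of the
  tail.\<close>

lemma bessel_frame_sum_convergent:
  assumes e: "\<And>z. z \<in> \<Lambda> \<Longrightarrow> e z \<in> L2" and C: "C \<ge> 0" and f: "f \<in> L2"
    and bessel: "\<And>f F. f \<in> L2 \<Longrightarrow> finite F \<Longrightarrow> F \<subseteq> \<Lambda> \<Longrightarrow> (\<Sum>z\<in>F. (cmod (l2_inner f (e z)))\<^sup>2) \<le> C * (l2_norm f)\<^sup>2"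
  shows "\<exists>g\<in>L2. ((\<lambda>F. l2_norm (\<lambda>t. (\<Sum>z\<in>F. l2_inner f (e z) * e z t) - g t)) \<longlongrightarrow> 0) (finite_subsets_at_top \<Lambda>)"
proof -
  define c where "c z = (cmod (l2_inner f (e z)))\<^sup>2" for z
  define P where "P F t = (\<Sum>z\<in>F. l2_inner f (e z) * e z t)" for F t
  have c: "c summable_on \<Lambda>"
    using bessel[OF f] by (intro nonneg_bdd_above_summable_on bdd_aboveI2) (auto simp: c_def)
  have PL: "P F \<in> L2" if "F \<subseteq> \<Lambda>" for F
    unfolding P_def using that by (intro L2_sum L2_cmult e) auto
  have bd: "(l2_norm (P F))\<^sup>2 \<le> C * sum c F" if "finite F" "F \<subseteq> \<Lambda>" for F
    unfolding P_def c_def using that bessel e by (intro bessel_synthesis_bound C) auto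
  have "\<exists>F. finite F \<and> F \<subseteq> \<Lambda> \<and> (\<forall>G. finite G \<longrightarrow> G \<subseteq> \<Lambda> - F \<longrightarrow> sum c G \<le> (1/16) ^ j)" for j :: nat
    by (rule summable_on_tail[OF c]) (auto simp: c_def)
  then obtain F0 where F0: "\<And>j. finite (F0 j)" "\<And>j. F0 j \<subseteq> \<Lambda>"
    "\<And>j G. finite G \<Longrightarrow> G \<subseteq> \<Lambda> - F0 j \<Longrightarrow> sum c G \<le> (1/16) ^ j"
    by metis
  define F where "F j = (\<Union>i\<le>j. F0 i)" for j
  have F: "finite (F j)" "F j \<subseteq> \<Lambda>" for j using F0 by (auto simp: F_def)
  have Fs: "F j \<subseteq> F (Suc j)" for j unfolding F_def by (auto simp: le_Suc_eq)
  have tail: "(l2_norm (P G))\<^sup>2 \<le> C * (1/16) ^ j" if "finite G" "G \<subseteq> \<Lambda> - F j" for G j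
  proof -
    have "sum c G \<le> (1/16) ^ j" using that by (intro F0(3)) (auto simp: F_def)
    then have "C * sum c G \<le> C * (1/16) ^ j" using C by (intro mult_left_mono)
    moreover have "(l2_norm (P G))\<^sup>2 \<le> C * sum c G" using that by (intro bd) auto
    ultimately show ?thesis by linarith
  qed
  have Pd: "P G t = P (G - H) t + P H t" if "finite G" "H \<subseteq> G" for G H t
    unfolding P_def by (rule sum.subset_diff) (use that in auto)
  define u where "u j = P (F (Suc j) - F j)" for j
  have "u j \<in> L2" for j unfolding u_def using F by (intro PL) auto
  moreover have "(l2_norm (u j))\<^sup>2 \<le> C * (1/16) ^ j" for j
    unfolding u_def using F by (intro tail) auto
  ultimately obtain g0 where g0: "g0 \<in> L2" "(\<lambda>n. l2_norm (\<lambda>t. (\<Sum>j<n. u j t) - g0 t)) \<longlonglongrightarrow> 0"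
    using L2_series_convergent[of u C] by blast
  define g where "g t = P (F 0) t + g0 t" for t
  have g: "g \<in> L2" unfolding g_def using F by (intro L2_add PL g0)
  have PF: "P (F n) t = P (F 0) t + (\<Sum>j<n. u j t)" for n t
  proof (induction n)
    case (Suc n)
    then show ?case using Pd[OF F(1) Fs, of n t] by (simp add: u_def)
  qed simp
  have lim0: "(\<lambda>n. l2_norm (\<lambda>t. P (F n) t - g t)) \<longlonglongrightarrow> 0"
  proof -
    have "P (F n) t - g t = (\<Sum>j<n. u j t) - g0 t" for n t
      using PF[of n t] by (simp add: g_def)
    then show ?thesis using g0(2) by simp
  qed
  have "((\<lambda>G. l2_norm (\<lambda>t. P G t - g t)) \<longlongrightarrow> 0) (finite_subsets_at_top \<Lambda>)"
    unfolding tendsto_iff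
  proof (intro allI impI)
    fix \<epsilon> :: real assume \<epsilon>: "\<epsilon> > 0"
    have "(\<lambda>n. C * (1/16) ^ n) \<longlonglongrightarrow> C * 0"
      by (intro tendsto_intros LIMSEQ_power_zero) auto
    then have "\<forall>\<^sub>F n in sequentially. C * (1/16) ^ n < (\<epsilon> / 2)\<^sup>2"
      using \<epsilon> by (intro order_tendstoD(2)) auto
    moreover have "\<forall>\<^sub>F n in sequentially. l2_norm (\<lambda>t. P (F n) t - g t) < \<epsilon> / 2"
      using \<epsilon> by (intro order_tendstoD(2)[OF lim0]) auto
    ultimately have "\<forall>\<^sub>F n in sequentially. C * (1/16) ^ n < (\<epsilon> / 2)\<^sup>2 \<and> l2_norm (\<lambda>t. P (F n) t - g t) < \<epsilon> / 2"
      by eventually_elim simp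
    then obtain n where n: "C * (1/16) ^ n < (\<epsilon> / 2)\<^sup>2" "l2_norm (\<lambda>t. P (F n) t - g t) < \<epsilon> / 2"
      by (auto simp: eventually_sequentially)
    have "dist (l2_norm (\<lambda>t. P G t - g t)) 0 < \<epsilon>" if "finite G" "F n \<subseteq> G" "G \<subseteq> \<Lambda>" for G
    proof -
      have "(l2_norm (P (G - F n)))\<^sup>2 < (\<epsilon> / 2)\<^sup>2"
      proof -
        have "(l2_norm (P (G - F n)))\<^sup>2 \<le> C * (1/16) ^ n"
          using that by (intro tail) auto
        then show ?thesis using n(1) by linarith
      qed
      then have 1: "l2_norm (P (G - F n)) < \<epsilon> / 2"
        using \<epsilon> by (intro power2_less_imp_less[of _ "\<epsilon> / 2"]) auto
      have "l2_norm (\<lambda>t. P G t - g t) = l2_norm (\<lambda>t. P (G - F n) t + (P (F n) t - g t))"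
        using Pd[OF that(1,2)] by (simp add: add_diff_eq)
      also have "\<dots> \<le> l2_norm (P (G - F n)) + l2_norm (\<lambda>t. P (F n) t - g t)"
        by (rule l2_norm_triangle[OF PL L2_diff[OF PL g]]) (use F that in blast)+
      also have "\<dots> < \<epsilon>" using 1 n(2) by linarith
      finally show ?thesis by simp
    qed
    then show "\<forall>\<^sub>F G in finite_subsets_at_top \<Lambda>. dist (l2_norm (\<lambda>t. P G t - g t)) 0 < \<epsilon>"
      unfolding eventually_finite_subsets_at_top using F[of n] by (intro exI[of _ "F n"]) simp
  qed
  with g show ?thesis unfolding P_def by blast
qed

section \<open>The quadratic form of the Gabor frame operator\<close>

lemma gaussian_shift_L2: "tf_shift z gaussian \<in> L2"
proof -
  have "integrable lborel (\<lambda>t. exp (- (2 * pi) * t\<^sup>2))"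
    by (rule gaussian_fourier_integral) simp
  from lborel_integrable_real_affine[OF this, of 1 "- z $ 1"]
  have "integrable lborel (\<lambda>t. (2 powr (1/4))\<^sup>2 * exp (- (2 * pi) * (t - z $ 1)\<^sup>2))" by simp
  moreover have "(cmod (tf_shift z gaussian t))\<^sup>2 = (2 powr (1/4))\<^sup>2 * exp (- (2 * pi) * (t - z $ 1)\<^sup>2)" for t
  proof -
    have "cmod (tf_shift z gaussian t) = 2 powr (1/4) * exp (- pi * (t - z $ 1)\<^sup>2)"
      by (simp add: tf_shift_def gaussian_def norm_mult)
    then show ?thesis by (simp add: power_mult_distrib flip: exp_double)
  qed
  ultimately show ?thesis
    unfolding L2_iff square_integrable_def tf_shift_def gaussian_def by simp
qed

abbreviation gabor_energy :: "(real \<Rightarrow> complex) \<Rightarrow> real ^ 2 \<Rightarrow> real" where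
  "gabor_energy f z \<equiv> (cmod (l2_inner f (tf_shift z gaussian)))\<^sup>2"

text \<open>The Bessel bound guarantees that a limit exists, so \<open>SOME\<close> selects an
  actual one; continuity of the inner product then gives the value for whichever limit is selected.
  The bound is assumed for all functions because convergence applies it to the partial sums.\<close>

lemma gabor_frame_operator_form:
  assumes C: "C \<ge> 0" and f: "f \<in> L2"
    and bessel: "\<And>f F. f \<in> L2 \<Longrightarrow> finite F \<Longrightarrow> F \<subseteq> \<Lambda> \<Longrightarrow>
      (\<Sum>z\<in>F. gabor_energy f z) \<le> C * (l2_norm f)\<^sup>2"
  shows "Re (l2_inner (gabor_frame_operator \<Lambda> f) f) =
    covolume \<Lambda> * (\<Sum>\<^sub>\<infinity>z\<in>\<Lambda>. gabor_energy f z)"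
proof -
  let ?e = "\<lambda>z. tf_shift z gaussian" and ?v = "complex_of_real (covolume \<Lambda>)"
  obtain g where g: "g \<in> L2"
    "((\<lambda>F. l2_norm (\<lambda>t. (\<Sum>z\<in>F. l2_inner f (?e z) * ?e z t) - g t)) \<longlongrightarrow> 0) (finite_subsets_at_top \<Lambda>)"
    using bessel_frame_sum_convergent[of \<Lambda> ?e C f] gaussian_shift_L2 C f bessel by blast
  have "l2_norm (\<lambda>t. gabor_partial_sum \<Lambda> F f t - ?v * g t) =
      \<bar>covolume \<Lambda>\<bar> * l2_norm (\<lambda>t. (\<Sum>z\<in>F. l2_inner f (?e z) * ?e z t) - g t)" for F
    using l2_norm_cmult[of ?v "\<lambda>t. (\<Sum>z\<in>F. l2_inner f (?e z) * ?e z t) - g t"]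
    by (simp add: gabor_partial_sum_def right_diff_distrib)
  then have "((\<lambda>F. l2_norm (\<lambda>t. gabor_partial_sum \<Lambda> F f t - ?v * g t)) \<longlongrightarrow> 0) (finite_subsets_at_top \<Lambda>)"
    using tendsto_mult_right_zero[OF g(2), of "\<bar>covolume \<Lambda>\<bar>"] by simp
  with L2_cmult[OF g(1), of ?v]
  have "\<exists>g. g \<in> L2 \<and> ((\<lambda>F. l2_norm (\<lambda>t. gabor_partial_sum \<Lambda> F f t - g t)) \<longlongrightarrow> 0) (finite_subsets_at_top \<Lambda>)"
    by blast
  from someI_ex[OF this] have S: "gabor_frame_operator \<Lambda> f \<in> L2"
    "((\<lambda>F. l2_norm (\<lambda>t. gabor_partial_sum \<Lambda> F f t - gabor_frame_operator \<Lambda> f t)) \<longlongrightarrow> 0) (finite_subsets_at_top \<Lambda>)"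
    by (simp_all add: gabor_frame_operator_def)
  define c where "c z = (cmod (l2_inner f (?e z)))\<^sup>2" for z
  have GL: "gabor_partial_sum \<Lambda> F f \<in> L2" for F
    unfolding gabor_partial_sum_def[abs_def] by (intro L2_cmult L2_sum gaussian_shift_L2)
  have inner: "l2_inner (gabor_partial_sum \<Lambda> F f) f = of_real (covolume \<Lambda> * sum c F)" for F
  proof -
    have "l2_inner (gabor_partial_sum \<Lambda> F f) f = ?v * (\<Sum>z\<in>F. l2_inner f (?e z) * l2_inner (?e z) f)"
      unfolding gabor_partial_sum_def[abs_def] l2_inner_cmult_left
      by (subst l2_inner_sum_left) (auto intro: L2_cmult gaussian_shift_L2 f simp: l2_inner_cmult_left)
    also have "(\<lambda>z. l2_inner f (?e z) * l2_inner (?e z) f) = (\<lambda>z. of_real (c z))"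
      unfolding c_def by (simp only: l2_inner_commute[of "?e _" f] complex_norm_square)
    finally show ?thesis by simp
  qed
  have "((\<lambda>F. l2_inner (gabor_partial_sum \<Lambda> F f) f) \<longlongrightarrow> l2_inner (gabor_frame_operator \<Lambda> f) f) (finite_subsets_at_top \<Lambda>)"
  proof (rule LIM_zero_cancel, rule Lim_null_comparison)
    show "\<forall>\<^sub>F F in finite_subsets_at_top \<Lambda>. norm (l2_inner (gabor_partial_sum \<Lambda> F f) f - l2_inner (gabor_frame_operator \<Lambda> f) f)
        \<le> l2_norm (\<lambda>t. gabor_partial_sum \<Lambda> F f t - gabor_frame_operator \<Lambda> f t) * l2_norm f"
      using cmod_l2_inner_le[OF L2_diff[OF GL S(1)] f] l2_inner_diff_left[OF GL S(1) f] by (intro always_eventually) simp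
    show "((\<lambda>F. l2_norm (\<lambda>t. gabor_partial_sum \<Lambda> F f t - gabor_frame_operator \<Lambda> f t) * l2_norm f) \<longlongrightarrow> 0) (finite_subsets_at_top \<Lambda>)"
      by (rule tendsto_mult_left_zero[OF S(2)])
  qed
  then have "((\<lambda>F. covolume \<Lambda> * sum c F) \<longlongrightarrow> Re (l2_inner (gabor_frame_operator \<Lambda> f) f)) (finite_subsets_at_top \<Lambda>)"
    unfolding inner using tendsto_Re by fastforce
  moreover have "c summable_on \<Lambda>"
    using bessel[OF f] by (intro nonneg_bdd_above_summable_on bdd_aboveI2) (auto simp: c_def)
  then have "((\<lambda>F. covolume \<Lambda> * sum c F) \<longlongrightarrow> covolume \<Lambda> * infsum c \<Lambda>) (finite_subsets_at_top \<Lambda>)"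
    by (intro tendsto_mult tendsto_const infsum_tendsto)
  ultimately show ?thesis
    unfolding c_def[symmetric] using tendsto_unique[OF finite_subsets_at_top_neq_bot] by blast
qed

text \<open>For a fixed finite \<open>F\<close> both sides are continuous in the function; this is
  why the Bessel bound is formulated with finite sums.\<close>

lemma bessel_bound_extend:
  assumes e: "\<And>z. z \<in> \<Lambda> \<Longrightarrow> e z \<in> L2"
    and D: "\<And>n. d n \<in> L2" and f: "f \<in> L2"
    and lim: "(\<lambda>n. l2_norm (\<lambda>t. d n t - f t)) \<longlonglongrightarrow> 0"
    and upper: "\<And>n F. finite F \<Longrightarrow> F \<subseteq> \<Lambda> \<Longrightarrow> (\<Sum>z\<in>F. (cmod (l2_inner (d n) (e z)))\<^sup>2) \<le> B * (l2_norm (d n))\<^sup>2"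
    and F: "finite F" "F \<subseteq> \<Lambda>"
  shows "(\<Sum>z\<in>F. (cmod (l2_inner f (e z)))\<^sup>2) \<le> B * (l2_norm f)\<^sup>2"
proof (rule LIMSEQ_le)
  show "(\<lambda>n. B * (l2_norm (d n))\<^sup>2) \<longlonglongrightarrow> B * (l2_norm f)\<^sup>2"
    by (intro tendsto_intros l2_norm_tendsto D f lim)
  have "(\<lambda>n. l2_inner (d n) (e z)) \<longlonglongrightarrow> l2_inner f (e z)" if "z \<in> F" for z
  proof (rule LIM_zero_cancel, rule Lim_null_comparison)
    have z: "e z \<in> L2" using that F e by auto
    show "\<forall>\<^sub>F n in sequentially. norm (l2_inner (d n) (e z) - l2_inner f (e z)) \<le> l2_norm (\<lambda>t. d n t - f t) * l2_norm (e z)"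
      using cmod_l2_inner_le[OF L2_diff[OF D f] z] l2_inner_diff_left[OF D f z] by simp
    show "(\<lambda>n. l2_norm (\<lambda>t. d n t - f t) * l2_norm (e z)) \<longlonglongrightarrow> 0"
      by (rule tendsto_mult_left_zero[OF lim])
  qed
  then show "(\<lambda>n. \<Sum>z\<in>F. (cmod (l2_inner (d n) (e z)))\<^sup>2) \<longlonglongrightarrow> (\<Sum>z\<in>F. (cmod (l2_inner f (e z)))\<^sup>2)"
    by (intro tendsto_intros)
  show "\<exists>N. \<forall>n\<ge>N. (\<Sum>z\<in>F. (cmod (l2_inner (d n) (e z)))\<^sup>2) \<le> B * (l2_norm (d n))\<^sup>2"
    using upper F by blast
qed

lemma cmod_add_sq_le_weighted:
  assumes "\<eta> > 0"
  shows "(cmod (a + b))\<^sup>2 \<le> (1 + \<eta>) * (cmod a)\<^sup>2 + (1 + 1 / \<eta>) * (cmod b)\<^sup>2"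
proof -
  have "0 \<le> (\<eta> * cmod a - cmod b)\<^sup>2 / \<eta>" using assms by simp
  also have "\<dots> = \<eta> * (cmod a)\<^sup>2 + (1 / \<eta>) * (cmod b)\<^sup>2 - 2 * cmod a * cmod b"
    using assms by (simp add: power2_eq_square field_simps)
  finally have "(cmod a + cmod b)\<^sup>2 \<le> (1 + \<eta>) * (cmod a)\<^sup>2 + (1 + 1 / \<eta>) * (cmod b)\<^sup>2"
    by (simp add: power2_sum distrib_right)
  moreover have "(cmod (a + b))\<^sup>2 \<le> (cmod a + cmod b)\<^sup>2"
    by (intro power_mono norm_triangle_ineq) auto
  ultimately show ?thesis by linarith
qed

text \<open>An infinite sum is not controlled term by term. The weighted triangle inequality bounds
  the energy of \<open>d n\<close> by (1 + \<eta>) times that of \<open>f\<close>, plus an error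
  which the Bessel bound sends to 0 with n; only afterwards does \<eta> tend to 0.\<close>

lemma frame_lower_bound_extend:
  assumes e: "\<And>z. z \<in> \<Lambda> \<Longrightarrow> e z \<in> L2"
    and D: "\<And>n. d n \<in> L2" and f: "f \<in> L2"
    and lim: "(\<lambda>n. l2_norm (\<lambda>t. d n t - f t)) \<longlonglongrightarrow> 0"
    and bessel: "\<And>f F. f \<in> L2 \<Longrightarrow> finite F \<Longrightarrow> F \<subseteq> \<Lambda> \<Longrightarrow> (\<Sum>z\<in>F. (cmod (l2_inner f (e z)))\<^sup>2) \<le> B * (l2_norm f)\<^sup>2"
    and lower: "\<And>n. A * (l2_norm (d n))\<^sup>2 \<le> (\<Sum>\<^sub>\<infinity>z\<in>\<Lambda>. (cmod (l2_inner (d n) (e z)))\<^sup>2)"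
  shows "A * (l2_norm f)\<^sup>2 \<le> (\<Sum>\<^sub>\<infinity>z\<in>\<Lambda>. (cmod (l2_inner f (e z)))\<^sup>2)"
proof -
  define Q where "Q h = (\<Sum>\<^sub>\<infinity>z\<in>\<Lambda>. (cmod (l2_inner h (e z)))\<^sup>2)" for h
  have sm: "(\<lambda>z. (cmod (l2_inner h (e z)))\<^sup>2) summable_on \<Lambda>" if "h \<in> L2" for h
    using bessel[OF that] by (intro nonneg_bdd_above_summable_on bdd_aboveI2) auto
  have Qle: "Q h \<le> B * (l2_norm h)\<^sup>2" if "h \<in> L2" for h
    unfolding Q_def using bessel[OF that] by (intro infsum_le_finite_sums sm that) auto
  have key: "A * (l2_norm f)\<^sup>2 \<le> (1 + \<eta>) * Q f" if \<eta>: "\<eta> > 0" for \<eta>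
  proof (rule LIMSEQ_le)
    show "(\<lambda>n. A * (l2_norm (d n))\<^sup>2) \<longlonglongrightarrow> A * (l2_norm f)\<^sup>2"
      by (intro tendsto_intros l2_norm_tendsto D f lim)
    have "(\<lambda>n. (1 + \<eta>) * Q f + (1 + 1 / \<eta>) * (B * (l2_norm (\<lambda>t. d n t - f t))\<^sup>2)) \<longlonglongrightarrow>
        (1 + \<eta>) * Q f + (1 + 1 / \<eta>) * (B * 0\<^sup>2)"
      by (intro tendsto_intros lim)
    then show "(\<lambda>n. (1 + \<eta>) * Q f + (1 + 1 / \<eta>) * (B * (l2_norm (\<lambda>t. d n t - f t))\<^sup>2)) \<longlonglongrightarrow> (1 + \<eta>) * Q f"
      by simp
    have "A * (l2_norm (d n))\<^sup>2 \<le> (1 + \<eta>) * Q f + (1 + 1 / \<eta>) * (B * (l2_norm (\<lambda>t. d n t - f t))\<^sup>2)" for n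
    proof -
      have dL: "(\<lambda>t. d n t - f t) \<in> L2" by (intro L2_diff D f)
      have split: "l2_inner (d n) (e z) = l2_inner f (e z) + l2_inner (\<lambda>t. d n t - f t) (e z)" if "z \<in> \<Lambda>" for z
        using l2_inner_diff_left[OF D f e[OF that]] by simp
      have "A * (l2_norm (d n))\<^sup>2 \<le> Q (d n)" using lower by (simp add: Q_def)
      also have "\<dots> \<le> (\<Sum>\<^sub>\<infinity>z\<in>\<Lambda>. (1 + \<eta>) * (cmod (l2_inner f (e z)))\<^sup>2 + (1 + 1 / \<eta>) * (cmod (l2_inner (\<lambda>t. d n t - f t) (e z)))\<^sup>2)"
        unfolding Q_def
      proof (rule infsum_mono)
        show "(cmod (l2_inner (d n) (e z)))\<^sup>2 \<le> (1 + \<eta>) * (cmod (l2_inner f (e z)))\<^sup>2 + (1 + 1 / \<eta>) * (cmod (l2_inner (\<lambda>t. d n t - f t) (e z)))\<^sup>2"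
          if "z \<in> \<Lambda>" for z
          unfolding split[OF that] by (rule cmod_add_sq_le_weighted[OF \<eta>])
      qed (intro summable_on_add summable_on_cmult_right sm D f dL)+
      also have "\<dots> = (1 + \<eta>) * Q f + (1 + 1 / \<eta>) * Q (\<lambda>t. d n t - f t)"
        unfolding Q_def using sm[OF f] sm[OF dL]
        by (subst infsum_add) (auto intro!: summable_on_cmult_right simp: infsum_cmult_right')
      also have "\<dots> \<le> (1 + \<eta>) * Q f + (1 + 1 / \<eta>) * (B * (l2_norm (\<lambda>t. d n t - f t))\<^sup>2)"
        using \<eta> by (intro add_left_mono mult_left_mono Qle dL) auto
      finally show ?thesis .
    qed
    then show "\<exists>N. \<forall>n\<ge>N. A * (l2_norm (d n))\<^sup>2 \<le> (1 + \<eta>) * Q f + (1 + 1 / \<eta>) * (B * (l2_norm (\<lambda>t. d n t - f t))\<^sup>2)"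
      by blast
  qed
  have "A * (l2_norm f)\<^sup>2 \<le> Q f"
  proof (rule tendsto_lowerbound)
    show "((\<lambda>\<eta>. (1 + \<eta>) * Q f) \<longlongrightarrow> Q f) (at_right 0)"
      by (auto intro!: tendsto_eq_intros)
    show "\<forall>\<^sub>F \<eta> in at_right 0. A * (l2_norm f)\<^sup>2 \<le> (1 + \<eta>) * Q f"
      using key by (auto simp: eventually_at_right_field intro: exI[of _ 1])
  qed simp
  then show ?thesis by (simp add: Q_def)
qed

section \<open>Windows and Toeplitz forms\<close>


lemma has_sum_finite_sum:
  fixes f :: "'i \<Rightarrow> 'a \<Rightarrow> 'b :: topological_comm_monoid_add"
  assumes "\<And>i. i \<in> I \<Longrightarrow> (f i has_sum s i) A"
  shows "((\<lambda>x. \<Sum>i\<in>I. f i x) has_sum (\<Sum>i\<in>I. s i)) A"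
  using assms by (induction I rule: infinite_finite_induct) (auto intro: has_sum_add)

lemma has_sum_iterated_nonneg:
  fixes c :: "'a \<Rightarrow> 'b \<Rightarrow> real"
  assumes c: "\<And>k l. c k l \<ge> 0" and inner: "\<And>k. (c k has_sum r k) UNIV" and outer: "(r has_sum S) UNIV"
  shows "((\<lambda>(k, l). c k l) has_sum S) UNIV"
proof -
  have r: "r k = infsum (c k) UNIV" for k using inner[of k] by (simp add: has_sum_iff)
  have sm: "(\<lambda>(k, l). c k l) summable_on UNIV \<times> UNIV"
  proof (rule Infinite_Sum.abs_summable_summable, subst Infinite_Sum.abs_summable_on_Sigma_iff, intro conjI ballI)
    show "(\<lambda>l. norm (case (k, l) of (k, l) \<Rightarrow> c k l)) summable_on UNIV" for k
      using inner[of k] c by (simp add: has_sum_iff)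
    show "(\<lambda>k. norm (\<Sum>\<^sub>\<infinity>l. norm (case (k, l) of (k, l) \<Rightarrow> c k l))) summable_on UNIV"
    proof -
      have "r k \<ge> 0" for k unfolding r using c by (intro infsum_nonneg)
      then show ?thesis using outer c by (simp add: has_sum_iff r[symmetric])
    qed
  qed
  moreover have "infsum (\<lambda>(k, l). c k l) (UNIV \<times> UNIV) = S"
    using outer by (subst infsum_Sigma'_banach[OF sm, symmetric]) (simp add: has_sum_iff r[symmetric])
  ultimately show ?thesis by (simp add: has_sum_iff)
qed

lemma square_integrable_dilate:
  fixes f :: "real \<Rightarrow> complex"
  assumes "square_integrable lborel f" "c \<noteq> 0"
  shows "square_integrable lborel (\<lambda>x. f (c * x))"
  using assms lborel_integrable_real_affine[of "\<lambda>x. (cmod (f x))\<^sup>2" c 0]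
  by (auto simp: square_integrable_def)

lemma square_integrable_shift_unit_interval:
  assumes "square_integrable lborel f"
  shows "square_integrable unit_interval (\<lambda>x. f (x + a))"
  using assms integrable_unit_interval_shift[of "\<lambda>x. (cmod (f x))\<^sup>2" a]
  by (auto simp: square_integrable_def intro!: measurable_unit_interval)

text \<open>The square lattice of density \<open>2 K\<close> has mesh \<open>1 / side K\<close>.\<close>
definition side :: "nat \<Rightarrow> real" where "side K = sqrt (2 * real K)"

definition lattice_point :: "nat \<Rightarrow> int \<Rightarrow> int \<Rightarrow> real ^ 2" where
  "lattice_point K k l = vector [of_int k / side K, of_int l / side K]"

text \<open>The translated Gaussian in the dilated coordinate t = \<open>side K\<close> * x, in
  which the modulations become the characters \<open>fexp\<close> of period 1.\<close>

definition window :: "nat \<Rightarrow> int \<Rightarrow> real \<Rightarrow> real" where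
  "window K k x = 2 powr (1/4) * exp (- pi * (side K * x - of_int k / side K)\<^sup>2)"

lemma side_pos: "K \<ge> 1 \<Longrightarrow> side K > 0"
  by (simp add: side_def)

lemma side_sq: "(side K)\<^sup>2 = 2 * real K"
  by (simp add: side_def)

lemma bij_betw_lattice_point:
  assumes K: "K \<ge> 1"
  shows "bij_betw (\<lambda>(k, l). lattice_point K k l) UNIV (Lambda_1x1 (2 * real K))"
proof -
  have c: "(2 * real K) powr (- 1/2) = 1 / side K"
    using K by (simp add: side_def powr_minus_divide powr_half_sqrt)
  show ?thesis
  proof (rule bij_betwI')
    fix p q :: "int \<times> int"
    show "((\<lambda>(k, l). lattice_point K k l) p = (\<lambda>(k, l). lattice_point K k l) q) = (p = q)"
      using side_pos[OF K] by (auto simp: lattice_point_def vec_eq_iff forall_2 vector_2 split: prod.splits)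
    show "(\<lambda>(k, l). lattice_point K k l) p \<in> Lambda_1x1 (2 * real K)"
      unfolding Lambda_1x1_def c by (cases p) (auto simp: lattice_point_def forall_2 vector_2)
  next
    fix z assume "z \<in> Lambda_1x1 (2 * real K)"
    then obtain k l where "z $ 1 = (1 / side K) * of_int k" "z $ 2 = (1 / side K) * of_int l"
      unfolding Lambda_1x1_def c by blast
    then have "z = lattice_point K k l"
      by (simp add: lattice_point_def vec_eq_iff forall_2 vector_2)
    then show "\<exists>p\<in>UNIV. z = (\<lambda>(k, l). lattice_point K k l) p" by auto
  qed
qed

lemma tf_shift_lattice_point:
  assumes K: "K \<ge> 1"
  shows "tf_shift (lattice_point K k l) gaussian (side K * x) = fexp l x * of_real (window K k x)"
  using side_pos[OF K]
  by (simp add: tf_shift_def lattice_point_def vector_2 gaussian_def window_def fexp_def cis_conv_exp mult_ac)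

lemma gabor_coefficient:
  assumes K: "K \<ge> 1"
  shows "l2_inner f (tf_shift (lattice_point K k l) gaussian)
    = of_real (side K) * (LINT x|lborel. f (side K * x) * of_real (window K k x) * cnj (fexp l x))"
proof -
  have "l2_inner f (tf_shift (lattice_point K k l) gaussian) =
      \<bar>side K\<bar> *\<^sub>R (LINT x|lborel. f (0 + side K * x) * cnj (tf_shift (lattice_point K k l) gaussian (0 + side K * x)))"
    unfolding l2_inner_def using side_pos[OF K] by (intro lborel_integral_real_affine) auto
  also have "\<dots> = of_real (side K) * (LINT x|lborel. f (side K * x) * of_real (window K k x) * cnj (fexp l x))"
    using side_pos[OF K] unfolding add_0 tf_shift_lattice_point[OF K] by (simp add: scaleR_conv_of_real mult_ac)
  finally show ?thesis .
qed

lemma window_bound: "\<bar>window K k x\<bar> \<le> 2 powr (1/4)"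
  by (simp add: window_def mult_left_le)

lemma continuous_on_window [continuous_intros]: "continuous_on S (window K k)"
  unfolding window_def by (intro continuous_intros)

lemma measurable_window [measurable]: "window K k \<in> borel_measurable borel"
  by (intro borel_measurable_continuous_onI continuous_on_window)

text \<open>
  This is where an even density is used: the centre \<open>K (m + m')\<close> of the product of two translated
  windows is an integer, so the sum over \<open>k\<close> does not see it.
\<close>
lemma has_sum_window_product:
  assumes K: "K \<ge> 1"
  shows "((\<lambda>k. window K k (x + of_int m) * window K k (x + of_int m')) has_sum
    side K * (exp (- (pi * real K) * (of_int (m - m'))\<^sup>2) * gtheta (pi * real K) (2 * real K * x))) UNIV"
proof -
  let ?K = "real K"
  have K0: "?K > 0" using K by simp
  define c where "c = sqrt 2 * exp (- (pi * ?K) * (of_int (m - m'))\<^sup>2)"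
  have eq: "window K k (x + of_int m) * window K k (x + of_int m') =
      c * exp (- (pi / ?K) * (2 * ?K * x + of_int (int K * (m + m') - k))\<^sup>2)" for k
  proof -
    let ?a = "side K"
    have a: "?a > 0" "?a\<^sup>2 = 2 * ?K" using side_pos[OF K] side_sq by auto
    have *: "?a * y - of_int k / ?a = (2 * ?K * y - of_int k) / ?a" for y
      using a by (simp add: field_simps power2_eq_square)
    have "(?a * (x + of_int m) - of_int k / ?a)\<^sup>2 + (?a * (x + of_int m') - of_int k / ?a)\<^sup>2
        = ((2 * ?K * (x + of_int m) - of_int k)\<^sup>2 + (2 * ?K * (x + of_int m') - of_int k)\<^sup>2) / (2 * ?K)"
      unfolding * power_divide a(2) by (simp add: add_divide_distrib)
    \<comment> \<open>Here u^2 + v^2 = (u - v)^2 / 2 + (u + v)^2 / 2, with u - v = 2 K (m - m') and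
      (u + v) / 2 = 2 K x + K (m + m') - k.\<close>
    also have "\<dots> = ?K * (of_int (m - m'))\<^sup>2 + (1 / ?K) * (2 * ?K * x + of_int (int K * (m + m') - k))\<^sup>2"
      using K0 by (simp add: field_simps power2_eq_square)
    finally have e: "(?a * (x + of_int m) - of_int k / ?a)\<^sup>2 + (?a * (x + of_int m') - of_int k / ?a)\<^sup>2
        = ?K * (of_int (m - m'))\<^sup>2 + (1 / ?K) * (2 * ?K * x + of_int (int K * (m + m') - k))\<^sup>2" .
    have "window K k (x + of_int m) * window K k (x + of_int m') = (2 powr (1/4) * 2 powr (1/4)) *
        exp (- pi * ((?a * (x + of_int m) - of_int k / ?a)\<^sup>2 + (?a * (x + of_int m') - of_int k / ?a)\<^sup>2))"
      unfolding window_def distrib_left exp_add by (simp only: mult_ac)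
    also have "2 powr (1/4) * 2 powr (1/4) = sqrt (2::real)"
      by (simp add: powr_half_sqrt flip: powr_add)
    also have "- pi * ((?a * (x + of_int m) - of_int k / ?a)\<^sup>2 + (?a * (x + of_int m') - of_int k / ?a)\<^sup>2)
        = - (pi * ?K) * (of_int (m - m'))\<^sup>2 + - (pi / ?K) * (2 * ?K * x + of_int (int K * (m + m') - k))\<^sup>2"
      unfolding e by (simp add: distrib_left)
    finally show ?thesis unfolding exp_add c_def by (simp only: mult_ac)
  qed
  have bij: "bij (\<lambda>k. int K * (m + m') - k)"
    by (rule bij_betwI[where g="\<lambda>k. int K * (m + m') - k"]) auto
  have "((\<lambda>j. exp (- (pi / ?K) * (2 * ?K * x + of_int j)\<^sup>2)) has_sum gauss_periodic (pi / ?K) (2 * ?K * x)) UNIV"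
    using K0 by (intro has_sum_gauss_periodic) simp
  then have "((\<lambda>k. exp (- (pi / ?K) * (2 * ?K * x + of_int (int K * (m + m') - k))\<^sup>2)) has_sum gauss_periodic (pi / ?K) (2 * ?K * x)) UNIV"
    using has_sum_reindex_bij_betw[OF bij, of "\<lambda>j. exp (- (pi / ?K) * (2 * ?K * x + of_int j)\<^sup>2)"] by blast
  from has_sum_cmult_right[OF this, of c]
  have "((\<lambda>k. window K k (x + of_int m) * window K k (x + of_int m')) has_sum c * gauss_periodic (pi / ?K) (2 * ?K * x)) UNIV"
    unfolding eq .
  \<comment> \<open>Poisson summation turns the parameter pi / K into pi K, the same nome as in the
    factor depending on m - m'.\<close>
  also have "gauss_periodic (pi / ?K) (2 * ?K * x) = sqrt ?K * gtheta (pi * ?K) (2 * ?K * x)"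
    using gauss_periodic_eq_gtheta[of "pi / ?K" "2 * ?K * x"] K0 by (simp add: power2_eq_square)
  also have "c * (sqrt ?K * gtheta (pi * ?K) (2 * ?K * x)) =
      side K * (exp (- (pi * ?K) * (of_int (m - m'))\<^sup>2) * gtheta (pi * ?K) (2 * ?K * x))"
    by (simp add: c_def side_def real_sqrt_mult mult_ac)
  finally show ?thesis .
qed

text \<open>The coefficient matrix is real and symmetric, so the Hermitian form is real and taking
  real parts termwise does not change it.\<close>

definition toeplitz_form :: "real \<Rightarrow> int set \<Rightarrow> (int \<Rightarrow> complex) \<Rightarrow> real" where
  "toeplitz_form s I z = (\<Sum>m\<in>I. \<Sum>m'\<in>I. exp (- s * (of_int (m - m'))\<^sup>2) * Re (z m * cnj (z m')))"

text \<open>The matrix entries are the Fourier coefficients of the theta function, which is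
  therefore the symbol; bounds for the symbol become bounds for the form.\<close>

lemma toeplitz_form_eq_integral:
  fixes I :: "int set" and z :: "int \<Rightarrow> complex"
  assumes s: "s > 0"
  defines "Z \<equiv> (\<lambda>x. \<Sum>m\<in>I. z m * fexp (- m) x)"
  shows "toeplitz_form s I z = (LINT x|unit_interval. gtheta s x * (cmod (Z x))\<^sup>2)"
    and "integrable unit_interval (\<lambda>x. gtheta s x * (cmod (Z x))\<^sup>2)"
proof -
  have gi: "integrable unit_interval (\<lambda>x. of_real (gtheta s x) * cnj (fexp j x))" for j
    by (intro square_integrable_mult(2) square_integrable_fexp square_integrable_unit_interval_continuous
        continuous_on_of_real continuous_on_gtheta s)
  have expand: "complex_of_real (gtheta s x * (cmod (Z x))\<^sup>2) =
      (\<Sum>m\<in>I. \<Sum>m'\<in>I. (z m * cnj (z m')) * (of_real (gtheta s x) * cnj (fexp (m - m') x)))" for x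
  proof -
    have "complex_of_real ((cmod (Z x))\<^sup>2) = (\<Sum>m\<in>I. z m * fexp (- m) x) * (\<Sum>m'\<in>I. cnj (z m') * fexp m' x)"
      unfolding Z_def by (simp only: complex_norm_square cnj_sum complex_cnj_mult cnj_fexp minus_minus)
    also have "\<dots> = (\<Sum>m\<in>I. \<Sum>m'\<in>I. (z m * cnj (z m')) * (fexp (- m) x * fexp m' x))"
      by (simp only: sum_product mult_ac)
    finally show ?thesis
      by (simp add: sum_distrib_left cnj_fexp fexp_mult mult_ac)
  qed
  have int: "integrable unit_interval (\<lambda>x. complex_of_real (gtheta s x * (cmod (Z x))\<^sup>2))"
    unfolding expand by (intro Bochner_Integration.integrable_sum integrable_mult_right gi)
  then show "integrable unit_interval (\<lambda>x. gtheta s x * (cmod (Z x))\<^sup>2)"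
    using integrable_Re by fastforce
  have "complex_of_real (LINT x|unit_interval. gtheta s x * (cmod (Z x))\<^sup>2) =
      (LINT x|unit_interval. complex_of_real (gtheta s x * (cmod (Z x))\<^sup>2))"
    by (rule integral_complex_of_real[symmetric])
  also have "\<dots> = (\<Sum>m\<in>I. \<Sum>m'\<in>I. (z m * cnj (z m')) * (LINT x|unit_interval. of_real (gtheta s x) * cnj (fexp (m - m') x)))"
    unfolding expand
    by (simp only: Bochner_Integration.integral_sum Bochner_Integration.integrable_sum integrable_mult_right gi integral_mult_right_zero)
  also have "\<dots> = (\<Sum>m\<in>I. \<Sum>m'\<in>I. (z m * cnj (z m')) * of_real (exp (- s * (of_int (m - m'))\<^sup>2)))"
    by (simp only: fcoeff_gtheta[OF s, unfolded fcoeff_def])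
  finally have "(LINT x|unit_interval. gtheta s x * (cmod (Z x))\<^sup>2) =
      Re (\<Sum>m\<in>I. \<Sum>m'\<in>I. (z m * cnj (z m')) * of_real (exp (- s * (of_int (m - m'))\<^sup>2)))"
    by (metis Re_complex_of_real)
  also have "\<dots> = toeplitz_form s I z"
    unfolding toeplitz_form_def Re_sum by (intro sum.cong refl) (simp add: mult.commute)
  finally show "toeplitz_form s I z = (LINT x|unit_interval. gtheta s x * (cmod (Z x))\<^sup>2)" by simp
qed

lemma toeplitz_form_bounds:
  assumes s: "s \<ge> 3" and I: "finite I"
  shows "gtheta s (1/2) * (\<Sum>m\<in>I. (cmod (z m))\<^sup>2) \<le> toeplitz_form s I z"
    and "toeplitz_form s I z \<le> gtheta s 0 * (\<Sum>m\<in>I. (cmod (z m))\<^sup>2)"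
proof -
  have s0: "s > 0" using s by simp
  define Z where "Z x = (\<Sum>m\<in>I. z m * fexp (- m) x)" for x
  have Zsq: "(LINT x|unit_interval. (cmod (Z x))\<^sup>2) = (\<Sum>m\<in>I. (cmod (z m))\<^sup>2)"
  proof -
    \<comment> \<open>\<open>Z\<close> is treated as the error of approximating the zero function;
      the index is reflected because \<open>Z\<close> carries the frequencies -m.\<close>
    have eq: "cmod (Z x) = cmod (0 - (\<Sum>l\<in>uminus ` I. z (- l) * fexp l x))" for x
      by (subst sum.reindex) (auto simp: Z_def)
    have "(LINT x|unit_interval. (cmod (Z x))\<^sup>2) = (\<Sum>l\<in>uminus ` I. (cmod (z (- l)))\<^sup>2)"
      unfolding eq using integral_norm_sq_diff_trig[OF square_integrable_0, of "uminus ` I" "\<lambda>l. z (- l)"] I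
      by (simp add: fcoeff_def)
    then show ?thesis by (simp add: sum.reindex)
  qed
  have Zi: "integrable unit_interval (\<lambda>x. (cmod (Z x))\<^sup>2)"
    unfolding Z_def by (intro square_integrableD(2) square_integrable_sum square_integrable_cmult square_integrable_fexp)
  note t = toeplitz_form_eq_integral[OF s0, where I=I and z=z, folded Z_def]
  have "gtheta s (1/2) * (\<Sum>m\<in>I. (cmod (z m))\<^sup>2) = (LINT x|unit_interval. gtheta s (1/2) * (cmod (Z x))\<^sup>2)"
    by (simp add: Zsq)
  also have "\<dots> \<le> toeplitz_form s I z"
    unfolding t(1) using Zi t(2) by (intro integral_mono mult_right_mono gtheta_ge s) auto
  finally show "gtheta s (1/2) * (\<Sum>m\<in>I. (cmod (z m))\<^sup>2) \<le> toeplitz_form s I z" .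
  have "toeplitz_form s I z \<le> (LINT x|unit_interval. gtheta s 0 * (cmod (Z x))\<^sup>2)"
    unfolding t(1) using Zi t(2) by (intro integral_mono mult_right_mono gtheta_le s0) auto
  also have "\<dots> = gtheta s 0 * (\<Sum>m\<in>I. (cmod (z m))\<^sup>2)"
    by (simp add: Zsq)
  finally show "toeplitz_form s I z \<le> gtheta s 0 * (\<Sum>m\<in>I. (cmod (z m))\<^sup>2)" .
qed

section \<open>Spectral bounds\<close>


lemma has_sum_UNIV_finite_support:
  fixes g :: "'a \<Rightarrow> 'b :: {topological_comm_monoid_add, t2_space}"
  assumes "(g has_sum S) UNIV" "finite I" "\<And>m. m \<notin> I \<Longrightarrow> g m = 0"
  shows "S = (\<Sum>m\<in>I. g m)"
proof -
  have "(g has_sum S) I"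
    using assms(1) by (rule has_sum_cong_neutral[THEN iffD1, rotated -1]) (use assms(3) in auto)
  then show ?thesis using assms(2) has_sum_unique has_sum_finite by blast
qed

lemma unit_interval_translate_support:
  assumes "x \<in> {0..<1::real}" "m \<notin> {- int M..<int M}"
  shows "x + of_int m < - real M \<or> real M \<le> x + of_int m"
proof -
  have "m \<le> - int M - 1 \<or> m \<ge> int M" using assms(2) by auto
  then have "real_of_int m \<le> - real M - 1 \<or> real_of_int m \<ge> real M"
    using of_int_le_iff[of m "- int M - 1", where 'a=real] of_int_le_iff[of "int M" m, where 'a=real] by simp
  then show ?thesis using assms(1) by auto
qed

lemma compact_support_norm_sq:
  assumes K: "K \<ge> 1" and f: "f \<in> L2"
    and supp: "\<forall>x. x < - real M \<or> real M \<le> x \<longrightarrow> f (side K * x) = 0"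
  defines "I \<equiv> {- int M..<int M}"
  shows "(l2_norm f)\<^sup>2 = side K * (LINT x|unit_interval. (\<Sum>m\<in>I. (cmod (f (side K * (x + of_int m))))\<^sup>2))"
    and "integrable unit_interval (\<lambda>x. \<Sum>m\<in>I. (cmod (f (side K * (x + of_int m))))\<^sup>2)"
proof -
  have sq: "square_integrable lborel (\<lambda>x. f (side K * x))"
    using f side_pos[OF K] by (intro square_integrable_dilate) (auto simp: L2_iff)
  note i = square_integrableD(2)[OF sq]
  have iu: "integrable unit_interval (\<lambda>x. (cmod (f (side K * (x + of_int m))))\<^sup>2)" for m
    by (rule integrable_unit_interval_shift[OF i])
  then show "integrable unit_interval (\<lambda>x. \<Sum>m\<in>I. (cmod (f (side K * (x + of_int m))))\<^sup>2)"
    by (intro Bochner_Integration.integrable_sum)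
  have "(l2_norm f)\<^sup>2 = \<bar>side K\<bar> *\<^sub>R (LINT x|lborel. (cmod (f (0 + side K * x)))\<^sup>2)"
    unfolding l2_norm_sq using side_pos[OF K] by (intro lborel_integral_real_affine) auto
  also have "(LINT x|lborel. (cmod (f (0 + side K * x)))\<^sup>2) = (\<Sum>m\<in>I. LINT x|unit_interval. (cmod (f (side K * (x + of_int m))))\<^sup>2)"
    unfolding add_0
  proof (rule has_sum_UNIV_finite_support[OF has_sum_integral_periodize[OF i]])
    show "(LINT x|unit_interval. (cmod (f (side K * (x + of_int m))))\<^sup>2) = 0" if "m \<notin> I" for m
      by (rule integral_eq_zero_AE, rule AE_I2)
         (use supp[rule_format, OF unit_interval_translate_support] that in \<open>auto simp: I_def\<close>)
  qed (simp add: I_def)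
  also have "\<dots> = (LINT x|unit_interval. (\<Sum>m\<in>I. (cmod (f (side K * (x + of_int m))))\<^sup>2))"
    by (intro Bochner_Integration.integral_sum[symmetric] iu)
  finally show "(l2_norm f)\<^sup>2 = side K * (LINT x|unit_interval. (\<Sum>m\<in>I. (cmod (f (side K * (x + of_int m))))\<^sup>2))"
    using side_pos[OF K] by simp
qed

text \<open>
  Parseval in the modulation index \<open>l\<close> turns the coefficients into the periodizations of \<open>f\<close>
  times a window; the sum over the translation index \<open>k\<close> is then carried out pointwise.
\<close>
lemma gabor_sum_compact_support:
  assumes K: "K \<ge> 1" and f: "f \<in> L2"
    and supp: "\<forall>x. x < - real M \<or> real M \<le> x \<longrightarrow> f (side K * x) = 0"
  defines "I \<equiv> {- int M..<int M}"
  defines "Fn \<equiv> (\<lambda>x. gtheta (pi * real K) (2 * real K * x) * toeplitz_form (pi * real K) I (\<lambda>m. f (side K * (x + of_int m))))"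
  shows "((\<lambda>(k, l). gabor_energy f (lattice_point K k l))
      has_sum (side K)\<^sup>2 * (side K * (LINT x|unit_interval. Fn x))) UNIV"
    and "integrable unit_interval Fn"
proof -
  define F where "F x = f (side K * x)" for x
  define s where "s = pi * real K"
  have s: "s > 0" using K by (simp add: s_def)
  have I: "finite I" by (simp add: I_def)
  have F: "square_integrable lborel F"
    unfolding F_def using f side_pos[OF K] by (intro square_integrable_dilate) (auto simp: L2_iff)
  have Fm [measurable]: "F \<in> borel_measurable borel" using square_integrableD(1)[OF F] by simp
  have [measurable]: "gtheta s \<in> borel_measurable borel"
    by (intro borel_measurable_continuous_onI continuous_on_gtheta s)
  have FU: "square_integrable unit_interval (\<lambda>x. F (x + of_int m))" for m
    by (rule square_integrable_shift_unit_interval[OF F])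
  \<comment> \<open>The periodization of window times \<open>F\<close>; only the translates in
    \<open>I\<close> meet the support.\<close>
  define P where "P k x = (\<Sum>m\<in>I. of_real (window K k (x + of_int m)) * F (x + of_int m))" for k x
  have Pm: "P k \<in> borel_measurable lborel" for k
    unfolding P_def by measurable
  have PU: "square_integrable unit_interval (P k)" for k
    unfolding P_def
  proof (rule square_integrable_sum)
    fix m
    show "square_integrable unit_interval (\<lambda>x. of_real (window K k (x + of_int m)) * F (x + of_int m))"
      by (rule square_integrable_bounded_mult[OF FU, where C="2 powr (1/4)"])
         (auto intro!: measurable_unit_interval simp: window_bound)
  qed
  have coeff: "(LINT x|lborel. F x * of_real (window K k x) * cnj (fexp l x)) = fcoeff (P k) l" for k l
  proof -
    have e: "F x * of_real (window K k x) * cnj (fexp l x) = F x * cnj (tf_shift (lattice_point K k l) gaussian (side K * x))" for x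
      unfolding tf_shift_lattice_point[OF K] by simp
    have "square_integrable lborel (\<lambda>x. tf_shift (lattice_point K k l) gaussian (side K * x))"
      using gaussian_shift_L2 side_pos[OF K] by (intro square_integrable_dilate) (auto simp: L2_iff)
    then have h: "integrable lborel (\<lambda>x. F x * of_real (window K k x) * cnj (fexp l x))"
      unfolding e by (intro square_integrable_mult F)
    have "(LINT x|lborel. F x * of_real (window K k x) * cnj (fexp l x)) =
        (\<Sum>m\<in>I. LINT x|unit_interval. F (x + of_int m) * of_real (window K k (x + of_int m)) * cnj (fexp l (x + of_int m)))"
    proof (rule has_sum_UNIV_finite_support[OF has_sum_integral_periodize[OF h] I])
      show "(LINT x|unit_interval. F (x + of_int m) * of_real (window K k (x + of_int m)) * cnj (fexp l (x + of_int m))) = 0"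
        if "m \<notin> I" for m
        by (rule integral_eq_zero_AE, rule AE_I2)
           (use supp[rule_format, OF unit_interval_translate_support] that in \<open>auto simp: I_def F_def\<close>)
    qed
    also have "\<dots> = (LINT x|unit_interval. (\<Sum>m\<in>I. F (x + of_int m) * of_real (window K k (x + of_int m)) * cnj (fexp l (x + of_int m))))"
      by (intro Bochner_Integration.integral_sum[symmetric] integrable_unit_interval_shift[OF h])
    also have "\<dots> = fcoeff (P k) l"
      unfolding fcoeff_def P_def sum_distrib_right fexp_of_int_add by (simp only: mult_ac)
    finally show ?thesis .
  qed
  have inner: "((\<lambda>l. gabor_energy f (lattice_point K k l))
      has_sum (side K)\<^sup>2 * (LINT x|unit_interval. (cmod (P k x))\<^sup>2)) UNIV" for k
  proof -
    have "gabor_energy f (lattice_point K k l) = (side K)\<^sup>2 * (cmod (fcoeff (P k) l))\<^sup>2" for l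
      unfolding gabor_coefficient[OF K] coeff[unfolded F_def] by (simp add: norm_mult power_mult_distrib)
    then show ?thesis using has_sum_cmult_right[OF parseval[OF Pm PU]] by simp
  qed
  have pt: "((\<lambda>k. (cmod (P k x))\<^sup>2) has_sum side K * Fn x) UNIV" for x
  proof -
    have e: "(cmod (P k x))\<^sup>2 = (\<Sum>m\<in>I. \<Sum>m'\<in>I. window K k (x + of_int m) * window K k (x + of_int m') * Re (F (x + of_int m) * cnj (F (x + of_int m'))))" for k
    proof -
      have "complex_of_real ((cmod (P k x))\<^sup>2) = P k x * cnj (P k x)" by (simp only: complex_norm_square)
      also have "\<dots> = (\<Sum>m\<in>I. \<Sum>m'\<in>I. of_real (window K k (x + of_int m) * window K k (x + of_int m')) * (F (x + of_int m) * cnj (F (x + of_int m'))))"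
        unfolding P_def cnj_sum sum_product complex_cnj_mult complex_cnj_complex_of_real by (simp only: of_real_mult mult_ac)
      finally have "(cmod (P k x))\<^sup>2 = Re (\<Sum>m\<in>I. \<Sum>m'\<in>I. of_real (window K k (x + of_int m) * window K k (x + of_int m')) * (F (x + of_int m) * cnj (F (x + of_int m'))))"
        by (metis Re_complex_of_real)
      also have "\<dots> = (\<Sum>m\<in>I. \<Sum>m'\<in>I. window K k (x + of_int m) * window K k (x + of_int m') * Re (F (x + of_int m) * cnj (F (x + of_int m'))))"
        unfolding Re_sum by (intro sum.cong refl) simp
      finally show ?thesis .
    qed
    have "((\<lambda>k. (cmod (P k x))\<^sup>2) has_sum (\<Sum>m\<in>I. \<Sum>m'\<in>I.
        side K * (exp (- s * (of_int (m - m'))\<^sup>2) * gtheta s (2 * real K * x)) * Re (F (x + of_int m) * cnj (F (x + of_int m'))))) UNIV"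
      unfolding e s_def by (intro has_sum_finite_sum has_sum_cmult_left has_sum_window_product K)
    also have "(\<Sum>m\<in>I. \<Sum>m'\<in>I.
        side K * (exp (- s * (of_int (m - m'))\<^sup>2) * gtheta s (2 * real K * x)) * Re (F (x + of_int m) * cnj (F (x + of_int m'))))
        = side K * Fn x"
      unfolding Fn_def toeplitz_form_def sum_distrib_left F_def[symmetric] s_def[symmetric] by (simp only: mult_ac)
    finally show ?thesis .
  qed
  show FnI: "integrable unit_interval Fn"
  proof -
    have gb: "\<bar>gtheta s x\<bar> \<le> 1 + 2 * exp (- s) / (1 - exp (- s))" for x
      using gtheta_near_1[OF s, of x] by linarith
    have "integrable unit_interval (\<lambda>x. exp (- s * (of_int (m - m'))\<^sup>2) * Re (F (x + of_int m) * cnj (F (x + of_int m'))))" for m m'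
      by (intro integrable_mult_right integrable_Re square_integrable_mult FU)
    then have T: "integrable unit_interval (\<lambda>x. toeplitz_form s I (\<lambda>m. F (x + of_int m)))"
      unfolding toeplitz_form_def by (intro Bochner_Integration.integrable_sum)
    have "integrable unit_interval (\<lambda>x. gtheta s (2 * real K * x) * toeplitz_form s I (\<lambda>m. F (x + of_int m)))"
    proof (rule Bochner_Integration.integrable_bound)
      show "integrable unit_interval (\<lambda>x. (1 + 2 * exp (- s) / (1 - exp (- s))) * toeplitz_form s I (\<lambda>m. F (x + of_int m)))"
        by (intro integrable_mult_right T)
      show "(\<lambda>x. gtheta s (2 * real K * x) * toeplitz_form s I (\<lambda>m. F (x + of_int m))) \<in> borel_measurable unit_interval"
        by (rule borel_measurable_times[OF measurable_unit_interval borel_measurable_integrable[OF T]]) measurable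
      show "AE x in unit_interval. norm (gtheta s (2 * real K * x) * toeplitz_form s I (\<lambda>m. F (x + of_int m)))
          \<le> norm ((1 + 2 * exp (- s) / (1 - exp (- s))) * toeplitz_form s I (\<lambda>m. F (x + of_int m)))"
      proof (rule AE_I2)
        fix x
        have "norm (gtheta s (2 * real K * x) * toeplitz_form s I (\<lambda>m. F (x + of_int m))) =
            \<bar>gtheta s (2 * real K * x)\<bar> * \<bar>toeplitz_form s I (\<lambda>m. F (x + of_int m))\<bar>"
          by (simp only: real_norm_def abs_mult)
        also have "\<dots> \<le> \<bar>1 + 2 * exp (- s) / (1 - exp (- s))\<bar> * \<bar>toeplitz_form s I (\<lambda>m. F (x + of_int m))\<bar>"
          using gb by (intro mult_right_mono) (auto intro: order_trans[OF gb abs_ge_self])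
        finally show "norm (gtheta s (2 * real K * x) * toeplitz_form s I (\<lambda>m. F (x + of_int m)))
          \<le> norm ((1 + 2 * exp (- s) / (1 - exp (- s))) * toeplitz_form s I (\<lambda>m. F (x + of_int m)))"
          by (simp only: real_norm_def abs_mult)
      qed
    qed
    then show ?thesis unfolding Fn_def s_def F_def .
  qed
  \<comment> \<open>Of the three factors \<open>side K\<close> in the total, two come from dilating
    the coefficient integral and one from the window sums.\<close>
  have "((\<lambda>k. LINT x|unit_interval. (cmod (P k x))\<^sup>2) has_sum (LINT x|unit_interval. side K * Fn x)) UNIV"
    by (rule has_sum_integral_nonneg) (use square_integrableD(2)[OF PU] pt FnI in auto)
  from has_sum_cmult_right[OF this, of "(side K)\<^sup>2"]
  have outer: "((\<lambda>k. (side K)\<^sup>2 * (LINT x|unit_interval. (cmod (P k x))\<^sup>2)) has_sum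
      (side K)\<^sup>2 * (side K * (LINT x|unit_interval. Fn x))) UNIV"
    by simp
  show "((\<lambda>(k, l). gabor_energy f (lattice_point K k l))
      has_sum (side K)\<^sup>2 * (side K * (LINT x|unit_interval. Fn x))) UNIV"
    by (rule has_sum_iterated_nonneg[OF _ inner outer]) simp
qed

lemma pi_mult_ge_3: "K \<ge> 1 \<Longrightarrow> pi * real K \<ge> 3"
  using pi_gt3 mult_mono[of 3 pi 1 "real K"] by simp

text \<open>At each x the Toeplitz form lies between the extremes of theta times \<open>N x\<close>,
  and its prefactor lies between the same extremes. Positivity of the minimum makes the form
  nonnegative and allows the two estimates to be multiplied.\<close>

lemma gabor_bounds_compact_support:
  assumes K: "K \<ge> 1" and f: "f \<in> L2"
    and supp: "\<forall>x. x < - real M \<or> real M \<le> x \<longrightarrow> f (side K * x) = 0"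
  defines "Q \<equiv> (\<Sum>\<^sub>\<infinity>z\<in>Lambda_1x1 (2 * real K). gabor_energy f z)"
  shows "(\<lambda>z. gabor_energy f z) summable_on Lambda_1x1 (2 * real K)"
    and "2 * real K * (gtheta (pi * real K) (1/2))\<^sup>2 * (l2_norm f)\<^sup>2 \<le> Q"
    and "Q \<le> 2 * real K * (gtheta (pi * real K) 0)\<^sup>2 * (l2_norm f)\<^sup>2"
    and "Q = 2 * real K * (side K * (LINT x|unit_interval. gtheta (pi * real K) (2 * real K * x) *
      toeplitz_form (pi * real K) {- int M..<int M} (\<lambda>m. f (side K * (x + of_int m)))))"
proof -
  define s where "s = pi * real K"
  have s: "s \<ge> 3" unfolding s_def using pi_mult_ge_3[OF K] .
  define I where "I = {- int M..<int M}"
  define T where "T x = toeplitz_form s I (\<lambda>m. f (side K * (x + of_int m)))" for x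
  define N where "N x = (\<Sum>m\<in>I. (cmod (f (side K * (x + of_int m))))\<^sup>2)" for x
  note sums = gabor_sum_compact_support[OF K f supp, folded I_def s_def, folded T_def]
  note norm = compact_support_norm_sq[OF K f supp, folded I_def, folded N_def]
  have "((\<lambda>z. gabor_energy f z) has_sum
      (side K)\<^sup>2 * (side K * (LINT x|unit_interval. gtheta s (2 * real K * x) * T x))) (Lambda_1x1 (2 * real K))"
    using has_sum_reindex_bij_betw[OF bij_betw_lattice_point[OF K], of "\<lambda>z. gabor_energy f z"] sums(1)
    by (simp add: case_prod_unfold)
  then show "(\<lambda>z. gabor_energy f z) summable_on Lambda_1x1 (2 * real K)"
    and Q: "Q = 2 * real K * (side K * (LINT x|unit_interval. gtheta (pi * real K) (2 * real K * x) *
      toeplitz_form (pi * real K) {- int M..<int M} (\<lambda>m. f (side K * (x + of_int m)))))"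
    unfolding Q_def T_def s_def I_def by (simp_all add: has_sum_iff side_sq)
  then have Q: "Q = 2 * real K * (side K * (LINT x|unit_interval. gtheta s (2 * real K * x) * T x))"
    by (simp add: T_def s_def I_def)
  have N0: "N x \<ge> 0" for x unfolding N_def by (intro sum_nonneg) auto
  have Tb: "gtheta s (1/2) * N x \<le> T x" "T x \<le> gtheta s 0 * N x" for x
    unfolding T_def N_def by (intro toeplitz_form_bounds s; simp add: I_def)+
  have th: "gtheta s (1/2) > 0" "gtheta s 0 > 0"
    using gtheta_half_pos[OF s] gtheta_0_pos[of s] s by auto
  have T0: "T x \<ge> 0" for x using Tb(1)[of x] mult_nonneg_nonneg[OF less_imp_le[OF th(1)] N0[of x]] by linarith
  have pw: "(gtheta s (1/2))\<^sup>2 * N x \<le> gtheta s (2 * real K * x) * T x"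
    "gtheta s (2 * real K * x) * T x \<le> (gtheta s 0)\<^sup>2 * N x" for x
  proof -
    have "(gtheta s (1/2))\<^sup>2 * N x \<le> gtheta s (1/2) * T x"
      using mult_left_mono[OF Tb(1)[of x] less_imp_le[OF th(1)]] by (simp add: power2_eq_square mult.assoc)
    also have "\<dots> \<le> gtheta s (2 * real K * x) * T x"
      by (intro mult_right_mono gtheta_ge s T0)
    finally show "(gtheta s (1/2))\<^sup>2 * N x \<le> gtheta s (2 * real K * x) * T x" .
    have "gtheta s (2 * real K * x) * T x \<le> gtheta s 0 * T x"
      using s by (intro mult_right_mono gtheta_le T0) auto
    also have "\<dots> \<le> (gtheta s 0)\<^sup>2 * N x"
      using mult_left_mono[OF Tb(2)[of x] less_imp_le[OF th(2)]] by (simp add: power2_eq_square mult.assoc)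
    finally show "gtheta s (2 * real K * x) * T x \<le> (gtheta s 0)\<^sup>2 * N x" .
  qed
  have l: "(gtheta s (1/2))\<^sup>2 * (LINT x|unit_interval. N x) \<le> (LINT x|unit_interval. gtheta s (2 * real K * x) * T x)"
    unfolding integral_mult_right_zero[symmetric]
    by (intro integral_mono integrable_mult_right norm(2) sums(2) pw(1))
  have u: "(LINT x|unit_interval. gtheta s (2 * real K * x) * T x) \<le> (gtheta s 0)\<^sup>2 * (LINT x|unit_interval. N x)"
    unfolding integral_mult_right_zero[symmetric]
    by (intro integral_mono integrable_mult_right norm(2) sums(2) pw(2))
  have c: "2 * real K * side K \<ge> 0" using side_pos[OF K] by simp
  show "2 * real K * (gtheta (pi * real K) (1/2))\<^sup>2 * (l2_norm f)\<^sup>2 \<le> Q"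
    using mult_left_mono[OF l c] unfolding Q norm(1) s_def[symmetric] by (simp only: mult_ac)
  show "Q \<le> 2 * real K * (gtheta (pi * real K) 0)\<^sup>2 * (l2_norm f)\<^sup>2"
    using mult_left_mono[OF u c] unfolding Q norm(1) s_def[symmetric] by (simp only: mult_ac)
qed

section \<open>Truncation and the bounds on all square-integrable functions\<close>

definition truncate_to :: "real \<Rightarrow> (real \<Rightarrow> complex) \<Rightarrow> real \<Rightarrow> complex" where
  "truncate_to R f t = (if - R \<le> t \<and> t < R then f t else 0)"

lemma truncate_to_L2:
  assumes "f \<in> L2"
  shows "truncate_to R f \<in> L2"
proof -
  have "square_integrable lborel (\<lambda>t. (if - R \<le> t \<and> t < R then 1 else 0) * f t)"
    by (rule square_integrable_bounded_mult[of _ _ _ 1]) (use assms in \<open>auto simp: L2_iff\<close>)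
  moreover have "(\<lambda>t. (if - R \<le> t \<and> t < R then 1 else 0) * f t) = truncate_to R f"
    by (auto simp: truncate_to_def)
  ultimately show ?thesis by (simp add: L2_iff)
qed

lemma truncate_to_tendsto:
  assumes f: "f \<in> L2" and c: "c > 0"
  shows "(\<lambda>n. l2_norm (\<lambda>t. truncate_to (c * real n) f t - f t)) \<longlonglongrightarrow> 0"
proof -
  have fm: "f \<in> borel_measurable lborel" "integrable lborel (\<lambda>t. (cmod (f t))\<^sup>2)"
    using f by (auto simp: L2_def)
  have "(\<lambda>n. LINT t|lborel. (cmod (f t - truncate_to (c * real n) f t))\<^sup>2) \<longlonglongrightarrow> 0"
  proof (rule integral_norm_sq_tendsto_0[OF fm(1) _ fm(2)])
    show "truncate_to (c * real n) f \<in> borel_measurable lborel" for n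
      using truncate_to_L2[OF f] by (simp add: L2_def)
    show "AE t in lborel. (cmod (f t - truncate_to (c * real n) f t))\<^sup>2 \<le> (cmod (f t))\<^sup>2" for n
      by (simp add: truncate_to_def)
    have "(\<lambda>n. truncate_to (c * real n) f t) \<longlonglongrightarrow> f t" for t
    proof (rule tendsto_eventually)
      obtain m where m: "(\<bar>t\<bar> + 1) / c \<le> real m" using real_arch_simple by blast
      have "truncate_to (c * real n) f t = f t" if "n \<ge> m" for n
      proof -
        have "(\<bar>t\<bar> + 1) / c \<le> real n" using m that by linarith
        then have "\<bar>t\<bar> + 1 \<le> c * real n" using c by (simp add: field_simps)
        then show ?thesis by (auto simp: truncate_to_def)
      qed
      then show "\<forall>\<^sub>F n in sequentially. truncate_to (c * real n) f t = f t"
        by (auto simp: eventually_sequentially)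
    qed
    then show "AE t in lborel. (\<lambda>n. truncate_to (c * real n) f t) \<longlonglongrightarrow> f t" by simp
  qed
  then have "(\<lambda>n. sqrt (LINT t|lborel. (cmod (f t - truncate_to (c * real n) f t))\<^sup>2)) \<longlonglongrightarrow> sqrt 0"
    by (rule tendsto_real_sqrt)
  then show ?thesis by (simp add: l2_norm_eq norm_minus_commute)
qed

lemma truncate_to_support:
  assumes "K \<ge> 1"
  shows "\<forall>x. x < - real n \<or> real n \<le> x \<longrightarrow> truncate_to (side K * real n) f (side K * x) = 0"
proof (intro allI impI)
  fix x assume "x < - real n \<or> real n \<le> x"
  then have "side K * x < side K * - real n \<or> side K * real n \<le> side K * x"
    using side_pos[OF assms] by (simp only: mult_less_cancel_left_pos mult_le_cancel_left_pos)
  then show "truncate_to (side K * real n) f (side K * x) = 0" by (auto simp: truncate_to_def)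
qed

lemma gabor_bessel:
  assumes K: "K \<ge> 1" and f: "f \<in> L2" and F: "finite F" "F \<subseteq> Lambda_1x1 (2 * real K)"
  shows "(\<Sum>z\<in>F. gabor_energy f z) \<le> 2 * real K * (gtheta (pi * real K) 0)\<^sup>2 * (l2_norm f)\<^sup>2"
proof (rule bessel_bound_extend[OF gaussian_shift_L2 truncate_to_L2[OF f] f truncate_to_tendsto[OF f side_pos[OF K]] _ F])
  fix n G assume G: "finite G" "G \<subseteq> Lambda_1x1 (2 * real K)"
  note b = gabor_bounds_compact_support[OF K truncate_to_L2[OF f] truncate_to_support[OF K, of n]]
  show "(\<Sum>z\<in>G. gabor_energy (truncate_to (side K * real n) f) z)
      \<le> 2 * real K * (gtheta (pi * real K) 0)\<^sup>2 * (l2_norm (truncate_to (side K * real n) f))\<^sup>2"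
    by (rule order_trans[OF finite_sum_le_infsum[OF b(1) G] b(3)]) auto
qed

lemma gabor_lower_bound:
  assumes K: "K \<ge> 1" and f: "f \<in> L2"
  shows "2 * real K * (gtheta (pi * real K) (1/2))\<^sup>2 * (l2_norm f)\<^sup>2
    \<le> (\<Sum>\<^sub>\<infinity>z\<in>Lambda_1x1 (2 * real K). gabor_energy f z)"
  by (rule frame_lower_bound_extend[OF gaussian_shift_L2 truncate_to_L2[OF f] f
        truncate_to_tendsto[OF f side_pos[OF K]] gabor_bessel[OF K]
        gabor_bounds_compact_support(2)[OF K truncate_to_L2[OF f] truncate_to_support[OF K]]])

lemma gabor_form:
  assumes K: "K \<ge> 1" and f: "f \<in> L2"
  shows "Re (l2_inner (gabor_frame_operator (Lambda_1x1 (2 * real K)) f) f)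
    = (\<Sum>\<^sub>\<infinity>z\<in>Lambda_1x1 (2 * real K). gabor_energy f z) / (2 * real K)"
  using gabor_frame_operator_form[OF _ f gabor_bessel[OF K]] covolume_Lambda_1x1[of "2 * real K"] K by simp

lemma gabor_form_bounds:
  assumes K: "K \<ge> 1" and f: "f \<in> L2"
  defines "q \<equiv> Re (l2_inner (gabor_frame_operator (Lambda_1x1 (2 * real K)) f) f)"
  shows "(gtheta (pi * real K) (1/2))\<^sup>2 * (l2_norm f)\<^sup>2 \<le> q"
    and "q \<le> (gtheta (pi * real K) 0)\<^sup>2 * (l2_norm f)\<^sup>2"
proof -
  have K0: "real K > 0" using K by simp
  show "(gtheta (pi * real K) (1/2))\<^sup>2 * (l2_norm f)\<^sup>2 \<le> q"
    unfolding q_def gabor_form[OF K f] using gabor_lower_bound[OF K f] K0 by (simp add: field_simps)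
  have "(\<lambda>z. gabor_energy f z) summable_on Lambda_1x1 (2 * real K)"
    using gabor_bessel[OF K f] by (intro nonneg_bdd_above_summable_on bdd_aboveI2) auto
  from infsum_le_finite_sums[OF this gabor_bessel[OF K f]]
  show "q \<le> (gtheta (pi * real K) 0)\<^sup>2 * (l2_norm f)\<^sup>2"
    unfolding q_def gabor_form[OF K f] using K0 by (simp add: field_simps)
qed

section \<open>Sharpness\<close>


text \<open>The Stolz-Cesaro theorem with denominators n.\<close>

lemma cesaro_difference:
  fixes b :: "nat \<Rightarrow> real"
  assumes "(\<lambda>n. b (Suc n) - b n) \<longlonglongrightarrow> L"
  shows "(\<lambda>n. b n / real n) \<longlonglongrightarrow> L"
proof (rule LIMSEQ_I)
  fix \<epsilon> :: real assume \<epsilon>: "\<epsilon> > 0"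
  obtain N where N: "\<And>n. n \<ge> N \<Longrightarrow> \<bar>b (Suc n) - b n - L\<bar> < \<epsilon> / 2"
    using LIMSEQ_D[OF assms, of "\<epsilon> / 2"] \<epsilon> by auto
  have ind: "\<bar>b n - b N - L * (real n - real N)\<bar> \<le> \<epsilon> / 2 * (real n - real N)" if "n \<ge> N" for n
    using that
  proof (induction n rule: dec_induct)
    case (step n)
    have "b (Suc n) - b N - L * (real (Suc n) - real N) = (b (Suc n) - b n - L) + (b n - b N - L * (real n - real N))"
      by (simp add: algebra_simps)
    also have "\<bar>\<dots>\<bar> \<le> \<epsilon> / 2 + \<epsilon> / 2 * (real n - real N)"
      using N[OF step.hyps(1)] step.IH by (intro order_trans[OF abs_triangle_ineq] add_mono) auto
    finally show ?case by (simp add: field_simps)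
  qed simp
  define c where "c = \<bar>b N - L * real N\<bar>"
  obtain N' where N': "2 * c / \<epsilon> < real N'" using reals_Archimedean2 by blast
  have "\<bar>b n / real n - L\<bar> < \<epsilon>" if n: "n \<ge> max N (Suc N')" for n
  proof -
    have n0: "real n > 0" using n by simp
    have "2 * c / \<epsilon> < real n" using N' n by linarith
    then have cn: "c < \<epsilon> / 2 * real n" using \<epsilon> by (simp add: field_simps)
    have "\<epsilon> / 2 * (real n - real N) \<le> \<epsilon> / 2 * real n"
      using \<epsilon> by (intro mult_left_mono) auto
    moreover have "b n - L * real n = (b n - b N - L * (real n - real N)) + (b N - L * real N)"
      by (simp add: algebra_simps)
    ultimately have "\<bar>b n - L * real n\<bar> < \<epsilon> * real n"
      using ind[of n] n cn abs_triangle_ineq[of "b n - b N - L * (real n - real N)" "b N - L * real N"]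
      unfolding c_def by (simp add: field_simps)
    moreover have "b n / real n - L = (b n - L * real n) / real n"
      using n0 by (simp add: field_simps)
    ultimately show ?thesis using n0 by (simp add: abs_divide divide_less_eq)
  qed
  then show "\<exists>no. \<forall>n\<ge>no. norm (b n / real n - L) < \<epsilon>"
    unfolding real_norm_def by blast
qed

lemma toeplitz_form_mono_neutral:
  assumes "finite I" "J \<subseteq> I" "\<And>m. m \<in> I - J \<Longrightarrow> z m = 0"
  shows "toeplitz_form s I z = toeplitz_form s J z"
proof -
  have "toeplitz_form s I z = (\<Sum>m\<in>J. \<Sum>m'\<in>I. exp (- s * (of_int (m - m'))\<^sup>2) * Re (z m * cnj (z m')))"
    unfolding toeplitz_form_def using assms by (intro sum.mono_neutral_right) auto
  also have "\<dots> = toeplitz_form s J z"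
    unfolding toeplitz_form_def using assms by (intro sum.cong refl sum.mono_neutral_right) auto
  finally show ?thesis .
qed

text \<open>Enlarging the index range borders the matrix by a diagonal entry 1 and two equal lines,
  which together form a partial sum of the theta series at \<sigma>.\<close>

lemma toeplitz_form_Suc:
  fixes s \<sigma> :: real
  defines "p \<equiv> \<lambda>j. exp (- s * (real j)\<^sup>2) * cos (2 * pi * real j * \<sigma>)"
  shows "toeplitz_form s {0..<int (Suc M)} (\<lambda>m. fexp m \<sigma>) - toeplitz_form s {0..<int M} (\<lambda>m. fexp m \<sigma>)
    = 1 + 2 * (\<Sum>j<M. p (Suc j))"
proof -
  define g where "g j = exp (- s * (of_int j)\<^sup>2) * cos (2 * pi * of_int j * \<sigma>)" for j :: int
  have g_even: "g (- j) = g j" for j by (simp add: g_def)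
  have tf: "toeplitz_form s I (\<lambda>m. fexp m \<sigma>) = (\<Sum>m\<in>I. \<Sum>m'\<in>I. g (m - m'))" for I
  proof -
    have "Re (fexp m \<sigma> * cnj (fexp m' \<sigma>)) = cos (2 * pi * of_int (m - m') * \<sigma>)" for m m'
      unfolding cnj_fexp fexp_mult by (simp add: fexp_def)
    then show ?thesis unfolding toeplitz_form_def g_def by simp
  qed
  have ins: "{0..<int (Suc M)} = insert (int M) {0..<int M}" by auto
  have row: "(\<Sum>m\<in>{0..<int M}. g (int M - m)) = (\<Sum>j<M. p (Suc j))"
  proof -
    have "(\<Sum>m\<in>{0..<int M}. g (int M - m)) = (\<Sum>j<M. g (int M - int (M - Suc j)))"
      by (rule sum.reindex_bij_witness[of _ "\<lambda>j. int (M - Suc j)" "\<lambda>m. M - Suc (nat m)"]) auto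
    also have "\<dots> = (\<Sum>j<M. p (Suc j))"
      by (intro sum.cong refl) (auto simp: g_def p_def of_nat_diff)
    finally show ?thesis .
  qed
  have row': "(\<Sum>m\<in>{0..<int M}. g (m - int M)) = (\<Sum>j<M. p (Suc j))"
    using row g_even[of "int M - _"] by simp
  have "toeplitz_form s {0..<int (Suc M)} (\<lambda>m. fexp m \<sigma>) =
      (g 0 + (\<Sum>m\<in>{0..<int M}. g (int M - m))) + ((\<Sum>m\<in>{0..<int M}. g (m - int M)) + (\<Sum>m\<in>{0..<int M}. \<Sum>m'\<in>{0..<int M}. g (m - m')))"
    unfolding tf ins by (simp add: sum.distrib)
  then show ?thesis unfolding tf row row' by (simp add: g_def)
qed

text \<open>A truncated character has squared norm M, so these are Rayleigh quotients: characters
  are approximate eigenvectors, with the value of the symbol as eigenvalue.\<close>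

lemma toeplitz_form_average:
  assumes s: "s > 0"
  shows "(\<lambda>M. toeplitz_form s {0..<int M} (\<lambda>m. fexp m \<sigma>) / real M) \<longlonglongrightarrow> gtheta s \<sigma>"
proof (rule cesaro_difference)
  have "(\<lambda>M. \<Sum>j<M. exp (- s * (real (Suc j))\<^sup>2) * cos (2 * pi * real (Suc j) * \<sigma>))
      \<longlonglongrightarrow> (\<Sum>j. exp (- s * (real (Suc j))\<^sup>2) * cos (2 * pi * real (Suc j) * \<sigma>))"
    by (rule summable_LIMSEQ[OF summable_norm_cancel[OF gtheta_eq_suminf(2)[OF s]]])
  then show "(\<lambda>M. toeplitz_form s {0..<int (Suc M)} (\<lambda>m. fexp m \<sigma>) - toeplitz_form s {0..<int M} (\<lambda>m. fexp m \<sigma>)) \<longlonglongrightarrow> gtheta s \<sigma>"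
    unfolding toeplitz_form_Suc gtheta_eq_suminf(1)[OF s] by (intro tendsto_intros)
qed

text \<open>
  Concentrating the Zak transform of \<open>f\<close> near a point \<open>(x\<^sub>0, \<sigma>)\<close>, with \<open>2 K x\<^sub>0 = \<sigma>\<close>, makes the
  quotient of the quadratic forms approach the value \<open>\<theta>(\<sigma>)\<^sup>2\<close> of the symbol there.
\<close>
lemma gabor_form_sharp:
  assumes K: "K \<ge> 1" and \<sigma>: "0 \<le> \<sigma>" "\<sigma> \<le> 1/2" and \<eta>: "\<eta> > 0"
  shows "\<exists>f\<in>L2. (l2_norm f)\<^sup>2 > 0 \<and>
    \<bar>Re (l2_inner (gabor_frame_operator (Lambda_1x1 (2 * real K)) f) f) - (gtheta (pi * real K) \<sigma>)\<^sup>2 * (l2_norm f)\<^sup>2\<bar>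
      \<le> \<eta> * (l2_norm f)\<^sup>2"
proof -
  define s where "s = pi * real K"
  have s: "s > 0" using K by (simp add: s_def)
  define \<theta> where "\<theta> = gtheta s \<sigma>"
  \<comment> \<open>Two factors within \<delta> of \<theta> have a product within (|\<theta>| + 1)
    \<delta> + |\<theta>| \<delta> of \<theta>^2; the bound \<delta> \<le> 1 is used for the summand
    1.\<close>
  define \<delta> where "\<delta> = min 1 (\<eta> / (2 * \<bar>\<theta>\<bar> + 1))"
  have \<delta>: "\<delta> > 0" "\<delta> \<le> 1" "(2 * \<bar>\<theta>\<bar> + 1) * \<delta> \<le> \<eta>"
  proof -
    show "\<delta> > 0" "\<delta> \<le> 1" using \<eta> by (auto simp: \<delta>_def divide_pos_pos)
    have "\<delta> \<le> \<eta> / (2 * \<bar>\<theta>\<bar> + 1)" by (simp add: \<delta>_def)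
    then show "(2 * \<bar>\<theta>\<bar> + 1) * \<delta> \<le> \<eta>" by (simp add: pos_le_divide_eq mult.commute)
  qed
  define \<tau> where "\<tau> M = toeplitz_form s {0..<int M} (\<lambda>m. fexp m \<sigma>)" for M
  obtain M where M: "M \<ge> 1" "\<bar>\<tau> M / real M - \<theta>\<bar> < \<delta>"
  proof -
    obtain M0 where "\<And>n. n \<ge> M0 \<Longrightarrow> norm (\<tau> n / real n - \<theta>) < \<delta>"
      using LIMSEQ_D[OF toeplitz_form_average[OF s, of \<sigma>] \<delta>(1)] unfolding \<tau>_def \<theta>_def by blast
    from this[of "max M0 1"] show ?thesis using that[of "max M0 1"] by simp
  qed
  \<comment> \<open>At this position the factor theta (2 K x) equals theta (\<sigma>). Since x0
    \<le> 1/4 and \<epsilon> \<le> 1/2, the set \<open>A\<close> stays inside one period.\<close>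
  define x0 where "x0 = \<sigma> / (2 * real K)"
  have x0: "0 \<le> x0" "x0 \<le> 1/4"
    using \<sigma> K by (auto simp: x0_def divide_le_eq)
  have "isCont (\<lambda>x. gtheta s (2 * real K * x)) x0"
    by (intro isCont_o2[OF _ isCont_gtheta[OF s]] continuous_intros)
  then obtain r where r: "r > 0" "\<And>x. \<bar>x - x0\<bar> < r \<Longrightarrow> \<bar>gtheta s (2 * real K * x) - gtheta s (2 * real K * x0)\<bar> < \<delta>"
    using \<delta>(1) unfolding continuous_at_eps_delta dist_real_def by blast
  define \<epsilon> where "\<epsilon> = min r (1/2)"
  have \<epsilon>: "\<epsilon> > 0" "x0 + \<epsilon> \<le> 1" using r x0 by (auto simp: \<epsilon>_def)
  define A where "A = {x0..<x0 + \<epsilon>}"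
  have th: "\<bar>gtheta s (2 * real K * x) - \<theta>\<bar> \<le> \<delta>" if "x \<in> A" for x
  proof -
    have "2 * real K * x0 = \<sigma>" using K by (simp add: x0_def)
    then show ?thesis using r(2)[of x] that by (auto simp: A_def \<epsilon>_def \<theta>_def less_imp_le)
  qed
  \<comment> \<open>Localized to \<open>A\<close> in position, with the truncated character at
    \<sigma> along the integer translates: one approximate eigenvector for each of the two
    factors.\<close>
  define F where "F x = (\<Sum>m\<in>{0..<int M}. fexp m \<sigma> * indicator A (x - of_int m))" for x
  have F: "F (x + of_int m) = (if m \<in> {0..<int M} \<and> x \<in> A then fexp m \<sigma> else 0)" if "x \<in> {0..<1}" for x m
  proof -
    have "fexp j \<sigma> * indicator A (x + of_int m - of_int j) = (if j = m then fexp m \<sigma> * indicator A x else 0)" for j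
    proof (cases "j = m")
      case False
      have "\<not> (0 \<le> x + of_int m - of_int j \<and> x + of_int m - of_int j < 1)"
      proof
        assume "0 \<le> x + of_int m - of_int j \<and> x + of_int m - of_int j < 1"
        then have "of_int (m - j) < (1::real)" "of_int (j - m) < (1::real)" using that by auto
        then show False using False by linarith
      qed
      then have "x + of_int m - of_int j \<notin> A" using x0 \<epsilon> by (auto simp: A_def)
      then show ?thesis using False by simp
    qed simp
    then have "F (x + of_int m) = (\<Sum>j\<in>{0..<int M}. if j = m then fexp m \<sigma> * indicator A x else 0)"
      unfolding F_def by simp
    then show ?thesis by simp
  qed
  have Fsupp: "F x = 0" if "x < - real M \<or> real M \<le> x" for x
  proof -
    have "x = frac x + of_int \<lfloor>x\<rfloor>" by (simp add: frac_def)
    moreover have "\<lfloor>x\<rfloor> \<notin> {0..<int M}" using that by (auto simp: floor_less_iff le_floor_iff)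
    ultimately show ?thesis using F[of "frac x" "\<lfloor>x\<rfloor>"] frac_lt_1[of x] by (auto simp: frac_ge_0)
  qed
  define f where "f t = F (t / side K)" for t
  have fF: "f (side K * x) = F x" for x using side_pos[OF K] by (simp add: f_def)
  have fL: "f \<in> L2"
  proof -
    have A: "A \<in> sets lborel" by (simp add: A_def)
    have "square_integrable lborel (\<lambda>x. indicator A x)"
      unfolding square_integrable_def
    proof
      have "(\<lambda>x. (cmod (indicator A x))\<^sup>2) = indicat_real A" by (auto simp: indicator_def)
      moreover have "integrable lborel (indicat_real A)"
        using \<epsilon> by (intro integrable_real_indicator) (auto simp: A_def)
      ultimately show "integrable lborel (\<lambda>x. (cmod (indicator A x))\<^sup>2)" by simp
    qed (use A in simp)
    then have "square_integrable lborel (\<lambda>x. indicator A (x - of_int m))" for m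
      using lborel_integrable_real_affine[of "\<lambda>x. (cmod (indicator A x))\<^sup>2" 1 "- of_int m"]
      by (auto simp: square_integrable_def A_def)
    then have "square_integrable lborel F"
      unfolding F_def by (intro square_integrable_sum square_integrable_cmult)
    then have "square_integrable lborel (\<lambda>t. F (inverse (side K) * t))"
      using side_pos[OF K] by (intro square_integrable_dilate) auto
    then show ?thesis by (simp add: L2_iff f_def[abs_def] divide_inverse mult.commute)
  qed
  have supp: "\<forall>x. x < - real M \<or> real M \<le> x \<longrightarrow> f (side K * x) = 0"
    using Fsupp fF by simp
  have sub: "{0..<int M} \<subseteq> {- int M..<int M}" by auto
  have nrm: "(l2_norm f)\<^sup>2 = side K * (real M * \<epsilon>)"
  proof -
    have "(LINT x|unit_interval. (\<Sum>m\<in>{- int M..<int M}. (cmod (F (x + of_int m)))\<^sup>2)) = (LINT x|unit_interval. real M * indicator A x)"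
    proof (rule Bochner_Integration.integral_cong[OF refl])
      fix x assume x: "x \<in> space unit_interval"
      have "(\<Sum>m\<in>{- int M..<int M}. (cmod (F (x + of_int m)))\<^sup>2) = (\<Sum>m\<in>{0..<int M}. (cmod (F (x + of_int m)))\<^sup>2)"
        using x F by (intro sum.mono_neutral_right) auto
      also have "\<dots> = (\<Sum>m\<in>{0..<int M}. indicator A x)"
        using x F by (intro sum.cong refl) auto
      finally show "(\<Sum>m\<in>{- int M..<int M}. (cmod (F (x + of_int m)))\<^sup>2) = real M * indicator A x" by simp
    qed
    also have "\<dots> = real M * \<epsilon>"
    proof -
      have "measure unit_interval A = \<epsilon>"
        using x0 \<epsilon> by (subst measure_restrict_space) (auto simp: A_def)
      then show ?thesis using x0 \<epsilon> by (simp add: A_def sets_restrict_space_iff Int_absorb2)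
    qed
    finally show ?thesis using compact_support_norm_sq(1)[OF K fL supp] by (simp add: fF)
  qed
  define J where "J = (LINT x|unit_interval. gtheta s (2 * real K * x) * indicator A x)"
  have mA: "measure unit_interval A = \<epsilon>" "A \<in> sets unit_interval"
    using x0 \<epsilon> by (auto simp: A_def measure_restrict_space sets_restrict_space_iff)
  have gm: "(\<lambda>x. gtheta s (2 * real K * x)) \<in> borel_measurable borel"
    by (intro borel_measurable_continuous_onI continuous_on_compose2[OF continuous_on_gtheta[OF s]] continuous_intros) auto
  have Ji: "integrable unit_interval (\<lambda>x. gtheta s (2 * real K * x) * indicator A x)"
  proof (rule Bochner_Integration.integrable_bound)
    show "integrable unit_interval (\<lambda>x. (\<bar>\<theta>\<bar> + \<delta>) * indicator A x)"
      using mA(2) by (intro integrable_mult_right) (simp add: unit_interval.emeasure_eq_measure)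
    show "(\<lambda>x. gtheta s (2 * real K * x) * indicator A x) \<in> borel_measurable unit_interval"
      using gm mA(2) by (intro borel_measurable_times borel_measurable_indicator measurable_unit_interval) auto
    have "\<bar>gtheta s (2 * real K * x)\<bar> \<le> \<bar>\<theta>\<bar> + \<delta>" if "x \<in> A" for x using th[OF that] by linarith
    then show "AE x in unit_interval. norm (gtheta s (2 * real K * x) * indicator A x) \<le> norm ((\<bar>\<theta>\<bar> + \<delta>) * indicator A x)"
      using \<delta>(1) by (auto simp: indicator_def)
  qed
  have Jb: "\<bar>J / \<epsilon> - \<theta>\<bar> \<le> \<delta>"
  proof -
    have ind: "integrable unit_interval (\<lambda>x. c * indicator A x)" "(LINT x|unit_interval. c * indicator A x) = c * \<epsilon>" for c :: real
    proof -
      have "A \<inter> {0..<1} = A" using x0 \<epsilon> by (auto simp: A_def)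
      then show "integrable unit_interval (\<lambda>x. c * indicator A x)" "(LINT x|unit_interval. c * indicator A x) = c * \<epsilon>"
        using mA by (auto simp: unit_interval.emeasure_eq_measure)
    qed
    have "(\<theta> - \<delta>) * \<epsilon> \<le> J"
      unfolding J_def ind(2)[symmetric] using th by (intro integral_mono ind(1) Ji) (auto simp: indicator_def abs_le_iff algebra_simps dest: th)
    moreover have "J \<le> (\<theta> + \<delta>) * \<epsilon>"
      unfolding J_def ind(2)[symmetric] using th by (intro integral_mono ind(1) Ji) (auto simp: indicator_def abs_le_iff algebra_simps dest: th)
    ultimately have "\<theta> - \<delta> \<le> J / \<epsilon>" "J / \<epsilon> \<le> \<theta> + \<delta>"
      using \<epsilon>(1) by (auto simp: field_simps)
    then show ?thesis by linarith
  qed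
  \<comment> \<open>The form separates: \<open>J / \<epsilon>\<close> is the mean of theta (2 K x)
    over \<open>A\<close>, and \<open>\<tau> M / real M\<close> is the Rayleigh quotient of the
    Toeplitz form.\<close>
  have q: "Re (l2_inner (gabor_frame_operator (Lambda_1x1 (2 * real K)) f) f) = (J / \<epsilon>) * (\<tau> M / real M) * (l2_norm f)\<^sup>2"
  proof -
    have T: "toeplitz_form s {- int M..<int M} (\<lambda>m. F (x + of_int m)) = indicator A x * \<tau> M" if "x \<in> {0..<1}" for x
    proof -
      have "toeplitz_form s {- int M..<int M} (\<lambda>m. F (x + of_int m)) = toeplitz_form s {0..<int M} (\<lambda>m. F (x + of_int m))"
        using F[OF that] by (intro toeplitz_form_mono_neutral) auto
      also have "\<dots> = indicator A x * \<tau> M"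
        unfolding toeplitz_form_def \<tau>_def sum_distrib_left
        using F[OF that] by (intro sum.cong refl) auto
      finally show ?thesis .
    qed
    have "(LINT x|unit_interval. gtheta s (2 * real K * x) * toeplitz_form s {- int M..<int M} (\<lambda>m. F (x + of_int m)))
        = (LINT x|unit_interval. (gtheta s (2 * real K * x) * indicator A x) * \<tau> M)"
      by (rule Bochner_Integration.integral_cong[OF refl]) (use T in simp)
    also have "\<dots> = J * \<tau> M" by (simp add: J_def)
    finally have I: "(LINT x|unit_interval. gtheta s (2 * real K * x) * toeplitz_form s {- int M..<int M} (\<lambda>m. F (x + of_int m))) = J * \<tau> M" .
    have "Re (l2_inner (gabor_frame_operator (Lambda_1x1 (2 * real K)) f) f) = side K * (J * \<tau> M)"
      unfolding gabor_form[OF K fL] gabor_bounds_compact_support(4)[OF K fL supp] fF s_def[symmetric] I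
      using K by simp
    then show ?thesis using \<epsilon>(1) M(1) by (simp add: nrm)
  qed
  define a where "a = J / \<epsilon>"
  define b where "b = \<tau> M / real M"
  have ab: "\<bar>a - \<theta>\<bar> \<le> \<delta>" "\<bar>b - \<theta>\<bar> \<le> \<delta>" using Jb M(2) by (auto simp: a_def b_def)
  have "\<bar>a * b - \<theta>\<^sup>2\<bar> = \<bar>a * (b - \<theta>) + \<theta> * (a - \<theta>)\<bar>"
    by (simp add: power2_eq_square algebra_simps)
  also have "\<dots> \<le> \<bar>a\<bar> * \<bar>b - \<theta>\<bar> + \<bar>\<theta>\<bar> * \<bar>a - \<theta>\<bar>"
    by (metis abs_mult abs_triangle_ineq)
  also have "\<dots> \<le> (\<bar>\<theta>\<bar> + 1) * \<delta> + \<bar>\<theta>\<bar> * \<delta>"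
    using ab \<delta> by (intro add_mono mult_mono) auto
  also have "\<dots> \<le> \<eta>" using \<delta>(3) by (simp add: algebra_simps)
  finally have "\<bar>a * b - \<theta>\<^sup>2\<bar> * (l2_norm f)\<^sup>2 \<le> \<eta> * (l2_norm f)\<^sup>2"
    by (intro mult_right_mono) auto
  moreover have "\<bar>a * b - \<theta>\<^sup>2\<bar> * (l2_norm f)\<^sup>2 = \<bar>a * b * (l2_norm f)\<^sup>2 - \<theta>\<^sup>2 * (l2_norm f)\<^sup>2\<bar>"
    by (simp add: abs_mult flip: left_diff_distrib)
  moreover have "(l2_norm f)\<^sup>2 > 0"
    unfolding nrm using side_pos[OF K] M(1) \<epsilon>(1) by simp
  ultimately show ?thesis
    using fL by (intro bexI[of _ f]) (auto simp: q a_def b_def \<theta>_def s_def)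
qed

text \<open>The extreme values of the form are approached by test functions at \<sigma> = 1/2 and
  \<sigma> = 0, so no bound can be improved by any \<eta> > 0, and \<open>GREATEST\<close> and
  \<open>LEAST\<close> are attained.\<close>

theorem spectral_bounds_even_density:
  assumes K: "K \<ge> 1"
  shows "A_1x1 (2 * real K) = (gtheta (pi * real K) (1/2))\<^sup>2"
    and "B_1x1 (2 * real K) = (gtheta (pi * real K) 0)\<^sup>2"
proof -
  define q where "q f = Re (l2_inner (gabor_frame_operator (Lambda_1x1 (2 * real K)) f) f)" for f
  show "A_1x1 (2 * real K) = (gtheta (pi * real K) (1/2))\<^sup>2"
    unfolding A_1x1_def lower_spectral_bound_def q_def[symmetric]
  proof (rule Greatest_equality)
    show "\<forall>f\<in>L2. (gtheta (pi * real K) (1/2))\<^sup>2 * (l2_norm f)\<^sup>2 \<le> q f"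
      using gabor_form_bounds(1)[OF K] by (simp add: q_def)
    fix A assume A: "\<forall>f\<in>L2. A * (l2_norm f)\<^sup>2 \<le> q f"
    show "A \<le> (gtheta (pi * real K) (1/2))\<^sup>2"
    proof (rule field_le_epsilon)
      fix \<eta> :: real assume "\<eta> > 0"
      then obtain f where f: "f \<in> L2" "(l2_norm f)\<^sup>2 > 0" "\<bar>q f - (gtheta (pi * real K) (1/2))\<^sup>2 * (l2_norm f)\<^sup>2\<bar> \<le> \<eta> * (l2_norm f)\<^sup>2"
        using gabor_form_sharp[OF K, of "1/2" \<eta>] by (auto simp: q_def)
      have "A * (l2_norm f)\<^sup>2 \<le> ((gtheta (pi * real K) (1/2))\<^sup>2 + \<eta>) * (l2_norm f)\<^sup>2"
        using bspec[OF A f(1)] f(3) unfolding distrib_right by linarith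
      then show "A \<le> (gtheta (pi * real K) (1/2))\<^sup>2 + \<eta>"
        using f(2) by (rule mult_right_le_imp_le)
    qed
  qed
  show "B_1x1 (2 * real K) = (gtheta (pi * real K) 0)\<^sup>2"
    unfolding B_1x1_def upper_spectral_bound_def q_def[symmetric]
  proof (rule Least_equality)
    show "\<forall>f\<in>L2. q f \<le> (gtheta (pi * real K) 0)\<^sup>2 * (l2_norm f)\<^sup>2"
      using gabor_form_bounds(2)[OF K] by (simp add: q_def)
    fix B assume B: "\<forall>f\<in>L2. q f \<le> B * (l2_norm f)\<^sup>2"
    show "(gtheta (pi * real K) 0)\<^sup>2 \<le> B"
    proof (rule field_le_epsilon)
      fix \<eta> :: real assume "\<eta> > 0"
      then obtain f where f: "f \<in> L2" "(l2_norm f)\<^sup>2 > 0" "\<bar>q f - (gtheta (pi * real K) 0)\<^sup>2 * (l2_norm f)\<^sup>2\<bar> \<le> \<eta> * (l2_norm f)\<^sup>2"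
        using gabor_form_sharp[OF K, of 0 \<eta>] by (auto simp: q_def)
      have "(gtheta (pi * real K) 0)\<^sup>2 * (l2_norm f)\<^sup>2 \<le> (B + \<eta>) * (l2_norm f)\<^sup>2"
        using bspec[OF B f(1)] f(3) unfolding distrib_right by linarith
      then show "(gtheta (pi * real K) 0)\<^sup>2 \<le> B + \<eta>"
        using f(2) by (rule mult_right_le_imp_le)
    qed
  qed
qed

section \<open>The arithmetic-geometric iteration realized by theta values\<close>

lemma ag2_iter_gtheta:
  defines "Y \<equiv> (gtheta pi (1/2))\<^sup>2"
  shows "ag2_iter (sqrt 2) 1 n = ((gtheta (2 ^ n * pi) 0)\<^sup>2 / Y, (gtheta (2 ^ n * pi) (1/2))\<^sup>2 / Y)"
proof (induction n)
  case 0
  \<comment> \<open>Division by \<open>Y\<close> normalizes the smaller start value to 1, and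
    \<open>gtheta_pi_ratio\<close> then makes the larger one sqrt 2. Both means are homogeneous, so
    the normalization survives each step.\<close>
  have "Y > 0" using gtheta_half_pos[of pi] pi_gt3 by (simp add: Y_def)
  then show ?case using gtheta_pi_ratio by (simp add: Y_def)
next
  case (Suc n)
  define s where "s = 2 ^ n * pi"
  have s: "s \<ge> 3" using pi_mult_ge_3[of "2 ^ n"] by (simp add: s_def mult.commute)
  then have s0: "s > 0" by simp
  have Y: "Y > 0" using gtheta_half_pos[of pi] pi_gt3 by (simp add: Y_def)
  have pos: "gtheta s 0 > 0" "gtheta s (1/2) > 0" using gtheta_0_pos[OF s0] gtheta_half_pos[OF s] .
  have 2: "2 ^ Suc n * pi = 2 * s" by (simp add: s_def)
  have "sqrt ((gtheta s 0)\<^sup>2 / Y * ((gtheta s (1/2))\<^sup>2 / Y)) = sqrt ((gtheta s 0 * gtheta s (1/2) / Y)\<^sup>2)"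
    by (simp add: power_mult_distrib power_divide power2_eq_square)
  also have "\<dots> = gtheta s 0 * gtheta s (1/2) / Y"
    using pos Y by (intro real_sqrt_unique) auto
  finally have e: "sqrt ((gtheta s 0)\<^sup>2 / Y * ((gtheta s (1/2))\<^sup>2 / Y)) = (gtheta (2 * s) (1/2))\<^sup>2 / Y"
    by (simp only: gtheta_double_half[OF s0])
  have "((gtheta s 0)\<^sup>2 / Y + (gtheta s (1/2))\<^sup>2 / Y) / 2 = (gtheta (2 * s) 0)\<^sup>2 / Y"
    by (simp add: gtheta_double_0[OF s0] add_divide_distrib)
  with e show ?case
    unfolding ag2_iter.simps(2) Suc.IH 2 s_def[symmetric] by (simp only: Let_def prod.case)
qed

theorem theorem1p1:
  shows "(\<forall>n::nat. n \<ge> 1 \<longrightarrow>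
            B_1x1 (2 ^ (n + 1)) = (A_1x1 (2 ^ n) + B_1x1 (2 ^ n)) / 2 \<and>
            A_1x1 (2 ^ (n + 1)) = sqrt (A_1x1 (2 ^ n) * B_1x1 (2 ^ n))) \<and>
         B_1x1 2 / A_1x1 2 = sqrt 2 \<and>
         A_1x1 2 = gauss_constant \<and>
         gauss_constant = 1 / ag2 (sqrt 2) 1 \<and>
         1 / ag2 (sqrt 2) 1 = (theta4 (exp (- pi)))\<^sup>2 \<and>
         0.8346 \<le> A_1x1 2 \<and> A_1x1 2 < 0.8347"
proof -
  define Y where "Y = (gtheta pi (1/2))\<^sup>2"
  have Y: "Y > 0" using gtheta_half_pos[of pi] pi_gt3 by (simp add: Y_def)
  have AB: "A_1x1 (2 ^ n) = (gtheta (2 ^ (n - 1) * pi) (1/2))\<^sup>2" "B_1x1 (2 ^ n) = (gtheta (2 ^ (n - 1) * pi) 0)\<^sup>2"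
    if "n \<ge> 1" for n
  proof -
    \<comment> \<open>Density 2^n is 2 K with K = 2^(n - 1), so the theta parameter is 2^(n - 1) pi;
      n \<ge> 1 keeps the truncated subtraction exact.\<close>
    have "(2::real) ^ n = 2 * real (2 ^ (n - 1))" using that by (cases n) auto
    then show "A_1x1 (2 ^ n) = (gtheta (2 ^ (n - 1) * pi) (1/2))\<^sup>2" "B_1x1 (2 ^ n) = (gtheta (2 ^ (n - 1) * pi) 0)\<^sup>2"
      using spectral_bounds_even_density[of "2 ^ (n - 1)"] by (simp_all add: mult.commute)
  qed
  have A2: "A_1x1 2 = Y" and B2: "B_1x1 2 = sqrt 2 * Y"
    using AB[of 1] gtheta_pi_ratio by (simp_all add: Y_def)
  have rec: "B_1x1 (2 ^ (n + 1)) = (A_1x1 (2 ^ n) + B_1x1 (2 ^ n)) / 2"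
    "A_1x1 (2 ^ (n + 1)) = sqrt (A_1x1 (2 ^ n) * B_1x1 (2 ^ n))" if n: "n \<ge> 1" for n
  proof -
    define s where "s = 2 ^ (n - 1) * pi"
    have s: "s \<ge> 3" using pi_mult_ge_3[of "2 ^ (n - 1)"] by (simp add: s_def mult.commute)
    then have s0: "s > 0" by simp
    have 2: "2 ^ (n + 1 - 1) * pi = 2 * s" using n by (cases n) (auto simp: s_def)
    have pos: "gtheta s 0 > 0" "gtheta s (1/2) > 0" using gtheta_0_pos[OF s0] gtheta_half_pos[OF s] .
    show "B_1x1 (2 ^ (n + 1)) = (A_1x1 (2 ^ n) + B_1x1 (2 ^ n)) / 2"
      unfolding AB[OF n] AB(2)[OF le_add2] 2 s_def[symmetric] gtheta_double_0[OF s0] by (simp only: add.commute)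
    have "sqrt ((gtheta s (1/2))\<^sup>2 * (gtheta s 0)\<^sup>2) = gtheta s 0 * gtheta s (1/2)"
      using pos by (intro real_sqrt_unique) (auto simp: power_mult_distrib)
    then show "A_1x1 (2 ^ (n + 1)) = sqrt (A_1x1 (2 ^ n) * B_1x1 (2 ^ n))"
      unfolding AB[OF n] AB(1)[OF le_add2] 2 s_def[symmetric] gtheta_double_half[OF s0] by simp
  qed
  define l where "l = 1 / Y"
  have l: "l > 0" using Y by (simp add: l_def)
  \<comment> \<open>Theta values tend to 1 at every x, so both means tend to 1 / Y; this provides
    the convergence of the iteration as well as its limit.\<close>
  have "(\<lambda>n. (gtheta (2 ^ n * pi) x)\<^sup>2 / Y) \<longlonglongrightarrow> 1\<^sup>2 / Y" for x
    using Y by (intro tendsto_intros gtheta_limit) auto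
  then have lim: "(\<lambda>n. fst (ag2_iter (sqrt 2) 1 n)) \<longlonglongrightarrow> l" "(\<lambda>n. snd (ag2_iter (sqrt 2) 1 n)) \<longlonglongrightarrow> l"
    unfolding ag2_iter_gtheta Y_def[symmetric] by (simp_all add: l_def)
  have ag: "1 / ag2 (sqrt 2) 1 = Y"
    unfolding ag2_eqI[OF lim] by (simp add: l_def)
  have g: "gauss_constant = Y"
    using gauss_constant_eq[OF l lim] by (simp add: l_def)
  have t: "(theta4 (exp (- pi)))\<^sup>2 = Y"
    by (simp add: theta4_eq_gtheta Y_def)
  have num: "0.8346 \<le> Y" "Y < 0.8347"
    using ag2_sqrt2_bounds[OF lim] by (simp_all add: l_def)
  show ?thesis
    unfolding A2 B2 ag g t using rec Y num by auto
qed

end
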